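(* Let $G$ be a Cohen--Macaulay Cameron--Walker graph with $m$ pendant triangles. Then the Cohen--Macaulay type of $G$ is equal to $2^m$. In particular, there is no Gorenstein Cameron--Walker graph.
   Context: All graphs are finite and simple. A matching of $G$ is a set $M$ of pairwise disjoint edges; $m(G)$ is the maximum size of a matching. A matching $M$ is an induced matching if for distinct $e,e'\in M$ there is no edge $f\in E(G)$ with $f\cap e\neq\emptyset$ and $f\cap e'\neq\emptyset$; $im(G)$ is the maximum size of an induced matching. A star is a complete bipartite graph $K_{1,k}$ with $k\ge 0$ (a single vertex counts as a star). A star triangle is a graph obtained by joining some number ($\geq 1$) of triangles at one common vertex. A Cameron--Walker graph is a finite connected simple graph $G$ with $im(G)=m(G)$ that is neither a star nor a star triangle. A pendant triangle is a triangle two of whose vertices have degree $2$ and whose remaining vertex has degree more than $2$. Let $K$ be a field. For a graph $G$ with vertex set $V$, let $S=K[x_v : v\in V]$ and $I(G)=(x_ux_v : \{u,v\}\in E(G))\subset S$. $G$ is Cohen--Macaulay (resp. Gorenstein) if $S/I(G)$ is Cohen--Macaulay (resp. Gorenstein). When $G$ is Cohen--Macaulay, the Cohen--Macaulay type of $G$ is the Cohen--Macaulay type of $S/I(G)$, that is, the $K$-dimension of the socle of $S/(I(G)+(\mathbf{x}))$ for a linear system of parameters $\mathbf{x}$ of $S/I(G)$ (when one exists over $K$); equivalently, the last nonzero total Betti number in the minimal graded free resolution of $S/I(G)$ over $S$. $G$ is Gorenstein if and only if $G$ is Cohen--Macaulay of type $1$. *)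

theory Defs
  imports "HOL-Library.Poly_Mapping" "HOL-Library.Extended_Nat"
begin

text \<open>
  A finite simple graph is given by its edge set; its vertex set is the whole (finite, nonempty)
  vertex type \<open>'v\<close>. Matchings, stars etc. are therefore relative to all vertices of the type.
\<close>

definition simple_graph :: "'v::finite set set \<Rightarrow> bool" where
  "simple_graph E \<longleftrightarrow> (\<forall>e\<in>E. card e = 2)"

definition connected_graph :: "'v::finite set set \<Rightarrow> bool" where
  "connected_graph E \<longleftrightarrow> (\<forall>u v. (u, v) \<in> {(a, b). {a, b} \<in> E}\<^sup>*)"

definition degree :: "'v::finite set set \<Rightarrow> 'v \<Rightarrow> nat" where
  "degree E v = card {e \<in> E. v \<in> e}"

definition matching :: "'v::finite set set \<Rightarrow> 'v set set \<Rightarrow> bool" where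
  "matching E M \<longleftrightarrow> M \<subseteq> E \<and> (\<forall>e\<in>M. \<forall>e'\<in>M. e \<noteq> e' \<longrightarrow> e \<inter> e' = {})"

definition induced_matching :: "'v::finite set set \<Rightarrow> 'v set set \<Rightarrow> bool" where
  "induced_matching E M \<longleftrightarrow> matching E M \<and>
     (\<forall>e\<in>M. \<forall>e'\<in>M. e \<noteq> e' \<longrightarrow> \<not> (\<exists>f\<in>E. f \<inter> e \<noteq> {} \<and> f \<inter> e' \<noteq> {}))"

definition matching_number :: "'v::finite set set \<Rightarrow> nat" where
  "matching_number E = Max {card M | M. matching E M}"

definition induced_matching_number :: "'v::finite set set \<Rightarrow> nat" where
  "induced_matching_number E = Max {card M | M. induced_matching E M}"

definition is_star :: "'v::finite set set \<Rightarrow> bool" where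
  "is_star E \<longleftrightarrow> (\<exists>c. E = {{c, v} | v. v \<noteq> c})"

text \<open>In a star triangle with centre \<open>c\<close>, the set \<open>T\<close> consists of the edges opposite to \<open>c\<close>.\<close>

definition is_star_triangle :: "'v::finite set set \<Rightarrow> bool" where
  "is_star_triangle E \<longleftrightarrow>
     (\<exists>c T. T \<noteq> {} \<and> (\<forall>e\<in>T. card e = 2) \<and> (\<forall>e\<in>T. \<forall>e'\<in>T. e \<noteq> e' \<longrightarrow> e \<inter> e' = {}) \<and>
            \<Union>T = UNIV - {c} \<and> E = T \<union> {{c, v} | v. v \<noteq> c})"

definition cameron_walker :: "'v::finite set set \<Rightarrow> bool" where
  "cameron_walker E \<longleftrightarrow> simple_graph E \<and> connected_graph E \<and>
     induced_matching_number E = matching_number E \<and> \<not> is_star E \<and> \<not> is_star_triangle E"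

definition pendant_triangle :: "'v::finite set set \<Rightarrow> 'v set \<Rightarrow> bool" where
  "pendant_triangle E T \<longleftrightarrow>
     (\<exists>a b c. T = {a, b, c} \<and> a \<noteq> b \<and> a \<noteq> c \<and> b \<noteq> c \<and>
              {a, b} \<in> E \<and> {a, c} \<in> E \<and> {b, c} \<in> E \<and>
              degree E a = 2 \<and> degree E b = 2 \<and> degree E c > 2)"

text \<open>
  The ring \<open>S = K[x\<^sub>v : v \<in> V]\<close>: a monomial is an exponent vector, a polynomial maps monomials to
  coefficients.
\<close>

type_synonym ('v, 'k) mpoly = "('v \<Rightarrow>\<^sub>0 nat) \<Rightarrow>\<^sub>0 'k"

definition Const :: "'k::field \<Rightarrow> ('v, 'k) mpoly" where
  "Const c = Poly_Mapping.single 0 c"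

definition Var :: "'v \<Rightarrow> ('v, 'k::field) mpoly" where
  "Var v = Poly_Mapping.single (Poly_Mapping.single v 1) 1"

text \<open>A commutative ring is a module over itself; its ideals are the submodules.\<close>

abbreviation ideal_of :: "'a::comm_ring_1 set \<Rightarrow> 'a set" where
  "ideal_of B \<equiv> module.span (*) B"

abbreviation is_ideal :: "'a::comm_ring_1 set \<Rightarrow> bool" where
  "is_ideal J \<equiv> module.subspace (*) J"

definition prime_ideal :: "'a::comm_ring_1 set \<Rightarrow> bool" where
  "prime_ideal P \<longleftrightarrow> is_ideal P \<and> P \<noteq> UNIV \<and> (\<forall>a b. a * b \<in> P \<longrightarrow> a \<in> P \<or> b \<in> P)"

definition homogeneous_of_degree :: "nat \<Rightarrow> ('v::finite, 'k::field) mpoly \<Rightarrow> bool" where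
  "homogeneous_of_degree n f \<longleftrightarrow>
     (\<forall>t \<in> Poly_Mapping.keys f. (\<Sum>v\<in>UNIV. Poly_Mapping.lookup t v) = n)"

definition edge_ideal :: "'v::finite set set \<Rightarrow> ('v, 'k::field) mpoly set" where
  "edge_ideal E = ideal_of {Var u * Var v | u v. {u, v} \<in> E}"

text \<open>
  All notions below concern the graded quotient ring \<open>S/I\<close> of a homogeneous ideal \<open>I\<close>, expressed
  inside \<open>S\<close>: ideals of \<open>S/I\<close> are ideals of \<open>S\<close> containing \<open>I\<close>, and elements of \<open>S/I\<close> are given by
  representatives.
\<close>

definition krull_dim :: "'a::comm_ring_1 set \<Rightarrow> enat" where
  "krull_dim I = (SUP n \<in> {n. \<exists>P :: nat \<Rightarrow> 'a set.
       (\<forall>i\<le>n. prime_ideal (P i) \<and> I \<subseteq> P i) \<and> (\<forall>i<n. P i \<subset> P (Suc i))}. enat n)"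

definition regular_sequence :: "'a::comm_ring_1 set \<Rightarrow> 'a list \<Rightarrow> bool" where
  "regular_sequence I \<theta> \<longleftrightarrow> ideal_of (I \<union> set \<theta>) \<noteq> UNIV \<and>
     (\<forall>i < length \<theta>. \<forall>f. \<theta> ! i * f \<in> ideal_of (I \<union> set (take i \<theta>)) \<longrightarrow>
                         f \<in> ideal_of (I \<union> set (take i \<theta>)))"

definition positive_homogeneous :: "('v::finite, 'k::field) mpoly list \<Rightarrow> bool" where
  "positive_homogeneous \<theta> \<longleftrightarrow> (\<forall>f \<in> set \<theta>. \<exists>n>0. homogeneous_of_degree n f)"

text \<open>
  The depth of the graded ring \<open>S/I\<close>: the maximal length of a homogeneous regular sequence in the
  irrelevant ideal.
\<close>

definition depth :: "('v::finite, 'k::field) mpoly set \<Rightarrow> enat" where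
  "depth I = (SUP \<theta> \<in> {\<theta>. positive_homogeneous \<theta> \<and> regular_sequence I \<theta>}. enat (length \<theta>))"

definition cohen_macaulay :: "('v::finite, 'k::field) mpoly set \<Rightarrow> bool" where
  "cohen_macaulay I \<longleftrightarrow> depth I = krull_dim I"

text \<open>
  The \<open>K\<close>-dimension of \<open>W/U\<close>, for \<open>K\<close>-subspaces \<open>U \<subseteq> W\<close> of \<open>S\<close>, as the maximal number of elements
  of \<open>W\<close> that are linearly independent modulo \<open>U\<close> (and \<open>\<infinity>\<close> if there is no maximum).
\<close>

definition independent_mod :: "('v, 'k::field) mpoly set \<Rightarrow> ('v, 'k) mpoly set \<Rightarrow> bool" where
  "independent_mod U B \<longleftrightarrow>
     (\<forall>c. (\<Sum>b\<in>B. Const (c b) * b) \<in> U \<longrightarrow> (\<forall>b\<in>B. c b = 0))"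

definition quotient_dim :: "('v, 'k::field) mpoly set \<Rightarrow> ('v, 'k) mpoly set \<Rightarrow> enat" where
  "quotient_dim W U = (SUP B \<in> {B. finite B \<and> B \<subseteq> W \<and> independent_mod U B}. enat (card B))"

text \<open>
  A homogeneous system of parameters of \<open>S/I\<close>. Linear ones need not exist over a finite field,
  whereas homogeneous ones always do.
\<close>

definition is_hsop :: "('v::finite, 'k::field) mpoly set \<Rightarrow> ('v, 'k) mpoly list \<Rightarrow> bool" where
  "is_hsop I \<theta> \<longleftrightarrow> positive_homogeneous \<theta> \<and> enat (length \<theta>) = krull_dim I \<and>
     quotient_dim UNIV (ideal_of (I \<union> set \<theta>)) < \<infinity>"

definition socle_dim :: "('v, 'k::field) mpoly set \<Rightarrow> enat" where
  "socle_dim J = quotient_dim {f. \<forall>v. Var v * f \<in> J} J"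

text \<open>
  For Cohen-Macaulay \<open>S/I\<close>, the socle dimension of \<open>S/(I + (\<theta>))\<close> is the same for every homogeneous
  system of parameters \<open>\<theta>\<close>, in particular for every linear one; the type is this common value.
\<close>

definition cm_type :: "('v::finite, 'k::field) mpoly set \<Rightarrow> enat" where
  "cm_type I = (THE t. \<forall>\<theta>. is_hsop I \<theta> \<longrightarrow> socle_dim (ideal_of (I \<union> set \<theta>)) = t)"

definition gorenstein :: "('v::finite, 'k::field) mpoly set \<Rightarrow> bool" where
  "gorenstein I \<longleftrightarrow> cohen_macaulay I \<and> cm_type I = 1"

end

theory Submission
  imports Defs
begin

text \<open>
  Let \<open>I\<close> be the edge ideal of \<open>G\<close> in the polynomial ring \<open>S\<close>. The proof combines the shape of an
  unmixed Cameron--Walker graph with the invariance of the type.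

  The graph. Take an induced matching that is at the same time a maximum matching. The unmatched
  vertices are independent, and since there is no augmenting path, an edge of the matching either has
  one end that is a leaf, or both of its ends have the same single unmatched neighbour, with which
  they form a triangle. If all maximal independent sets have the same size, a comparison of three of
  them shows that every unmatched vertex is the apex of exactly one such triangle
  (\<open>cameron_walker_unmixed_structure\<close>). Hence \<open>G\<close> consists of edges \<open>{a, l a}\<close> for \<open>a \<in> A\<close>, triangles
  \<open>{b, c b, d b}\<close> for \<open>b \<in> B\<close>, and edges between \<open>A\<close> and \<open>B\<close>. The triangles are precisely the
  pendant triangles, so that \<open>m = |B|\<close>, and \<open>B\<close> is not empty.

  Unmixedness. Let \<open>F\<close> be a maximal independent set. The dimension of \<open>S/I\<close> is at least \<open>|F|\<close>, because
  the variables outside \<open>F\<close> generate a prime containing \<open>I\<close>. The depth is at most \<open>|F|\<close>, because the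
  product of the variables in \<open>F\<close> is a nonzero element of \<open>S/I\<close> whose annihilator contains all
  variables outside \<open>F\<close>. If \<open>S/I\<close> is Cohen--Macaulay, both numbers are therefore equal to \<open>|F|\<close>,
  and there is a homogeneous regular sequence of this length (\<open>cohen_macaulay_unmixed\<close>).

  Invariance of the type. The socle of \<open>S/(I + (\<theta>))\<close> is the degree \<open>0\<close> cohomology of the Koszul complex
  on all variables with coefficients in \<open>S/(I + (\<theta>))\<close>. If \<open>\<theta>\<close> is regular on \<open>S/I\<close>, the connecting
  homomorphisms identify it with the cohomology in degree \<open>length \<theta>\<close> with coefficients in \<open>S/I\<close>, where
  \<open>\<theta>\<close> enters only through its length (\<open>cohomology_iso_regular\<close>). Moreover every homogeneous system
  of parameters \<open>\<theta>\<close> is regular: the Koszul complex on \<open>\<theta>\<close> is exact below the dimension, since \<open>(\<theta>)\<close>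
  contains powers of a regular sequence modulo \<open>I\<close>, and by a graded Nakayama argument this exactness
  survives the removal of elements of \<open>\<theta>\<close> (\<open>hsop_weakly_regular\<close>). So the type can be computed from a
  single system of parameters (\<open>socle_dim_hsop\<close>).

  The computation. The linear forms \<open>l a - a\<close> and \<open>d b - b - c b\<close> eliminate the variables \<open>l a\<close> and
  \<open>d b\<close>. What remains is the polynomial ring on \<open>A \<union> B \<union> c ` B\<close> modulo all squares of variables, the
  products \<open>b * c b\<close>, and the products \<open>a * b\<close> for the edges between \<open>A\<close> and \<open>B\<close>. Its nonzero
  monomials are the independent sets of a graph, and its socle is spanned by the maximal ones among
  them. Such a set is determined by the subset \<open>X\<close> of those \<open>b \<in> B\<close> that it contains: it contains
  \<open>c b\<close> for the other \<open>b\<close>, and the \<open>a \<in> A\<close> without neighbours in \<open>X\<close>. This gives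
  \<open>2 ^ |B|\<close> sets (\<open>card_top_standard\<close>).
\<close>

section \<open>Koszul cochains modulo an ideal\<close>

interpretation ideal: module "(*) :: 'a::comm_ring_1 \<Rightarrow> 'a \<Rightarrow> 'a"
  by standard (auto simp: algebra_simps)

(* As a rewrite rule, this fact reassociates products against mult.assoc. *)
declare ideal.scale_scale [simp del]

text \<open>
  The Koszul cochain complex, as an iterated mapping cone: a list \<open>bs\<close> of the length of \<open>xs\<close> stands for
  the set of positions of \<open>True\<close>, hence for a basis element of the exterior algebra, and a cochain is a
  function on such lists. Cochains are taken in the ring itself and all conditions are imposed modulo
  an ideal \<open>J\<close>, which replaces coefficients in the quotient ring.
\<close>

fun koszul_d :: "'a::comm_ring_1 list \<Rightarrow> (bool list \<Rightarrow> 'a) \<Rightarrow> bool list \<Rightarrow> 'a" where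
  "koszul_d [] c bs = 0"
| "koszul_d (x # xs) c [] = 0"
| "koszul_d (x # xs) c (False # bs) = koszul_d xs (\<lambda>b. c (False # b)) bs"
| "koszul_d (x # xs) c (True # bs) = x * c (False # bs) - koszul_d xs (\<lambda>b. c (True # b)) bs"

text \<open>
  The contraction at position \<open>n\<close>; by \<open>koszul_homotopy\<close> below it is a homotopy from multiplication by
  the \<open>n\<close>-th element of the sequence to zero.
\<close>

fun koszul_h :: "nat \<Rightarrow> (bool list \<Rightarrow> 'a::comm_ring_1) \<Rightarrow> bool list \<Rightarrow> 'a" where
  "koszul_h n c [] = 0"
| "koszul_h 0 c (False # bs) = c (True # bs)"
| "koszul_h 0 c (True # bs) = 0"
| "koszul_h (Suc n) c (False # bs) = koszul_h n (\<lambda>b. c (False # b)) bs"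
| "koszul_h (Suc n) c (True # bs) = - koszul_h n (\<lambda>b. c (True # b)) bs"

text \<open>
  The basis elements of cohomological degree \<open>i\<close>.
\<close>

definition cells :: "nat \<Rightarrow> nat \<Rightarrow> bool list set" where
  "cells n i = {bs. length bs = n \<and> count_list bs True = i}"

definition cocycle :: "'a::comm_ring_1 set \<Rightarrow> 'a list \<Rightarrow> nat \<Rightarrow> (bool list \<Rightarrow> 'a) \<Rightarrow> bool" where
  "cocycle J xs i c \<longleftrightarrow> (\<forall>bs\<in>cells (length xs) (Suc i). koszul_d xs c bs \<in> J)"

definition coboundary :: "'a::comm_ring_1 set \<Rightarrow> 'a list \<Rightarrow> nat \<Rightarrow> (bool list \<Rightarrow> 'a) \<Rightarrow> bool" where
  "coboundary J xs i c \<longleftrightarrow> (\<exists>e. \<forall>bs\<in>cells (length xs) i. c bs - koszul_d xs e bs \<in> J)"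

definition koszul_exact :: "'a::comm_ring_1 set \<Rightarrow> 'a list \<Rightarrow> nat \<Rightarrow> bool" where
  "koszul_exact J xs i \<longleftrightarrow> (\<forall>c. cocycle J xs i c \<longrightarrow> coboundary J xs i c)"

lemma cells_simps [simp]:
  "[] \<in> cells 0 i \<longleftrightarrow> i = 0"
  "[] \<notin> cells (Suc n) i"
  "False # bs \<in> cells (Suc n) i \<longleftrightarrow> bs \<in> cells n i"
  "True # bs \<in> cells (Suc n) (Suc i) \<longleftrightarrow> bs \<in> cells n i"
  "True # bs \<notin> cells (Suc n) 0"
  by (auto simp: cells_def)

lemma cells_SucE:
  assumes "bs \<in> cells (Suc n) i"
  obtains bs' where "bs = False # bs'" "bs' \<in> cells n i"
    | bs' j where "bs = True # bs'" "i = Suc j" "bs' \<in> cells n j"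
proof (cases bs)
  case Nil
  then show ?thesis using assms by simp
next
  case (Cons b bs')
  then show ?thesis using assms that by (cases b; cases i) auto
qed

lemma cells_0: "cells n 0 = {replicate n False}"
proof (induction n)
  case 0
  then show ?case by (auto simp: cells_def)
next
  case (Suc n)
  have "cells (Suc n) 0 = (#) False ` cells n 0"
    by (auto elim: cells_SucE)
  then show ?case using Suc by simp
qed

lemma koszul_d_add: "koszul_d xs (\<lambda>b. c b + e b) bs = koszul_d xs c bs + koszul_d xs e bs"
proof (induction xs arbitrary: c e bs)
  case (Cons x xs)
  show ?case
  proof (cases bs)
    case (Cons b bs')
    then show ?thesis
      using Cons.IH[of "\<lambda>u. c (b # u)" "\<lambda>u. e (b # u)" bs'] by (cases b) (simp_all add: distrib_left)
  qed simp
qed simp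

lemma koszul_d_scale: "koszul_d xs (\<lambda>b. r * c b) bs = r * koszul_d xs c bs"
proof (induction xs arbitrary: c bs)
  case (Cons x xs)
  show ?case
  proof (cases bs)
    case (Cons b bs')
    then show ?thesis
      using Cons.IH[of "\<lambda>u. c (b # u)" bs']
      by (cases b) (simp_all add: right_diff_distrib mult.left_commute)
  qed simp
qed simp

lemma koszul_d_diff: "koszul_d xs (\<lambda>b. c b - e b) bs = koszul_d xs c bs - koszul_d xs e bs"
  using koszul_d_add[of xs "\<lambda>b. c b - e b" e bs] by simp

lemma koszul_d_0 [simp]: "koszul_d xs (\<lambda>b. 0) bs = 0"
  using koszul_d_diff[of xs "\<lambda>b. 0" "\<lambda>b. 0" bs] by simp

lemma koszul_d_d [simp]: "koszul_d xs (koszul_d xs c) bs = 0"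
proof (induction xs arbitrary: c bs)
  case (Cons x xs)
  show ?case
  proof (cases bs)
    case (Cons b bs')
    then show ?thesis
      using Cons.IH[of "\<lambda>u. c (b # u)" bs']
      by (cases b) (simp_all add: koszul_d_diff koszul_d_scale)
  qed simp
qed simp

lemma koszul_d_cell_0: "bs \<in> cells (length xs) 0 \<Longrightarrow> koszul_d xs c bs = 0"
proof (induction xs arbitrary: c bs)
  case (Cons x xs)
  from Cons.prems have "bs \<in> cells (Suc (length xs)) 0" by simp
  then show ?case by (cases rule: cells_SucE) (simp_all add: Cons.IH)
qed simp

lemma koszul_d_mem:
  assumes "is_ideal J" "\<And>b. b \<in> cells (length xs) i \<Longrightarrow> c b \<in> J"
    "bs \<in> cells (length xs) (Suc i)"
  shows "koszul_d xs c bs \<in> J"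
  using assms(2,3)
proof (induction xs arbitrary: c bs i)
  case Nil
  then show ?case using ideal.subspace_0[OF assms(1)] by simp
next
  case (Cons x xs)
  from Cons.prems(2) have "bs \<in> cells (Suc (length xs)) (Suc i)" by simp
  then show ?case
  proof (cases rule: cells_SucE)
    case (1 bs')
    then show ?thesis using Cons.IH[of i "\<lambda>b. c (False # b)" bs'] Cons.prems(1) by simp
  next
    case (2 bs' j)
    have "koszul_d xs (\<lambda>b. c (True # b)) bs' \<in> J"
    proof (cases i)
      case 0
      then show ?thesis using 2 ideal.subspace_0[OF assms(1)] by (simp add: koszul_d_cell_0)
    next
      case (Suc k)
      then show ?thesis using Cons.IH[of k "\<lambda>b. c (True # b)" bs'] Cons.prems(1) 2 by simp
    qed
    moreover have "c (False # bs') \<in> J" using Cons.prems(1) 2 by simp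
    ultimately show ?thesis
      using 2 assms(1) by (simp add: ideal.subspace_diff ideal.subspace_scale)
  qed
qed

lemma koszul_h_mem:
  assumes "is_ideal J" "\<And>b. b \<in> cells N (Suc i) \<Longrightarrow> c b \<in> J" "bs \<in> cells N i"
  shows "koszul_h n c bs \<in> J"
  using assms(2,3)
proof (induction n c bs arbitrary: N i rule: koszul_h.induct)
  case (1 n c)
  then show ?case using ideal.subspace_0[OF assms(1)] by simp
next
  case (2 c bs)
  then show ?case by (cases N) (auto simp: cells_def)
next
  case (3 c bs)
  then show ?case using ideal.subspace_0[OF assms(1)] by simp
next
  case (4 n c bs)
  obtain M where "N = Suc M" using 4(3) by (cases N) (auto simp: cells_def)
  then show ?case using 4(1)[of M i] 4(2,3) by simp
next
  case (5 n c bs)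
  obtain M j where "N = Suc M" "i = Suc j" using 5(3) by (cases N; cases i) (auto simp: cells_def)
  then show ?case using 5(1)[of M j] 5(2,3) assms(1) by (simp add: ideal.subspace_neg)
qed

lemma koszul_h_diff: "koszul_h n (\<lambda>b. c b - e b) bs = koszul_h n c bs - koszul_h n e bs"
proof (induction n arbitrary: c e bs)
  case 0
  show ?case by (cases "(0::nat, c, bs)" rule: koszul_h.cases) auto
next
  case (Suc n)
  show ?case
  proof (cases bs)
    case (Cons b bs')
    then show ?thesis
      using Suc.IH[of "\<lambda>u. c (b # u)" "\<lambda>u. e (b # u)" bs'] by (cases b) simp_all
  qed simp
qed

lemma koszul_h_scale: "koszul_h n (\<lambda>b. r * c b) bs = r * koszul_h n c bs"
proof (induction n arbitrary: c bs)
  case 0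
  show ?case by (cases "(0::nat, c, bs)" rule: koszul_h.cases) auto
next
  case (Suc n)
  show ?case
  proof (cases bs)
    case (Cons b bs')
    then show ?thesis
      using Suc.IH[of "\<lambda>u. c (b # u)" bs'] by (cases b) simp_all
  qed simp
qed

lemma koszul_homotopy:
  assumes "n < length xs" "length bs = length xs"
  shows "koszul_d xs (koszul_h n c) bs + koszul_h n (koszul_d xs c) bs = xs ! n * c bs"
  using assms
proof (induction xs arbitrary: n c bs)
  case Nil
  then show ?case by simp
next
  case (Cons x xs)
  obtain b bs' where bs: "bs = b # bs'" using Cons.prems by (cases bs) auto
  show ?case
  proof (cases n)
    case 0
    then show ?thesis using bs by (cases b) (simp_all add: koszul_d_scale)
  next
    case (Suc k)
    have IH: "koszul_d xs (koszul_h k c') bs' + koszul_h k (koszul_d xs c') bs' = xs ! k * c' bs'" for c'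
      using Cons.IH[of k bs' c'] Cons.prems Suc bs by simp
    have neg: "koszul_d xs (\<lambda>b. - koszul_h k c' b) bs' = - koszul_d xs (koszul_h k c') bs'" for c'
      using koszul_d_scale[of xs "-1" "koszul_h k c'" bs'] by simp
    show ?thesis using Suc bs IH
      by (cases b) (simp_all add: neg koszul_h_diff koszul_h_scale)
  qed
qed

lemma coboundary_add:
  assumes "is_ideal J" "coboundary J xs i c" "coboundary J xs i e"
  shows "coboundary J xs i (\<lambda>b. c b + e b)"
proof -
  obtain c' e' where "\<And>bs. bs \<in> cells (length xs) i \<Longrightarrow> c bs - koszul_d xs c' bs \<in> J"
    "\<And>bs. bs \<in> cells (length xs) i \<Longrightarrow> e bs - koszul_d xs e' bs \<in> J"
    using assms(2,3) unfolding coboundary_def by blast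
  then have "(c bs + e bs) - koszul_d xs (\<lambda>b. c' b + e' b) bs \<in> J" if "bs \<in> cells (length xs) i" for bs
    using ideal.subspace_add[OF assms(1), of "c bs - koszul_d xs c' bs" "e bs - koszul_d xs e' bs"] that
    by (simp add: koszul_d_add algebra_simps)
  then show ?thesis unfolding coboundary_def by blast
qed

lemma coboundary_scale:
  assumes "is_ideal J" "coboundary J xs i c"
  shows "coboundary J xs i (\<lambda>b. r * c b)"
proof -
  obtain c' where "\<And>bs. bs \<in> cells (length xs) i \<Longrightarrow> c bs - koszul_d xs c' bs \<in> J"
    using assms(2) unfolding coboundary_def by blast
  then have "r * c bs - koszul_d xs (\<lambda>b. r * c' b) bs \<in> J" if "bs \<in> cells (length xs) i" for bs
    using ideal.subspace_scale[OF assms(1), of "c bs - koszul_d xs c' bs" r] that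
    by (simp add: koszul_d_scale algebra_simps)
  then show ?thesis unfolding coboundary_def by blast
qed

lemma coboundary_d: "is_ideal J \<Longrightarrow> coboundary J xs i (koszul_d xs e)"
  unfolding coboundary_def by (rule exI[of _ e]) (simp add: ideal.subspace_0)

lemma coboundary_cong:
  assumes "is_ideal J" "coboundary J xs i c" "\<And>bs. bs \<in> cells (length xs) i \<Longrightarrow> e bs - c bs \<in> J"
  shows "coboundary J xs i e"
proof -
  obtain c' where "\<And>bs. bs \<in> cells (length xs) i \<Longrightarrow> c bs - koszul_d xs c' bs \<in> J"
    using assms(2) unfolding coboundary_def by blast
  then have "e bs - koszul_d xs c' bs \<in> J" if "bs \<in> cells (length xs) i" for bs
    using ideal.subspace_add[OF assms(1) assms(3)[OF that], of "c bs - koszul_d xs c' bs"] that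
    by (simp add: algebra_simps)
  then show ?thesis unfolding coboundary_def by blast
qed

text \<open>
  Koszul cohomology with coefficients modulo \<open>J\<close> is annihilated by \<open>J\<close> and, through the homotopies, by
  the elements of the sequence.
\<close>

lemma cocycle_mult_coboundary:
  assumes J: "is_ideal J" and r: "r \<in> ideal_of (J \<union> set xs)" and c: "cocycle J xs i c"
  shows "coboundary J xs i (\<lambda>b. r * c b)"
  using r
proof (induction rule: ideal.span_induct_alt)
  case base
  show ?case unfolding coboundary_def
    by (intro exI[of _ "\<lambda>_. 0"]) (simp add: ideal.subspace_0[OF J])
next
  case (step a x y)
  have "coboundary J xs i (\<lambda>b. x * c b)"
  proof (cases "x \<in> J")
    case True
    then have "x * c bs \<in> J" for bs
      using ideal.subspace_scale[OF J True, of "c bs"] by (simp only: mult.commute)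
    then show ?thesis unfolding coboundary_def by (intro exI[of _ "\<lambda>_. 0"]) simp
  next
    case False
    then obtain n where n: "n < length xs" "x = xs ! n"
      using step by (auto simp: in_set_conv_nth)
    show ?thesis
    proof (rule coboundary_cong[OF J coboundary_d[OF J]])
      fix bs assume bs: "bs \<in> cells (length xs) i"
      have "koszul_h n (koszul_d xs c) bs \<in> J"
        by (rule koszul_h_mem[OF J _ bs]) (use c in \<open>auto simp: cocycle_def\<close>)
      moreover have "koszul_h n (koszul_d xs c) bs = x * c bs - koszul_d xs (koszul_h n c) bs"
        using koszul_homotopy[OF n(1), of bs c] bs n(2) by (simp add: cells_def algebra_simps)
      ultimately show "x * c bs - koszul_d xs (koszul_h n c) bs \<in> J" by simp
    qed
  qed
  from coboundary_add[OF J coboundary_scale[OF J this, of a] step(2)]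
  show ?case by (simp only: distrib_right mult.assoc)
qed

text \<open>
  In degree \<open>0\<close> a cochain is a single ring element. For the sequence of all variables, the cocycles are
  the representatives of the socle.
\<close>

lemma cocycle_0_iff:
  assumes "is_ideal J"
  shows "cocycle J xs 0 c \<longleftrightarrow> (\<forall>x\<in>set xs. x * c (replicate (length xs) False) \<in> J)"
proof (induction xs arbitrary: c)
  case Nil
  then show ?case by (auto simp: cocycle_def cells_def)
next
  case (Cons x xs)
  have "cells (Suc (length xs)) (Suc 0) = (#) False ` cells (length xs) (Suc 0) \<union> (#) True ` cells (length xs) 0"
    by (auto elim: cells_SucE)
  then have "cocycle J (x # xs) 0 c \<longleftrightarrow> cocycle J xs 0 (\<lambda>b. c (False # b)) \<and>
      (\<forall>bs\<in>cells (length xs) 0. x * c (False # bs) \<in> J)"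
    by (simp add: cocycle_def ball_Un koszul_d_cell_0)
  then show ?case using Cons.IH by (auto simp: cells_0)
qed

lemma coboundary_0_iff: "coboundary J xs 0 c \<longleftrightarrow> c (replicate (length xs) False) \<in> J"
  by (simp add: coboundary_def cells_0 koszul_d_cell_0)

section \<open>Exactness of the Koszul complex and regular sequences\<close>

definition nonzerodivisor_mod :: "'a::comm_ring_1 set \<Rightarrow> 'a \<Rightarrow> bool" where
  "nonzerodivisor_mod J y \<longleftrightarrow> (\<forall>f. y * f \<in> J \<longrightarrow> f \<in> J)"

lemma nonzerodivisor_modD: "nonzerodivisor_mod J y \<Longrightarrow> y * f \<in> J \<Longrightarrow> f \<in> J"
  unfolding nonzerodivisor_mod_def by blast

lemma mem_ideal_insert:
  assumes "is_ideal J"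
  shows "f \<in> ideal_of (insert y J) \<longleftrightarrow> (\<exists>k. f - y * k \<in> J)"
proof -
  have "ideal_of J = J" using assms by (simp only: ideal.span_eq_iff)
  then show ?thesis
    unfolding ideal.span_breakdown_eq[of f y J] by (simp only: mult.commute)
qed

text \<open>
  The part of the long exact cohomology sequence of multiplication by \<open>y\<close> that bounds the cohomology
  modulo \<open>(J, y)\<close> by that modulo \<open>J\<close>.
\<close>

lemma koszul_exact_quotient:
  assumes J: "is_ideal J" and y: "nonzerodivisor_mod J y"
    and ex: "koszul_exact J xs i" "koszul_exact J xs (Suc i)"
  shows "koszul_exact (ideal_of (insert y J)) xs i"
  unfolding koszul_exact_def
proof (intro allI impI)
  fix c assume c: "cocycle (ideal_of (insert y J)) xs i c"
  then have "\<forall>bs\<in>cells (length xs) (Suc i). \<exists>k. koszul_d xs c bs - y * k \<in> J"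
    by (simp add: cocycle_def mem_ideal_insert[OF J])
  from bchoice[OF this] obtain e
    where e: "\<And>bs. bs \<in> cells (length xs) (Suc i) \<Longrightarrow> koszul_d xs c bs - y * e bs \<in> J"
    by blast
  have "cocycle J xs (Suc i) e"
    unfolding cocycle_def
  proof
    fix bs assume "bs \<in> cells (length xs) (Suc (Suc i))"
    then have "koszul_d xs (\<lambda>b. koszul_d xs c b - y * e b) bs \<in> J"
      using koszul_d_mem[OF J, of xs "Suc i" "\<lambda>b. koszul_d xs c b - y * e b"] e by blast
    then have "- (y * koszul_d xs e bs) \<in> J" by (simp add: koszul_d_diff koszul_d_scale)
    from ideal.subspace_neg[OF J this] have "y * koszul_d xs e bs \<in> J" by simp
    then show "koszul_d xs e bs \<in> J" by (rule nonzerodivisor_modD[OF y])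
  qed
  then obtain b where b: "\<And>bs. bs \<in> cells (length xs) (Suc i) \<Longrightarrow> e bs - koszul_d xs b bs \<in> J"
    using ex(2) unfolding koszul_exact_def coboundary_def by blast
  have "cocycle J xs i (\<lambda>bs. c bs - y * b bs)"
    unfolding cocycle_def
  proof
    fix bs assume bs: "bs \<in> cells (length xs) (Suc i)"
    have "(koszul_d xs c bs - y * e bs) + y * (e bs - koszul_d xs b bs) \<in> J"
      using e[OF bs] b[OF bs] J by (simp add: ideal.subspace_add ideal.subspace_scale)
    then show "koszul_d xs (\<lambda>bs. c bs - y * b bs) bs \<in> J"
      by (simp add: koszul_d_diff koszul_d_scale algebra_simps)
  qed
  then obtain g where g: "\<And>bs. bs \<in> cells (length xs) i \<Longrightarrow> c bs - y * b bs - koszul_d xs g bs \<in> J"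
    using ex(1) unfolding koszul_exact_def coboundary_def by blast
  show "coboundary (ideal_of (insert y J)) xs i c"
    unfolding coboundary_def mem_ideal_insert[OF J]
  proof (intro exI ballI)
    fix bs assume "bs \<in> cells (length xs) i"
    from g[OF this] show "c bs - koszul_d xs g bs - y * b bs \<in> J" by (simp add: algebra_simps)
  qed
qed

text \<open>
  The converse direction of the long exact sequence: exactness modulo \<open>(J, y)\<close> in the preceding degree
  makes multiplication by \<open>y\<close> injective on the cohomology modulo \<open>J\<close>, which is annihilated by a power
  of \<open>y\<close>.
\<close>

lemma koszul_exact_lift:
  assumes J: "is_ideal J" and y: "nonzerodivisor_mod J y" and N: "y ^ N \<in> ideal_of (J \<union> set xs)"
    and ex: "\<And>k. i = Suc k \<Longrightarrow> koszul_exact (ideal_of (insert y J)) xs k"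
  shows "koszul_exact J xs i"
  unfolding koszul_exact_def
proof (intro allI impI)
  fix c assume c: "cocycle J xs i c"
  have "coboundary J xs i (\<lambda>b. y ^ N * c b)" by (rule cocycle_mult_coboundary[OF J N c])
  then show "coboundary J xs i c"
  proof (induction N)
    case 0
    then show ?case by simp
  next
    case (Suc N)
    have "coboundary J xs i (\<lambda>b. y ^ N * c b)"
    proof (cases i)
      case 0
      with Suc.prems have "y * (y ^ N * c (replicate (length xs) False)) \<in> J"
        by (simp add: coboundary_0_iff mult.assoc)
      from nonzerodivisor_modD[OF y this] 0 show ?thesis by (simp only: coboundary_0_iff)
    next
      case (Suc k)
      obtain b where b: "\<And>bs. bs \<in> cells (length xs) i \<Longrightarrow> y ^ Suc N * c bs - koszul_d xs b bs \<in> J"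
        using Suc.prems unfolding coboundary_def by blast
      have "cocycle (ideal_of (insert y J)) xs k b"
        unfolding cocycle_def mem_ideal_insert[OF J]
      proof (intro ballI exI)
        fix bs assume "bs \<in> cells (length xs) (Suc k)"
        then have "- (y ^ Suc N * c bs - koszul_d xs b bs) \<in> J"
          using ideal.subspace_neg[OF J b] Suc by blast
        then show "koszul_d xs b bs - y * (y ^ N * c bs) \<in> J" by (simp add: mult.assoc)
      qed
      then obtain e where "\<And>bs. bs \<in> cells (length xs) k \<Longrightarrow> \<exists>g. b bs - koszul_d xs e bs - y * g \<in> J"
        using ex[OF Suc] unfolding koszul_exact_def coboundary_def mem_ideal_insert[OF J] by blast
      then obtain g where g: "\<And>bs. bs \<in> cells (length xs) k \<Longrightarrow> b bs - koszul_d xs e bs - y * g bs \<in> J"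
        using bchoice[of "cells (length xs) k" "\<lambda>bs g. b bs - koszul_d xs e bs - y * g \<in> J"] by blast
      show ?thesis unfolding coboundary_def
      proof (intro exI ballI)
        fix bs assume bs: "bs \<in> cells (length xs) i"
        have "koszul_d xs (\<lambda>b'. b b' - koszul_d xs e b' - y * g b') bs \<in> J"
          using koszul_d_mem[OF J, of xs k "\<lambda>b'. b b' - koszul_d xs e b' - y * g b'"] g bs Suc by blast
        then have "koszul_d xs b bs - y * koszul_d xs g bs \<in> J"
          by (simp add: koszul_d_diff koszul_d_scale)
        from ideal.subspace_add[OF J this b[OF bs]]
        have "y * (y ^ N * c bs - koszul_d xs g bs) \<in> J" by (simp add: right_diff_distrib mult.assoc)
        then show "y ^ N * c bs - koszul_d xs g bs \<in> J" by (rule nonzerodivisor_modD[OF y])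
      qed
    qed
    then show ?case by (rule Suc.IH)
  qed
qed

text \<open>
  Regularity by recursion on the sequence, which suits induction; the quotient is allowed to be zero.
\<close>

fun weakly_regular :: "'a::comm_ring_1 set \<Rightarrow> 'a list \<Rightarrow> bool" where
  "weakly_regular J [] \<longleftrightarrow> True"
| "weakly_regular J (y # ys) \<longleftrightarrow> nonzerodivisor_mod J y \<and> weakly_regular (ideal_of (insert y J)) ys"

lemma ideal_of_ideal_of_Un: "ideal_of (ideal_of A \<union> B) = ideal_of (A \<union> B)"
proof
  have "ideal_of A \<subseteq> ideal_of (A \<union> B)" by (rule ideal.span_mono) auto
  moreover have "B \<subseteq> ideal_of (A \<union> B)" using ideal.span_superset by blast
  ultimately have "ideal_of (ideal_of A \<union> B) \<subseteq> ideal_of (ideal_of (A \<union> B))"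
    by (intro ideal.span_mono) auto
  then show "ideal_of (ideal_of A \<union> B) \<subseteq> ideal_of (A \<union> B)" by (simp only: ideal.span_span)
  show "ideal_of (A \<union> B) \<subseteq> ideal_of (ideal_of A \<union> B)"
    using ideal.span_superset[of A] by (intro ideal.span_mono) auto
qed

lemma weakly_regular_if_regular_sequence:
  assumes "is_ideal J" "regular_sequence J ys"
  shows "weakly_regular J ys"
proof -
  have "\<forall>i<length ys. \<forall>f. ys ! i * f \<in> ideal_of (J \<union> set (take i ys)) \<longrightarrow>
      f \<in> ideal_of (J \<union> set (take i ys))"
    using assms(2) by (simp add: regular_sequence_def)
  with assms(1) show ?thesis
  proof (induction ys arbitrary: J)
    case Nil
    then show ?case by simp
  next
    case (Cons y ys)
    have "nonzerodivisor_mod J y"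
      using Cons.prems(2)[rule_format, of 0] ideal.span_eq_iff[THEN iffD2, OF Cons.prems(1)]
      by (simp only: nonzerodivisor_mod_def) simp
    moreover have "weakly_regular (ideal_of (insert y J)) ys"
    proof (rule Cons.IH)
      show "is_ideal (ideal_of (insert y J))" by simp
      have "ideal_of (ideal_of (insert y J) \<union> set (take i ys)) = ideal_of (J \<union> set (take (Suc i) (y # ys)))" for i
        by (simp add: ideal_of_ideal_of_Un)
      note eq = this
      show "\<forall>i<length ys. \<forall>f. ys ! i * f \<in> ideal_of (ideal_of (insert y J) \<union> set (take i ys)) \<longrightarrow>
          f \<in> ideal_of (ideal_of (insert y J) \<union> set (take i ys))"
        unfolding eq using Cons.prems(2)[rule_format, of "Suc _"] by (simp only: nth_Cons_Suc length_Cons Suc_less_eq) blast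
    qed
    ultimately show ?case by simp
  qed
qed

lemma koszul_exact_below_grade:
  assumes "is_ideal J" "weakly_regular J ys" "\<And>y. y \<in> set ys \<Longrightarrow> \<exists>N. y ^ N \<in> ideal_of (J \<union> set xs)"
    and "i < length ys"
  shows "koszul_exact J xs i"
  using assms
proof (induction ys arbitrary: J i)
  case Nil
  then show ?case by simp
next
  case (Cons y ys)
  obtain N where N: "y ^ N \<in> ideal_of (J \<union> set xs)" using Cons.prems(3) by auto
  show ?case
  proof (rule koszul_exact_lift[OF Cons.prems(1) _ N])
    show "nonzerodivisor_mod J y" using Cons.prems(2) by simp
    fix k assume k: "i = Suc k"
    have sub: "ideal_of (J \<union> set xs) \<subseteq> ideal_of (ideal_of (insert y J) \<union> set xs)"
      using ideal.span_superset[of "insert y J"] by (intro ideal.span_mono) auto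
    show "koszul_exact (ideal_of (insert y J)) xs k"
    proof (rule Cons.IH)
      show "is_ideal (ideal_of (insert y J))" by simp
      show "weakly_regular (ideal_of (insert y J)) ys" using Cons.prems(2) by simp
      show "\<exists>N. z ^ N \<in> ideal_of (ideal_of (insert y J) \<union> set xs)" if "z \<in> set ys" for z
        using Cons.prems(3)[of z] that sub by auto
      show "k < length ys" using Cons.prems(4) k by simp
    qed
  qed
qed

text \<open>
  Regularity is read off in degree \<open>0\<close>: once the earlier elements \<open>pre\<close> lie in the ideal, a degree \<open>0\<close>
  cocycle for \<open>y # pre\<close> is just an element annihilated by \<open>y\<close>. Exactness in all degrees below the number
  of elements is assumed because passing to the quotient by \<open>y\<close> costs one degree.
\<close>

lemma weakly_regular_if_koszul_exact:
  assumes "is_ideal J" "set pre \<subseteq> J"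
    and "\<And>k i. k \<le> length ys \<Longrightarrow> i < k \<Longrightarrow> koszul_exact J (rev (take k ys) @ pre) i"
  shows "weakly_regular J ys"
  using assms
proof (induction ys arbitrary: J pre)
  case Nil
  then show ?case by simp
next
  case (Cons y ys)
  note J = Cons.prems(1)
  have nzd: "nonzerodivisor_mod J y"
    unfolding nonzerodivisor_mod_def
  proof (intro allI impI)
    fix f assume f: "y * f \<in> J"
    have "x * f \<in> J" if "x \<in> set (y # pre)" for x
      using that f Cons.prems(2) ideal.subspace_scale[OF J, of x f]
      by (auto simp: mult.commute[of f])
    then have "cocycle J (y # pre) 0 (\<lambda>_. f)" by (simp add: cocycle_0_iff[OF J])
    moreover have "koszul_exact J (y # pre) 0" using Cons.prems(3)[of 1 0] by simp
    ultimately have "coboundary J (y # pre) 0 (\<lambda>_. f)" unfolding koszul_exact_def by blast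
    then show "f \<in> J" by (simp only: coboundary_0_iff)
  qed
  moreover have "weakly_regular (ideal_of (insert y J)) ys"
  proof (rule Cons.IH[of _ "y # pre"])
    show "is_ideal (ideal_of (insert y J))" by simp
    show "set (y # pre) \<subseteq> ideal_of (insert y J)"
      using ideal.span_superset[of "insert y J"] Cons.prems(2) by auto
    fix k i assume k: "k \<le> length ys" "i < k"
    then have "koszul_exact J (rev (take k ys) @ y # pre) j" if "j \<in> {i, Suc i}" for j
      using Cons.prems(3)[of "Suc k" j] that by auto
    then show "koszul_exact (ideal_of (insert y J)) (rev (take k ys) @ y # pre) i"
      by (intro koszul_exact_quotient[OF J nzd]) auto
  qed
  ultimately show ?case by simp
qed

section \<open>The connecting isomorphism in Koszul cohomology\<close>

text \<open>
  An isomorphism between two Koszul cohomology modules, given by a linear relation between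
  representatives. A relation avoids choices: the connecting homomorphism is only defined up to
  coboundaries and elements of the ideals.
\<close>

definition cohomology_iso ::
  "'a::comm_ring_1 list \<Rightarrow> 'a set \<Rightarrow> nat \<Rightarrow> 'a set \<Rightarrow> nat \<Rightarrow> bool" where
  "cohomology_iso xs J i J' i' \<longleftrightarrow> (\<exists>R.
     R (\<lambda>_. 0) (\<lambda>_. 0) \<and>
     (\<forall>c e c' e' r. R c e \<longrightarrow> R c' e' \<longrightarrow> R (\<lambda>b. r * c b + c' b) (\<lambda>b. r * e b + e' b)) \<and>
     (\<forall>c. cocycle J xs i c \<longrightarrow> (\<exists>e. R c e)) \<and>
     (\<forall>e. cocycle J' xs i' e \<longrightarrow> (\<exists>c. R c e)) \<and>
     (\<forall>c e. R c e \<longrightarrow> cocycle J xs i c \<and> cocycle J' xs i' e \<and>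
        (coboundary J xs i c \<longleftrightarrow> coboundary J' xs i' e)))"

lemma cocycle_comb:
  assumes "is_ideal J" "cocycle J xs i c" "cocycle J xs i c'"
  shows "cocycle J xs i (\<lambda>b. r * c b + c' b)"
  using assms ideal.subspace_add[OF assms(1)] ideal.subspace_scale[OF assms(1)]
  by (auto simp: cocycle_def koszul_d_add koszul_d_scale)

lemma cohomology_iso_refl:
  assumes "is_ideal J"
  shows "cohomology_iso xs J i J i"
  unfolding cohomology_iso_def
  by (rule exI[of _ "\<lambda>c e. c = e \<and> cocycle J xs i c"])
     (use assms in \<open>auto simp: cocycle_comb ideal.subspace_0 cocycle_def[of _ _ _ "\<lambda>_. 0"]\<close>)

lemma cohomology_iso_sym: "cohomology_iso xs J i J' i' \<Longrightarrow> cohomology_iso xs J' i' J i"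
  unfolding cohomology_iso_def
  apply (elim exE)
  subgoal for R by (rule exI[of _ "\<lambda>c e. R e c"]) blast
  done

lemma cohomology_iso_trans:
  assumes "cohomology_iso xs J i J' i'" "cohomology_iso xs J' i' J'' i''"
  shows "cohomology_iso xs J i J'' i''"
proof -
  obtain R where R: "R (\<lambda>_. 0) (\<lambda>_. 0)"
     "\<And>c e c' e' r. R c e \<Longrightarrow> R c' e' \<Longrightarrow> R (\<lambda>b. r * c b + c' b) (\<lambda>b. r * e b + e' b)"
     "\<And>c. cocycle J xs i c \<Longrightarrow> \<exists>e. R c e" "\<And>e. cocycle J' xs i' e \<Longrightarrow> \<exists>c. R c e"
     "\<And>c e. R c e \<Longrightarrow> cocycle J xs i c \<and> cocycle J' xs i' e \<and>
        (coboundary J xs i c \<longleftrightarrow> coboundary J' xs i' e)"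
    using assms(1) unfolding cohomology_iso_def by blast
  obtain Q where Q: "Q (\<lambda>_. 0) (\<lambda>_. 0)"
     "\<And>c e c' e' r. Q c e \<Longrightarrow> Q c' e' \<Longrightarrow> Q (\<lambda>b. r * c b + c' b) (\<lambda>b. r * e b + e' b)"
     "\<And>c. cocycle J' xs i' c \<Longrightarrow> \<exists>e. Q c e" "\<And>e. cocycle J'' xs i'' e \<Longrightarrow> \<exists>c. Q c e"
     "\<And>c e. Q c e \<Longrightarrow> cocycle J' xs i' c \<and> cocycle J'' xs i'' e \<and>
        (coboundary J' xs i' c \<longleftrightarrow> coboundary J'' xs i'' e)"
    using assms(2) unfolding cohomology_iso_def by blast
  show ?thesis unfolding cohomology_iso_def
  proof (intro exI[of _ "R OO Q"] conjI allI impI)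
    show "(R OO Q) (\<lambda>_. 0) (\<lambda>_. 0)" by (rule relcomppI[of R _ "\<lambda>_. 0"]) (fact R(1), fact Q(1))
  next
    fix c e c' e' r assume "(R OO Q) c e" "(R OO Q) c' e'"
    then obtain d d' where "R c d" "Q d e" "R c' d'" "Q d' e'" by (auto elim!: relcomppE)
    then show "(R OO Q) (\<lambda>b. r * c b + c' b) (\<lambda>b. r * e b + e' b)"
      by (intro relcomppI[of _ _ "\<lambda>b. r * d b + d' b"] R(2) Q(2))
  next
    fix c assume "cocycle J xs i c"
    then obtain d where d: "R c d" using R(3) by blast
    then obtain e where "Q d e" using R(5) Q(3) by blast
    then show "\<exists>e. (R OO Q) c e" using d by (intro exI relcomppI)
  next
    fix e assume "cocycle J'' xs i'' e"
    then obtain d where d: "Q d e" using Q(4) by blast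
    then obtain c where "R c d" using Q(5) R(4) by blast
    then show "\<exists>c. (R OO Q) c e" using d by (intro exI relcomppI)
  next
    fix c e assume "(R OO Q) c e"
    then obtain d where "R c d" "Q d e" by (elim relcomppE)
    then show "cocycle J xs i c" "cocycle J'' xs i'' e" "coboundary J xs i c = coboundary J'' xs i'' e"
      using R(5) Q(5) by blast+
  qed
qed

text \<open>
  The connecting homomorphism sends the class of \<open>c\<close> modulo \<open>(J, y)\<close> to the class of \<open>e\<close>, where
  \<open>koszul_d xs c\<close> is \<open>y * e\<close> modulo \<open>J\<close>. It is surjective since \<open>y\<close> annihilates the cohomology, and
  injective by exactness in degree \<open>i\<close>.
\<close>

lemma cohomology_iso_connecting:
  assumes J: "is_ideal J" and y: "nonzerodivisor_mod J y" and mem: "y \<in> ideal_of (set xs)"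
    and ex: "koszul_exact J xs i"
  shows "cohomology_iso xs (ideal_of (insert y J)) i J (Suc i)"
proof -
  define R where "R = (\<lambda>c e. \<forall>bs\<in>cells (length xs) (Suc i). koszul_d xs c bs - y * e bs \<in> J)"
  have cocyc: "cocycle J xs (Suc i) e" if "R c e" for c e
    unfolding cocycle_def
  proof
    fix bs assume "bs \<in> cells (length xs) (Suc (Suc i))"
    then have "koszul_d xs (\<lambda>b. koszul_d xs c b - y * e b) bs \<in> J"
      using koszul_d_mem[OF J, of xs "Suc i" "\<lambda>b. koszul_d xs c b - y * e b"] that
      unfolding R_def by blast
    then have "- (y * koszul_d xs e bs) \<in> J" by (simp add: koszul_d_diff koszul_d_scale)
    from ideal.subspace_neg[OF J this] have "y * koszul_d xs e bs \<in> J" by simp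
    then show "koszul_d xs e bs \<in> J" by (rule nonzerodivisor_modD[OF y])
  qed
  have iff: "coboundary (ideal_of (insert y J)) xs i c \<longleftrightarrow> coboundary J xs (Suc i) e" if R: "R c e" for c e
  proof
    assume "coboundary (ideal_of (insert y J)) xs i c"
    then obtain g where "\<And>bs. bs \<in> cells (length xs) i \<Longrightarrow> \<exists>b. c bs - koszul_d xs g bs - y * b \<in> J"
      unfolding coboundary_def mem_ideal_insert[OF J] by blast
    then obtain b where b: "\<And>bs. bs \<in> cells (length xs) i \<Longrightarrow> c bs - koszul_d xs g bs - y * b bs \<in> J"
      using bchoice[of "cells (length xs) i" "\<lambda>bs b. c bs - koszul_d xs g bs - y * b \<in> J"] by blast
    show "coboundary J xs (Suc i) e"
      unfolding coboundary_def
    proof (intro exI ballI)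
      fix bs assume bs: "bs \<in> cells (length xs) (Suc i)"
      have "koszul_d xs (\<lambda>bs. c bs - koszul_d xs g bs - y * b bs) bs \<in> J"
        using koszul_d_mem[OF J, of xs i "\<lambda>bs. c bs - koszul_d xs g bs - y * b bs"] b bs by blast
      then have "koszul_d xs c bs - y * koszul_d xs b bs \<in> J"
        by (simp add: koszul_d_diff koszul_d_scale)
      from ideal.subspace_diff[OF J this, of "koszul_d xs c bs - y * e bs"]
      have "y * (e bs - koszul_d xs b bs) \<in> J" using R bs by (simp add: R_def algebra_simps)
      then show "e bs - koszul_d xs b bs \<in> J" by (rule nonzerodivisor_modD[OF y])
    qed
  next
    assume "coboundary J xs (Suc i) e"
    then obtain b where b: "\<And>bs. bs \<in> cells (length xs) (Suc i) \<Longrightarrow> e bs - koszul_d xs b bs \<in> J"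
      unfolding coboundary_def by blast
    have "cocycle J xs i (\<lambda>bs. c bs - y * b bs)"
      unfolding cocycle_def
    proof
      fix bs assume bs: "bs \<in> cells (length xs) (Suc i)"
      have "(koszul_d xs c bs - y * e bs) + y * (e bs - koszul_d xs b bs) \<in> J"
        using R b[OF bs] J bs by (simp add: R_def ideal.subspace_add ideal.subspace_scale)
      then show "koszul_d xs (\<lambda>bs. c bs - y * b bs) bs \<in> J"
        by (simp add: koszul_d_diff koszul_d_scale algebra_simps)
    qed
    then obtain g where g: "\<And>bs. bs \<in> cells (length xs) i \<Longrightarrow> c bs - y * b bs - koszul_d xs g bs \<in> J"
      using ex unfolding koszul_exact_def coboundary_def by blast
    show "coboundary (ideal_of (insert y J)) xs i c"
      unfolding coboundary_def mem_ideal_insert[OF J]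
    proof (intro exI ballI)
      fix bs assume "bs \<in> cells (length xs) i"
      from g[OF this] show "c bs - koszul_d xs g bs - y * b bs \<in> J" by (simp add: algebra_simps)
    qed
  qed
  show ?thesis unfolding cohomology_iso_def
  proof (intro exI[of _ R] conjI allI impI)
    show "R (\<lambda>_. 0) (\<lambda>_. 0)" using J by (simp add: R_def ideal.subspace_0)
  next
    fix c e c' e' r assume "R c e" "R c' e'"
    then show "R (\<lambda>b. r * c b + c' b) (\<lambda>b. r * e b + e' b)"
      unfolding R_def
    proof (intro ballI)
      fix bs assume "\<forall>bs\<in>cells (length xs) (Suc i). koszul_d xs c bs - y * e bs \<in> J"
        "\<forall>bs\<in>cells (length xs) (Suc i). koszul_d xs c' bs - y * e' bs \<in> J"
        "bs \<in> cells (length xs) (Suc i)"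
      then have "r * (koszul_d xs c bs - y * e bs) + (koszul_d xs c' bs - y * e' bs) \<in> J"
        using J by (simp add: ideal.subspace_add ideal.subspace_scale)
      then show "koszul_d xs (\<lambda>b. r * c b + c' b) bs - y * (r * e bs + e' bs) \<in> J"
        unfolding koszul_d_add koszul_d_scale by (simp add: algebra_simps)
    qed
  next
    fix c assume "cocycle (ideal_of (insert y J)) xs i c"
    then have "\<And>bs. bs \<in> cells (length xs) (Suc i) \<Longrightarrow> \<exists>k. koszul_d xs c bs - y * k \<in> J"
      by (simp add: cocycle_def mem_ideal_insert[OF J])
    then show "\<exists>e. R c e" unfolding R_def
      using bchoice[of "cells (length xs) (Suc i)" "\<lambda>bs k. koszul_d xs c bs - y * k \<in> J"] by blast
  next
    fix e assume e: "cocycle J xs (Suc i) e"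
    have "y \<in> ideal_of (J \<union> set xs)" using mem ideal.span_mono[of "set xs" "J \<union> set xs"] by auto
    from cocycle_mult_coboundary[OF J this e]
    obtain c where "\<And>bs. bs \<in> cells (length xs) (Suc i) \<Longrightarrow> y * e bs - koszul_d xs c bs \<in> J"
      unfolding coboundary_def by blast
    then have "- (y * e bs - koszul_d xs c bs) \<in> J" if "bs \<in> cells (length xs) (Suc i)" for bs
      using ideal.subspace_neg[OF J] that by blast
    then have "R c e" unfolding R_def by simp
    then show "\<exists>c. R c e" by blast
  next
    fix c e assume R: "R c e"
    then show "cocycle (ideal_of (insert y J)) xs i c"
      unfolding cocycle_def R_def mem_ideal_insert[OF J] by blast
    show "cocycle J xs (Suc i) e" by (rule cocyc[OF R])
    show "coboundary (ideal_of (insert y J)) xs i c \<longleftrightarrow> coboundary J xs (Suc i) e" by (rule iff[OF R])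
  qed
qed

lemma cohomology_iso_regular:
  assumes "is_ideal J" "weakly_regular J ys" "set ys \<subseteq> ideal_of (set xs)"
  shows "cohomology_iso xs (ideal_of (J \<union> set ys)) 0 J (length ys)"
  using assms
proof (induction ys arbitrary: J)
  case Nil
  then show ?case by (simp add: cohomology_iso_refl ideal.span_eq_iff[THEN iffD2])
next
  case (Cons y ys)
  have "koszul_exact J xs (length ys)"
  proof (rule koszul_exact_below_grade[OF Cons.prems(1,2)])
    fix z assume "z \<in> set (y # ys)"
    then have "z ^ 1 \<in> ideal_of (J \<union> set xs)"
      using Cons.prems(3) ideal.span_mono[of "set xs" "J \<union> set xs"] by auto
    then show "\<exists>N. z ^ N \<in> ideal_of (J \<union> set xs)" by blast
  qed simp
  then have "cohomology_iso xs (ideal_of (insert y J)) (length ys) J (length (y # ys))"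
    using cohomology_iso_connecting[OF Cons.prems(1), of y xs "length ys"] Cons.prems by simp
  moreover have "cohomology_iso xs (ideal_of (ideal_of (insert y J) \<union> set ys)) 0 (ideal_of (insert y J)) (length ys)"
    using Cons.prems by (intro Cons.IH) auto
  moreover have "ideal_of (ideal_of (insert y J) \<union> set ys) = ideal_of (J \<union> set (y # ys))"
    by (simp add: ideal_of_ideal_of_Un)
  ultimately show ?case using cohomology_iso_trans by metis
qed

section \<open>Graded ideals and the graded Nakayama argument\<close>

abbreviation "lookup \<equiv> Poly_Mapping.lookup"
abbreviation "keys \<equiv> Poly_Mapping.keys"
abbreviation "single \<equiv> Poly_Mapping.single"

definition tdeg :: "('v::finite \<Rightarrow>\<^sub>0 nat) \<Rightarrow> nat" where
  "tdeg t = (\<Sum>v\<in>UNIV. lookup t v)"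

lemma tdeg_add [simp]: "tdeg (s + t) = tdeg s + tdeg t"
  by (simp add: tdeg_def lookup_add sum.distrib)

lemma tdeg_single [simp]: "tdeg (single v n) = n"
  by (simp add: tdeg_def lookup_single when_def)

lemma homogeneous_of_degree_iff: "homogeneous_of_degree n f \<longleftrightarrow> (\<forall>t\<in>keys f. tdeg t = n)"
  by (simp add: homogeneous_of_degree_def tdeg_def)

definition part :: "('b \<Rightarrow> bool) \<Rightarrow> ('b \<Rightarrow>\<^sub>0 'k::comm_monoid_add) \<Rightarrow> 'b \<Rightarrow>\<^sub>0 'k" where
  "part P f = Poly_Mapping.mapp (\<lambda>t c. c when P t) f"

lemma lookup_part: "lookup (part P f) t = (if P t then lookup f t else 0)"
  by (auto simp: part_def lookup_mapp when_def in_keys_iff)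

lemma part_add: "part P (f + g) = part P f + part P g"
  by (rule poly_mapping_eqI) (simp add: lookup_part lookup_add)

lemma part_diff:
  fixes f g :: "'b \<Rightarrow>\<^sub>0 'k::ab_group_add"
  shows "part P (f - g) = part P f - part P g"
  by (rule poly_mapping_eqI) (simp add: lookup_part lookup_minus)

lemma keys_part: "keys (part P f) = {t \<in> keys f. P t}"
  by (auto simp: in_keys_iff lookup_part split: if_splits)

lemma part_split: "part P f + part (\<lambda>t. \<not> P t) f = f"
  by (rule poly_mapping_eqI) (simp add: lookup_part lookup_add)

lemma part_eq_self: "(\<And>t. t \<in> keys f \<Longrightarrow> P t) \<Longrightarrow> part P f = f"
  by (rule poly_mapping_eqI) (auto simp: lookup_part in_keys_iff)

lemma part_eq_0: "(\<And>t. t \<in> keys f \<Longrightarrow> \<not> P t) \<Longrightarrow> part P f = 0"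
  by (rule poly_mapping_eqI) (auto simp: lookup_part in_keys_iff)

text \<open>
  The homogeneous component. The degree is an integer so that shifted degrees may become negative; the
  component then vanishes.
\<close>

definition hcomp :: "int \<Rightarrow> ('v::finite, 'k::field) mpoly \<Rightarrow> ('v, 'k) mpoly" where
  "hcomp n = part (\<lambda>t. int (tdeg t) = n)"

lemma hcomp_add: "hcomp n (f + g) = hcomp n f + hcomp n g"
  by (simp add: hcomp_def part_add)

lemma hcomp_diff: "hcomp n (f - g) = hcomp n f - hcomp n g"
  by (simp add: hcomp_def part_diff)

lemma hcomp_0 [simp]: "hcomp n 0 = 0"
  by (rule poly_mapping_eqI) (simp add: hcomp_def lookup_part)

lemma hcomp_mult:
  assumes "homogeneous_of_degree d x"
  shows "hcomp (n + int d) (x * f) = x * hcomp n f"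
proof -
  define g where "g = part (\<lambda>t. int (tdeg t) \<noteq> n) f"
  have "f = hcomp n f + g" unfolding hcomp_def g_def by (rule part_split[symmetric])
  then have "hcomp (n + int d) (x * f) = hcomp (n + int d) (x * hcomp n f) + hcomp (n + int d) (x * g)"
    by (metis distrib_left hcomp_add)
  also have "hcomp (n + int d) (x * hcomp n f) = x * hcomp n f"
    unfolding hcomp_def[of "n + int d"]
  proof (rule part_eq_self)
    fix t assume "t \<in> keys (x * hcomp n f)"
    then obtain a b where "t = a + b" "a \<in> keys x" "b \<in> keys (hcomp n f)"
      using keys_mult[of x "hcomp n f"] by blast
    then show "int (tdeg t) = n + int d"
      using assms by (simp add: homogeneous_of_degree_iff hcomp_def keys_part)
  qed
  also have "hcomp (n + int d) (x * g) = 0"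
    unfolding hcomp_def[of "n + int d"]
  proof (rule part_eq_0)
    fix t assume "t \<in> keys (x * g)"
    then obtain a b where "t = a + b" "a \<in> keys x" "b \<in> keys g"
      using keys_mult[of x g] by blast
    then show "int (tdeg t) \<noteq> n + int d"
      using assms by (simp add: homogeneous_of_degree_iff g_def keys_part)
  qed
  finally show ?thesis by simp
qed

lemma hcomp_negative: "n < 0 \<Longrightarrow> hcomp n f = 0"
  unfolding hcomp_def by (rule part_eq_0) simp

lemma lookup_hcomp: "lookup (hcomp n f) t = (if int (tdeg t) = n then lookup f t else 0)"
  by (simp add: hcomp_def lookup_part)

definition graded_ideal :: "('v::finite, 'k::field) mpoly set \<Rightarrow> bool" where
  "graded_ideal J \<longleftrightarrow> is_ideal J \<and> (\<forall>f\<in>J. \<forall>n. hcomp n f \<in> J)"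

lemma graded_ideal_ideal_of:
  assumes "\<And>g. g \<in> B \<Longrightarrow> \<exists>d. homogeneous_of_degree d g"
  shows "graded_ideal (ideal_of B)"
proof -
  have "hcomp n f \<in> ideal_of B" if "f \<in> ideal_of B" for f n
    using that
  proof (induction rule: ideal.span_induct_alt)
    case base
    then show ?case by (simp add: ideal.span_zero)
  next
    case (step c x y)
    obtain d where "homogeneous_of_degree d x" using assms step by blast
    from hcomp_mult[OF this, of "n - int d" c]
    have "hcomp n (c * x) = hcomp (n - int d) c * x" by (simp add: mult.commute)
    then show ?case using step by (simp add: hcomp_add ideal.span_add ideal.span_scale ideal.span_base)
  qed
  then show ?thesis by (simp add: graded_ideal_def)
qed

text \<open>
  With the basis element \<open>bs\<close> placed in internal degree \<open>- weight ds bs\<close>, where \<open>ds\<close> are the degrees of the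
  elements of the sequence, the Koszul differential preserves degrees.
\<close>

fun weight :: "nat list \<Rightarrow> bool list \<Rightarrow> int" where
  "weight (d # ds) (True # bs) = int d + weight ds bs"
| "weight (d # ds) (False # bs) = weight ds bs"
| "weight _ _ = 0"

lemma weight_nonneg: "0 \<le> weight ds bs"
  by (induction ds bs rule: weight.induct) auto

lemma weight_le: "weight ds bs \<le> int (sum_list ds)"
  by (induction ds bs rule: weight.induct) auto

definition cochain_comp ::
  "nat list \<Rightarrow> int \<Rightarrow> (bool list \<Rightarrow> ('v::finite, 'k::field) mpoly) \<Rightarrow> bool list \<Rightarrow> ('v, 'k) mpoly" where
  "cochain_comp ds n c bs = hcomp (n + weight ds bs) (c bs)"

lemma koszul_d_cochain_comp:
  assumes "list_all2 homogeneous_of_degree ds xs" "length bs = length xs"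
  shows "koszul_d xs (cochain_comp ds n c) bs = cochain_comp ds n (koszul_d xs c) bs"
  using assms
proof (induction ds xs arbitrary: n c bs rule: list_all2_induct)
  case Nil
  then show ?case by (simp add: cochain_comp_def)
next
  case (Cons d ds x xs)
  obtain b bs' where bs: "bs = b # bs'" "length bs' = length xs" using Cons.prems by (cases bs) auto
  have F: "(\<lambda>u. cochain_comp (d # ds) n c (False # u)) = cochain_comp ds n (\<lambda>u. c (False # u))"
    and T: "(\<lambda>u. cochain_comp (d # ds) n c (True # u)) = cochain_comp ds (n + int d) (\<lambda>u. c (True # u))"
    by (auto simp: cochain_comp_def algebra_simps)
  show ?case
  proof (cases b)
    case False
    then show ?thesis using bs Cons.IH[of bs' n "\<lambda>u. c (False # u)"]
      by (simp add: F) (simp add: cochain_comp_def)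
  next
    case True
    have "koszul_d (x # xs) (cochain_comp (d # ds) n c) bs =
        x * cochain_comp (d # ds) n c (False # bs') - koszul_d xs (cochain_comp ds (n + int d) (\<lambda>u. c (True # u))) bs'"
      using True bs T by simp
    also have "\<dots> = x * hcomp (n + weight ds bs') (c (False # bs')) -
        hcomp (n + int d + weight ds bs') (koszul_d xs (\<lambda>u. c (True # u)) bs')"
      unfolding Cons.IH[of bs' "n + int d" "\<lambda>u. c (True # u)", OF bs(2)] by (simp add: cochain_comp_def)
    also have "x * hcomp (n + weight ds bs') (c (False # bs')) =
        hcomp (n + int d + weight ds bs') (x * c (False # bs'))"
      using hcomp_mult[OF Cons.hyps(1), of "n + weight ds bs'" "c (False # bs')"] by (simp add: algebra_simps)
    finally show ?thesis using True bs by (simp add: cochain_comp_def hcomp_diff algebra_simps)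
  qed
qed

lemma finite_cells: "finite (cells n i)"
  by (rule finite_subset[OF _ finite_lists_length_eq[of "UNIV :: bool set" n]]) (auto simp: cells_def)

lemma coboundary_sum:
  assumes J: "is_ideal J" and "finite A" "\<And>a. a \<in> A \<Longrightarrow> coboundary J xs i (c a)"
  shows "coboundary J xs i (\<lambda>b. \<Sum>a\<in>A. c a b)"
  using assms(2,3)
proof (induction A rule: finite_induct)
  case empty
  then show ?case
    unfolding coboundary_def by (intro exI[of _ "\<lambda>_. 0"]) (simp add: ideal.subspace_0[OF J])
next
  case (insert a A)
  then show ?case using coboundary_add[OF J] by simp
qed

text \<open>
  Exactness for \<open>x # xs\<close> implies that multiplication by \<open>x\<close> is surjective on the cohomology for \<open>xs\<close> one
  degree lower; since \<open>x\<close> has positive degree, that cohomology vanishes by the graded version of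
  Nakayama's lemma.
\<close>

lemma koszul_exact_tail:
  assumes J: "graded_ideal J" and x: "homogeneous_of_degree d x" "d > 0"
    and xs: "\<And>y. y \<in> set xs \<Longrightarrow> \<exists>e. homogeneous_of_degree e y"
    and ex: "koszul_exact J (x # xs) (Suc i)"
  shows "koszul_exact J xs i"
  unfolding koszul_exact_def
proof (intro allI impI)
  fix c assume c: "cocycle J xs i c"
  have id: "is_ideal J" using J by (simp add: graded_ideal_def)
  have "\<exists>ds. list_all2 homogeneous_of_degree ds xs"
    using xs
  proof (induction xs)
    case (Cons y ys)
    obtain e where "homogeneous_of_degree e y" using Cons.prems by auto
    moreover obtain ds where "list_all2 homogeneous_of_degree ds ys" using Cons by auto
    ultimately have "list_all2 homogeneous_of_degree (e # ds) (y # ys)" by simp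
    then show ?case by blast
  qed simp
  then obtain ds where ds: "list_all2 homogeneous_of_degree ds xs" ..
  \<comment> \<open>Extended by \<open>0\<close>, the cocycle \<open>c\<close> for \<open>xs\<close> becomes a cocycle for \<open>x # xs\<close>, and a primitive of it yields \<open>b\<close>.\<close>
  have divide: "\<exists>b. cocycle J xs i b \<and> coboundary J xs i (\<lambda>bs. c bs - x * b bs)"
    if c: "cocycle J xs i c" for c
  proof -
    define c' where "c' = (\<lambda>bs. case bs of True # bs' \<Rightarrow> c bs' | _ \<Rightarrow> 0)"
    have c'_simps: "c' (True # bs) = c bs" "c' (False # bs) = 0" for bs by (simp_all add: c'_def)
    have "cocycle J (x # xs) (Suc i) c'"
      unfolding cocycle_def
    proof
      fix bs assume "bs \<in> cells (length (x # xs)) (Suc (Suc i))"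
      then have "bs \<in> cells (Suc (length xs)) (Suc (Suc i))" by simp
      then show "koszul_d (x # xs) c' bs \<in> J"
      proof (cases rule: cells_SucE)
        case (1 bs')
        then show ?thesis by (simp add: c'_simps ideal.subspace_0[OF id])
      next
        case (2 bs' j)
        then have "- koszul_d xs c bs' \<in> J"
          using c by (intro ideal.subspace_neg[OF id]) (simp add: cocycle_def)
        then show ?thesis using 2 by (simp add: c'_simps)
      qed
    qed
    then obtain e where e: "\<And>bs. bs \<in> cells (length (x # xs)) (Suc i) \<Longrightarrow> c' bs - koszul_d (x # xs) e bs \<in> J"
      using ex unfolding koszul_exact_def coboundary_def by blast
    have "cocycle J xs i (\<lambda>u. e (False # u))"
      unfolding cocycle_def
    proof
      fix bs assume "bs \<in> cells (length xs) (Suc i)"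
      then have "- koszul_d xs (\<lambda>u. e (False # u)) bs \<in> J" using e[of "False # bs"] by (simp add: c'_simps)
      from ideal.subspace_neg[OF id this] show "koszul_d xs (\<lambda>u. e (False # u)) bs \<in> J" by simp
    qed
    moreover have "coboundary J xs i (\<lambda>bs. c bs - x * e (False # bs))"
      unfolding coboundary_def
    proof (intro exI ballI)
      fix bs assume bs: "bs \<in> cells (length xs) i"
      have "koszul_d xs (\<lambda>u. - e (True # u)) bs = - koszul_d xs (\<lambda>u. e (True # u)) bs"
        using koszul_d_scale[of xs "-1" "\<lambda>u. e (True # u)" bs] by simp
      then show "c bs - x * e (False # bs) - koszul_d xs (\<lambda>u. - e (True # u)) bs \<in> J"
        using e[of "True # bs"] bs by (simp add: c'_simps algebra_simps)
    qed
    ultimately show ?thesis by blast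
  qed
  \<comment> \<open>Division by \<open>x\<close> lowers the internal degree by \<open>d > 0\<close>, and below \<open>- sum_list ds\<close> all components vanish.\<close>
  have comp: "coboundary J xs i (cochain_comp ds n c)" if "cocycle J xs i c" for c n
    using that
  proof (induction "nat (n + int (sum_list ds) + 1)" arbitrary: n c rule: less_induct)
    case less
    show ?case
    proof (cases "n + int (sum_list ds) < 0")
      case True
      have "cochain_comp ds n c bs = 0" for bs
        unfolding cochain_comp_def using True weight_le[of ds bs] by (intro hcomp_negative) linarith
      then show ?thesis unfolding coboundary_def
        by (intro exI[of _ "\<lambda>_. 0"]) (simp add: ideal.subspace_0[OF id])
    next
      case False
      obtain b where b: "cocycle J xs i b" "coboundary J xs i (\<lambda>bs. c bs - x * b bs)"
        using divide[OF less.prems] by blast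
      obtain e where e: "\<And>bs. bs \<in> cells (length xs) i \<Longrightarrow> c bs - x * b bs - koszul_d xs e bs \<in> J"
        using b(2) unfolding coboundary_def by blast
      have "coboundary J xs i (cochain_comp ds (n - int d) b)"
        using less.hyps[of "n - int d" b] b(1) x(2) False by simp
      from coboundary_add[OF id coboundary_scale[OF id this, of x] coboundary_d[OF id, of xs i "cochain_comp ds n e"]]
      have *: "coboundary J xs i (\<lambda>bs. x * cochain_comp ds (n - int d) b bs + koszul_d xs (cochain_comp ds n e) bs)" .
      show ?thesis
      proof (rule coboundary_cong[OF id *])
        fix bs assume bs: "bs \<in> cells (length xs) i"
        then have "hcomp (n + weight ds bs) (c bs - x * b bs - koszul_d xs e bs) \<in> J"
          using e J by (simp add: graded_ideal_def)
        moreover have "hcomp (n + weight ds bs) (x * b bs) = x * cochain_comp ds (n - int d) b bs"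
          using hcomp_mult[OF x(1), of "n - int d + weight ds bs" "b bs"]
          by (simp add: cochain_comp_def algebra_simps)
        moreover have "hcomp (n + weight ds bs) (koszul_d xs e bs) = koszul_d xs (cochain_comp ds n e) bs"
          using koszul_d_cochain_comp[OF ds, of bs n e] bs by (simp add: cochain_comp_def cells_def)
        ultimately show "cochain_comp ds n c bs -
            (x * cochain_comp ds (n - int d) b bs + koszul_d xs (cochain_comp ds n e) bs) \<in> J"
          by (simp add: hcomp_diff hcomp_add cochain_comp_def[of ds n c] diff_diff_eq)
      qed
    qed
  qed
  \<comment> \<open>Components outside the range from \<open>- W\<close> to \<open>N\<close> are zero on the finitely many cells of degree \<open>i\<close>.\<close>
  define W where "W = int (sum_list ds)"
  define N where "N = (MAX t \<in> insert 0 (\<Union>bs\<in>cells (length xs) i. keys (c bs)). int (tdeg t))"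
  have "coboundary J xs i (\<lambda>bs. \<Sum>n\<in>{-W..N}. cochain_comp ds n c bs)"
    by (rule coboundary_sum[OF id _ comp[OF c]]) simp
  then show "coboundary J xs i c"
  proof (rule coboundary_cong[OF id])
    fix bs assume bs: "bs \<in> cells (length xs) i"
    have "(\<Sum>n\<in>{-W..N}. cochain_comp ds n c bs) = c bs"
    proof (rule poly_mapping_eqI)
      fix t
      have "int (tdeg t) \<le> N" if "t \<in> keys (c bs)"
        unfolding N_def using bs that by (intro Max_ge) (auto simp: finite_cells)
      then have "lookup (c bs) t = 0" if "int (tdeg t) > N"
        using that by (metis in_keys_iff not_le)
      moreover have "int (tdeg t) - weight ds bs \<ge> -W" using weight_le[of ds bs] by (simp add: W_def)
      moreover have "(\<Sum>n\<in>{-W..N}. if int (tdeg t) = n + weight ds bs then lookup (c bs) t else 0)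
          = (\<Sum>n\<in>{-W..N}. if n = int (tdeg t) - weight ds bs then lookup (c bs) t else 0)"
        by (intro sum.cong) auto
      ultimately show "lookup (\<Sum>n\<in>{-W..N}. cochain_comp ds n c bs) t = lookup (c bs) t"
        using weight_nonneg[of ds bs]
        by (auto simp: lookup_sum cochain_comp_def lookup_hcomp)
    qed
    then show "c bs - (\<Sum>n\<in>{-W..N}. cochain_comp ds n c bs) \<in> J" by (simp add: ideal.subspace_0[OF id])
  qed
qed

lemma koszul_exact_drop:
  assumes "graded_ideal J" "\<And>y. y \<in> set zs \<Longrightarrow> \<exists>e>0. homogeneous_of_degree e y"
    and "\<And>y. y \<in> set xs \<Longrightarrow> \<exists>e. homogeneous_of_degree e y"
    and "koszul_exact J (zs @ xs) (length zs + i)"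
  shows "koszul_exact J xs i"
  using assms(2,4)
proof (induction zs)
  case (Cons z zs)
  obtain d where d: "d > 0" "homogeneous_of_degree d z" using Cons.prems(1) by auto
  have "koszul_exact J (zs @ xs) (length zs + i)"
  proof (rule koszul_exact_tail[OF assms(1) d(2,1)])
    show "\<exists>e. homogeneous_of_degree e y" if "y \<in> set (zs @ xs)" for y
      using that Cons.prems(1)[of y] assms(3)[of y] by auto
    show "koszul_exact J (z # zs @ xs) (Suc (length zs + i))" using Cons.prems(2) by simp
  qed
  then show ?case using Cons by simp
qed simp

text \<open>
  Since powers of the elements of \<open>ys\<close> lie in the ideal generated by \<open>J\<close> and \<open>\<theta>\<close>, the Koszul complex
  on \<open>\<theta>\<close> is exact below the length of \<open>ys\<close>; dropping the last elements of \<open>\<theta>\<close> leaves the exactness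
  needed for its initial segments.
\<close>

lemma hsop_weakly_regular:
  assumes J: "graded_ideal J" and ys: "weakly_regular J ys" "length ys = length \<theta>"
    and th: "positive_homogeneous \<theta>" and rad: "\<And>y. y \<in> set ys \<Longrightarrow> \<exists>N. y ^ N \<in> ideal_of (J \<union> set \<theta>)"
  shows "weakly_regular J \<theta>"
proof (rule weakly_regular_if_koszul_exact[of J "[]"])
  show id: "is_ideal J" using J by (simp add: graded_ideal_def)
  show "set [] \<subseteq> J" by simp
  fix k i assume k: "k \<le> length \<theta>" "i < k"
  have hom: "\<exists>e>0. homogeneous_of_degree e y" if "y \<in> set \<theta>" for y
    using th that by (auto simp: positive_homogeneous_def)
  let ?zs = "rev (drop k \<theta>)" and ?xs = "rev (take k \<theta>)"
  have eq: "?zs @ ?xs = rev \<theta>" by (simp flip: rev_append)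
  have "koszul_exact J (rev \<theta>) (length ?zs + i)"
  proof (rule koszul_exact_below_grade[OF id ys(1)])
    show "\<exists>N. y ^ N \<in> ideal_of (J \<union> set (rev \<theta>))" if "y \<in> set ys" for y
      using rad[OF that] by (simp only: set_rev)
    show "length ?zs + i < length ys" using k ys(2) by simp
  qed
  then have ex: "koszul_exact J (?zs @ ?xs) (length ?zs + i)" by (simp only: eq)
  have "koszul_exact J ?xs i"
  proof (rule koszul_exact_drop[OF J _ _ ex])
    show "\<exists>e>0. homogeneous_of_degree e y" if "y \<in> set ?zs" for y
      using hom[of y] that in_set_dropD[of y k \<theta>] by simp
    show "\<exists>e. homogeneous_of_degree e y" if "y \<in> set ?xs" for y
      using hom[of y] that in_set_takeD[of y k \<theta>] by auto
  qed
  then show "koszul_exact J (rev (take k \<theta>) @ []) i" by simp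
qed

section \<open>Dimensions of quotients of the polynomial ring\<close>

lemma poly_eq_sum_monomials:
  "f = (\<Sum>t\<in>keys f. single t (lookup f t))"
  by (rule poly_mapping_eqI) (simp add: lookup_sum lookup_single when_def in_keys_iff)

lemma lookup_Const_mult [simp]: "lookup (Const c * f) t = c * lookup f t"
  unfolding Const_def mult_map_scale_conv_mult[symmetric]
  by (simp add: Poly_Mapping.map.rep_eq when_def)

lemma Const_add: "Const (a + b) = Const a + Const b"
  by (simp add: Const_def single_add)

lemma Const_mult: "Const (a * b) = Const a * Const b"
  by (simp add: Const_def mult_single)

lemma Const_1 [simp]: "Const 1 = 1" and Const_0 [simp]: "Const 0 = 0"
  by (simp_all add: Const_def)

lemma Const_mult_single: "Const c * single t a = single t (c * a)"
  by (simp add: Const_def mult_single)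

lemma vector_space_mpoly: "vector_space (\<lambda>(c::'k::field) (f::('v, 'k) mpoly). Const c * f)"
  by standard (simp_all add: Const_add Const_mult algebra_simps)

text \<open>
  Reading off the coefficients of \<open>\<sigma> f\<close> at the monomials in \<open>\<Lambda>\<close> embeds \<open>W/U\<close> into a space of dimension
  \<open>card \<Lambda>\<close>.
\<close>

lemma quotient_dim_le_card:
  fixes \<sigma> :: "('v, 'k::field) mpoly \<Rightarrow> ('v, 'k) mpoly"
  assumes W: "is_ideal W" and fin: "finite \<Lambda>"
    and add: "\<And>f g. \<sigma> (f + g) = \<sigma> f + \<sigma> g" and scale: "\<And>c f. \<sigma> (Const c * f) = Const c * \<sigma> f"
    and ker: "\<And>f. f \<in> W \<Longrightarrow> (\<And>t. t \<in> \<Lambda> \<Longrightarrow> lookup (\<sigma> f) t = 0) \<Longrightarrow> f \<in> U"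
  shows "quotient_dim W U \<le> enat (card \<Lambda>)"
  unfolding quotient_dim_def
proof (rule SUP_least, safe)
  fix B assume B: "finite B" "B \<subseteq> W" "independent_mod U B"
  interpret vs: vector_space "\<lambda>(c::'k) (f::('v, 'k) mpoly). Const c * f" by (rule vector_space_mpoly)
  define p where "p f = part (\<lambda>t. t \<in> \<Lambda>) (\<sigma> f)" for f
  have p0: "\<sigma> 0 = 0" using scale[of 0 0] by simp
  have p_comb: "p (\<Sum>b\<in>A. Const (c b) * b) = (\<Sum>b\<in>A. Const (c b) * p b)" if "finite A" for c A
    using that
  proof (induction A rule: finite_induct)
    case empty
    show ?case by (rule poly_mapping_eqI) (simp add: p_def p0 lookup_part)
  next
    case (insert a A)
    have "p (x + y) = p x + p y" for x y by (simp add: p_def add part_add)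
    moreover have "p (Const c * x) = Const c * p x" for c x
      by (rule poly_mapping_eqI) (simp add: p_def scale lookup_part)
    ultimately show ?case using insert by simp
  qed
  have zero: "\<forall>b\<in>B. c b = 0" if "(\<Sum>b\<in>B. Const (c b) * p b) = 0" for c
  proof -
    have "p (\<Sum>b\<in>B. Const (c b) * b) = 0" using p_comb[OF B(1)] that by simp
    then have "lookup (\<sigma> (\<Sum>b\<in>B. Const (c b) * b)) t = 0" if "t \<in> \<Lambda>" for t
      using that lookup_part[of "\<lambda>t. t \<in> \<Lambda>" "\<sigma> (\<Sum>b\<in>B. Const (c b) * b)" t] by (simp add: p_def)
    moreover have "(\<Sum>b\<in>B. Const (c b) * b) \<in> W"
      using B(2) by (intro ideal.subspace_sum[OF W] ideal.subspace_scale[OF W]) auto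
    ultimately have "(\<Sum>b\<in>B. Const (c b) * b) \<in> U" by (intro ker)
    then show ?thesis using B(3) unfolding independent_mod_def by blast
  qed
  have inj: "inj_on p B"
  proof (rule inj_onI, rule ccontr)
    fix b b' assume b: "b \<in> B" "b' \<in> B" "p b = p b'" "b \<noteq> b'"
    \<comment> \<open>If \<open>p\<close> identified two elements of \<open>B\<close>, their difference would be a nontrivial relation.\<close>
    define c :: "('v, 'k) mpoly \<Rightarrow> 'k" where "c x = (if x = b then 1 else if x = b' then -1 else 0)" for x
    have "(\<Sum>x\<in>B. Const (c x) * p x) = (\<Sum>x\<in>{b, b'}. Const (c x) * p x)"
      by (rule sum.mono_neutral_right) (use B(1) b in \<open>auto simp: c_def\<close>)
    also have "\<dots> = Const (1 + -1) * p b'"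
      unfolding Const_add using b by (simp add: c_def algebra_simps)
    finally have "c b = 0" using zero[of c] b by simp
    then show False by (simp add: c_def)
  qed
  have "vs.independent (p ` B)"
    unfolding vs.independent_explicit_module
  proof (intro allI impI)
    fix t u v assume t: "finite t" "t \<subseteq> p ` B" "(\<Sum>v\<in>t. Const (u v) * v) = 0" "v \<in> t"
    define c where "c b = (if p b \<in> t then u (p b) else 0)" for b
    have "(\<Sum>v\<in>t. Const (u v) * v) = (\<Sum>v\<in>p ` B. Const (if v \<in> t then u v else 0) * v)"
      using B(1) t by (intro sum.mono_neutral_cong_left) auto
    also have "\<dots> = (\<Sum>b\<in>B. Const (c b) * p b)"
      by (simp add: sum.reindex[OF inj] c_def)
    finally have "\<forall>b\<in>B. c b = 0" using zero t(3) by simp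
    moreover obtain b where "b \<in> B" "v = p b" using t(2,4) by blast
    ultimately show "u v = 0" using t(4) by (auto simp: c_def)
  qed
  moreover have "p ` B \<subseteq> vs.span ((\<lambda>t. single t 1) ` \<Lambda>)"
  proof safe
    fix b assume "b \<in> B"
    have "p b = (\<Sum>t\<in>keys (p b). Const (lookup (p b) t) * single t 1)"
      by (simp add: Const_mult_single) (rule poly_eq_sum_monomials)
    moreover have "\<dots> \<in> vs.span ((\<lambda>t. single t 1) ` \<Lambda>)"
      by (intro vs.span_sum vs.span_scale vs.span_base) (auto simp: p_def keys_part)
    ultimately show "p b \<in> vs.span ((\<lambda>t. single t 1) ` \<Lambda>)" by simp
  qed
  ultimately have "card (p ` B) \<le> card ((\<lambda>t. single t (1::'k)) ` \<Lambda>)"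
    using fin by (intro vs.independent_span_bound[THEN conjunct2]) auto
  also have "\<dots> \<le> card \<Lambda>" by (rule card_image_le[OF fin])
  finally show "enat (card B) \<le> enat (card \<Lambda>)" using inj by (simp add: card_image)
qed

lemma card_le_quotient_dim:
  fixes U W :: "('v, 'k::field) mpoly set"
  assumes "finite \<Lambda>" "\<And>t. t \<in> \<Lambda> \<Longrightarrow> single t 1 \<in> W"
    and ker: "\<And>c t. (\<Sum>t\<in>\<Lambda>. single t (c t)) \<in> U \<Longrightarrow> t \<in> \<Lambda> \<Longrightarrow> c t = 0"
  shows "enat (card \<Lambda>) \<le> quotient_dim W U"
proof -
  define B where "B = (\<lambda>t. single t (1::'k)) ` \<Lambda>"
  have inj: "inj_on (\<lambda>t. single t (1::'k)) \<Lambda>"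
    by (rule inj_onI) (metis keys_single singleton_inject one_neq_zero)
  have "independent_mod U B"
    unfolding independent_mod_def
  proof (intro allI impI)
    fix c assume "(\<Sum>b\<in>B. Const (c b) * b) \<in> U"
    then have "(\<Sum>t\<in>\<Lambda>. single t (c (single t 1))) \<in> U"
      by (simp add: B_def sum.reindex[OF inj] Const_mult_single)
    then show "\<forall>b\<in>B. c b = 0" using ker by (auto simp: B_def)
  qed
  moreover have "finite B" "B \<subseteq> W" using assms(1,2) by (auto simp: B_def)
  ultimately have "enat (card B) \<le> quotient_dim W U"
    unfolding quotient_dim_def by (intro SUP_upper) simp
  then show ?thesis by (simp add: B_def card_image[OF inj])
qed

text \<open>
  The socle is Koszul cohomology of degree \<open>0\<close> for the sequence of all variables, and a linear
  isomorphism carries independent elements to independent elements.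
\<close>

lemma socle_dim_le_if_cohomology_iso:
  fixes J J' :: "('v::finite, 'k::field) mpoly set"
  assumes iso: "cohomology_iso xs J 0 J' 0" and xs: "set xs = range Var"
    and J: "is_ideal J" and J': "is_ideal J'"
  shows "socle_dim J \<le> socle_dim J'"
  unfolding socle_dim_def quotient_dim_def[of "{f. \<forall>v. Var v * f \<in> J}"]
proof (rule SUP_least, safe)
  fix B assume B: "finite B" "B \<subseteq> {f. \<forall>v. Var v * f \<in> J}" "independent_mod J B"
  define o_cell where "o_cell = replicate (length xs) False"
  obtain R where R: "R (\<lambda>_. 0) (\<lambda>_. 0)"
     "\<And>c e c' e' r. R c e \<Longrightarrow> R c' e' \<Longrightarrow> R (\<lambda>b. r * c b + c' b) (\<lambda>b. r * e b + e' b)"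
     "\<And>c. cocycle J xs 0 c \<Longrightarrow> \<exists>e. R c e" 
     "\<And>c e. R c e \<Longrightarrow> cocycle J xs 0 c \<and> cocycle J' xs 0 e \<and>
        (coboundary J xs 0 c \<longleftrightarrow> coboundary J' xs 0 e)"
    using iso unfolding cohomology_iso_def by blast
  have "\<exists>e. R (\<lambda>_. b) e" if "b \<in> B" for b
    using that B(2) xs by (intro R(3)) (auto simp: cocycle_0_iff[OF J])
  then obtain e where e: "\<And>b. b \<in> B \<Longrightarrow> R (\<lambda>_. b) (e b)" by metis
  define g where "g b = e b o_cell" for b
  have comb: "R (\<lambda>_. \<Sum>b\<in>A. Const (c b) * b) (\<lambda>z. \<Sum>b\<in>A. Const (c b) * e b z)"
    if "finite A" "A \<subseteq> B" for A c
    using that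
  proof (induction A rule: finite_induct)
    case (insert a A)
    then show ?case using R(2)[OF e, of a _ _ "Const (c a)"] by simp
  qed (simp add: R(1))
  have zero: "\<forall>b\<in>B. c b = 0" if "(\<Sum>b\<in>B. Const (c b) * g b) \<in> J'" for c
  proof -
    have "(\<Sum>b\<in>B. Const (c b) * b) \<in> J"
      using R(4)[OF comb[OF B(1) order_refl, of c]] that by (simp add: coboundary_0_iff g_def o_cell_def)
    then show ?thesis using B(3) unfolding independent_mod_def by blast
  qed
  have inj: "inj_on g B"
  proof (rule inj_onI, rule ccontr)
    fix b b' assume b: "b \<in> B" "b' \<in> B" "g b = g b'" "b \<noteq> b'"
    define c :: "('v, 'k) mpoly \<Rightarrow> 'k" where "c x = (if x = b then 1 else if x = b' then -1 else 0)" for x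
    have "(\<Sum>x\<in>B. Const (c x) * g x) = (\<Sum>x\<in>{b, b'}. Const (c x) * g x)"
      by (rule sum.mono_neutral_right) (use B(1) b in \<open>auto simp: c_def\<close>)
    also have "\<dots> = Const (1 + -1) * g b'"
      unfolding Const_add using b by (simp add: c_def algebra_simps)
    finally have "(\<Sum>x\<in>B. Const (c x) * g x) \<in> J'" by (simp add: ideal.subspace_0[OF J'])
    then have "c b = 0" using zero[of c] b by simp
    then show False by (simp add: c_def)
  qed
  have "independent_mod J' (g ` B)"
    unfolding independent_mod_def
    using zero[of "\<lambda>b. _ (g b)"] by (auto simp: sum.reindex[OF inj])
  moreover have "g ` B \<subseteq> {f. \<forall>v. Var v * f \<in> J'}"
    using R(4)[OF e] xs by (auto simp: cocycle_0_iff[OF J'] g_def o_cell_def)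
  ultimately have "enat (card (g ` B)) \<le> quotient_dim {f. \<forall>v. Var v * f \<in> J'} J'"
    unfolding quotient_dim_def using B(1) by (intro SUP_upper) simp
  then show "enat (card B) \<le> quotient_dim {f. \<forall>v. Var v * f \<in> J'} J'"
    by (simp add: card_image[OF inj])
qed

lemma Var_power: "Var v ^ m = single (single v m) 1"
  by (induction m) (simp_all add: Var_def mult_single single_add[symmetric])

lemma single_mem_ideal:
  assumes "is_ideal J" "Var v ^ n \<in> J" "n \<le> lookup t v"
  shows "single t c \<in> J"
proof -
  define s where "s = t - single v n"
  have "t = s + single v n"
    using assms(3) by (intro poly_mapping_eqI) (auto simp: s_def lookup_add lookup_minus lookup_single when_def)
  then have "single t c = single s c * Var v ^ n"
    by (simp add: Var_power mult_single)
  then show ?thesis using ideal.subspace_scale[OF assms(1,2)] by simp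
qed

lemma mem_ideal_if_keys:
  assumes "is_ideal J" "\<And>t c. t \<in> keys f \<Longrightarrow> single t c \<in> J"
  shows "f \<in> J"
  by (subst poly_eq_sum_monomials) (intro ideal.subspace_sum[OF assms(1)] assms(2))

lemma positive_homogeneous_mem:
  assumes "homogeneous_of_degree n f" "n > 0"
  shows "f \<in> ideal_of (range Var)"
proof (rule mem_ideal_if_keys)
  fix t c assume "t \<in> keys f"
  then have "tdeg t > 0" using assms by (simp add: homogeneous_of_degree_iff)
  then obtain v where "lookup t v \<noteq> 0" unfolding tdeg_def by (metis sum.neutral less_irrefl)
  moreover have "Var v ^ 1 \<in> ideal_of (range Var)" by (simp add: ideal.span_base)
  ultimately show "single t c \<in> ideal_of (range Var)"
    by (intro single_mem_ideal[of _ v 1]) auto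
qed simp

text \<open>
  A monomial of large degree is divisible by a high power of some variable, and all monomials of
  \<open>f ^ N\<close> have degree at least \<open>N\<close>.
\<close>

lemma positive_homogeneous_nilpotent:
  fixes f :: "('v::finite, 'k::field) mpoly"
  assumes J: "is_ideal J" and nil: "\<And>v::'v. \<exists>N. Var v ^ N \<in> J" and f: "homogeneous_of_degree n f" "n > 0"
  shows "\<exists>N. f ^ N \<in> J"
proof -
  obtain N where N: "\<And>v. Var v ^ N v \<in> J" using nil by metis
  define M where "M = (\<Sum>v\<in>UNIV. N v)"
  have deg: "m \<le> tdeg t" if "t \<in> keys (f ^ m)" for m t
    using that
  proof (induction m arbitrary: t)
    case (Suc m)
    then obtain a b where "t = a + b" "a \<in> keys f" "b \<in> keys (f ^ m)"
      using keys_mult[of f "f ^ m"] by auto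
    then show ?case using Suc.IH[of b] f by (auto simp: homogeneous_of_degree_iff)
  qed simp
  have "f ^ Suc M \<in> J"
  proof (rule mem_ideal_if_keys[OF J])
    fix t c assume "t \<in> keys (f ^ Suc M)"
    then have "M < tdeg t" using deg[of t "Suc M"] by simp
    then have "\<exists>v. N v \<le> lookup t v"
      unfolding M_def tdeg_def by (metis linorder_not_le nat_less_le sum_mono)
    then show "single t c \<in> J" using single_mem_ideal[OF J N] by blast
  qed
  then show ?thesis by blast
qed

text \<open>
  Otherwise the powers of the variable would be infinitely many elements of different degrees outside
  the graded ideal \<open>J\<close>, hence independent modulo \<open>J\<close>.
\<close>

lemma Var_nilpotent_if_finite_dim:
  fixes J :: "('v::finite, 'k::field) mpoly set"
  assumes J: "graded_ideal J" and fin: "quotient_dim UNIV J < \<infinity>"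
  shows "\<exists>N. Var v ^ N \<in> J"
proof (rule ccontr)
  assume no: "\<nexists>N. Var v ^ N \<in> J"
  have id: "is_ideal J" using J by (simp add: graded_ideal_def)
  have "enat n \<le> quotient_dim UNIV J" for n
  proof -
    define \<Lambda> where "\<Lambda> = (\<lambda>k. single v k) ` {..<n}"
    have "inj_on (\<lambda>k. single v k) {..<n}"
      by (rule inj_onI) (metis lookup_single_eq)
    then have "card \<Lambda> = n" by (simp add: \<Lambda>_def card_image)
    moreover have "enat (card \<Lambda>) \<le> quotient_dim UNIV J"
    proof (rule card_le_quotient_dim)
      fix c t assume s: "(\<Sum>t\<in>\<Lambda>. single t (c t)) \<in> J" and t: "t \<in> \<Lambda>"
      obtain k where k: "t = single v k" using t by (auto simp: \<Lambda>_def)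
      have "hcomp (int k) (\<Sum>t\<in>\<Lambda>. single t (c t)) = single t (c t)"
      proof (rule poly_mapping_eqI)
        fix u
        have "lookup (hcomp (int k) (\<Sum>t\<in>\<Lambda>. single t (c t))) u =
            (if tdeg u = k \<and> u \<in> \<Lambda> then c u else 0)"
          by (simp add: lookup_hcomp lookup_sum lookup_single when_def \<Lambda>_def)
        also have "\<dots> = (if u = t then c u else 0)" using t k by (auto simp: \<Lambda>_def)
        finally show "lookup (hcomp (int k) (\<Sum>t\<in>\<Lambda>. single t (c t))) u =
            lookup (single t (c t)) u" by (simp add: lookup_single when_def)
      qed
      moreover have "hcomp (int k) (\<Sum>t\<in>\<Lambda>. single t (c t)) \<in> J"
        using J s by (simp add: graded_ideal_def)
      ultimately have "Const (1 / c t) * single t (c t) \<in> J"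
        using ideal.subspace_scale[OF id] by simp
      then show "c t = 0" using no k by (cases "c t = 0") (simp_all add: Const_mult_single Var_power)
    qed (auto simp: \<Lambda>_def)
    ultimately show ?thesis by simp
  qed
  then have "quotient_dim UNIV J = \<infinity>"
    by (metis Suc_ile_eq enat.exhaust less_irrefl)
  then show False using fin by simp
qed

section \<open>Independence of the system of parameters, and a bound on the depth\<close>

lemma list_of_all_Vars:
  obtains xs :: "('v::finite, 'k::field) mpoly list" where "set xs = range Var"
  using finite_list[of "range (Var :: 'v \<Rightarrow> ('v, 'k) mpoly)"] by auto

text \<open>
  Both sequences are regular of the same length, so both socles are identified with the same Koszul
  cohomology module of \<open>S/I\<close>.
\<close>

theorem socle_dim_hsop:
  fixes I :: "('v::finite, 'k::field) mpoly set"
  assumes I: "graded_ideal I" and ys: "weakly_regular I ys" "positive_homogeneous ys"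
    and th: "positive_homogeneous \<theta>" "length \<theta> = length ys"
    and fin: "quotient_dim UNIV (ideal_of (I \<union> set \<theta>)) < \<infinity>"
  shows "socle_dim (ideal_of (I \<union> set \<theta>)) = socle_dim (ideal_of (I \<union> set ys))"
proof -
  obtain xs :: "('v, 'k) mpoly list" where xs: "set xs = range Var" by (rule list_of_all_Vars)
  have id: "is_ideal I" using I by (simp add: graded_ideal_def)
  have mem: "set zs \<subseteq> ideal_of (set xs)" if "positive_homogeneous zs" for zs :: "('v, 'k) mpoly list"
    using that positive_homogeneous_mem by (auto simp: positive_homogeneous_def xs)
  have "graded_ideal (ideal_of (I \<union> set \<theta>))"
  proof -
    have "hcomp n f \<in> ideal_of (I \<union> set \<theta>)" if f: "f \<in> ideal_of (I \<union> set \<theta>)" for f n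
    proof -
      obtain a b where ab: "f = a + b" "a \<in> ideal_of I" "b \<in> ideal_of (set \<theta>)"
        using f unfolding ideal.span_Un by blast
      have "ideal_of I = I" using id by (simp only: ideal.span_eq_iff)
      then have "hcomp n a \<in> ideal_of I" using ab(2) I unfolding graded_ideal_def by (metis (no_types))
      moreover have "hcomp n b \<in> ideal_of (set \<theta>)"
        using graded_ideal_ideal_of[of "set \<theta>"] th(1) ab(3)
        by (force simp: graded_ideal_def positive_homogeneous_def)
      ultimately show ?thesis unfolding ideal.span_Un ab(1) hcomp_add by blast
    qed
    then show ?thesis by (simp add: graded_ideal_def)
  qed
  from Var_nilpotent_if_finite_dim[OF this fin]
  have nil: "\<exists>N. Var v ^ N \<in> ideal_of (I \<union> set \<theta>)" for v .
  have "weakly_regular I \<theta>"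
  proof (rule hsop_weakly_regular[OF I ys(1) th(2)[symmetric] th(1)])
    fix y assume "y \<in> set ys"
    then obtain n where "n > 0" "homogeneous_of_degree n y" using ys(2) by (auto simp: positive_homogeneous_def)
    then show "\<exists>N. y ^ N \<in> ideal_of (I \<union> set \<theta>)"
      by (intro positive_homogeneous_nilpotent[OF _ nil]) auto
  qed
  from cohomology_iso_regular[OF id this mem[OF th(1)]] cohomology_iso_regular[OF id ys(1) mem[OF ys(2)]]
  have "cohomology_iso xs (ideal_of (I \<union> set \<theta>)) 0 (ideal_of (I \<union> set ys)) 0"
    unfolding th(2) by (rule cohomology_iso_trans[OF _ cohomology_iso_sym])
  then show ?thesis
    using socle_dim_le_if_cohomology_iso[OF _ xs] cohomology_iso_sym[of xs] ideal.subspace_span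
    by (meson antisym)
qed

text \<open>
  The element \<open>u\<close> represents a nonzero Koszul cohomology class of degree \<open>0\<close> for the variables outside
  \<open>F\<close>. Adding the \<open>card F\<close> variables in \<open>F\<close> to this sequence raises the grade by at most \<open>card F\<close>, while the
  irrelevant ideal has grade at least \<open>length ys\<close>.
\<close>

lemma regular_sequence_length_le:
  fixes I :: "('v::finite, 'k::field) mpoly set"
  assumes I: "graded_ideal I" and ys: "weakly_regular I ys" "positive_homogeneous ys"
    and u: "u \<notin> I" "\<And>v. v \<notin> F \<Longrightarrow> Var v * u \<in> I"
  shows "length ys \<le> card F"
proof (rule ccontr)
  assume "\<not> length ys \<le> card F"
  have id: "is_ideal I" using I by (simp add: graded_ideal_def)
  obtain fl where fl: "set fl = F" "length fl = card F" using finite_distinct_list[of F] distinct_card by fastforce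
  obtain cl where cl: "set cl = - F" using finite_list[of "- F"] by auto
  have hom: "homogeneous_of_degree 1 (Var v :: ('v, 'k) mpoly)" for v
    by (simp add: homogeneous_of_degree_iff Var_def)
  have "koszul_exact I (map Var fl @ map Var cl) (length (map Var fl) + 0)"
  proof (rule koszul_exact_below_grade[OF id ys(1)])
    have all: "set (map Var fl @ map Var cl) = range Var" using fl cl by auto
    fix y assume "y \<in> set ys"
    then have "y ^ 1 \<in> ideal_of (range Var)"
      using ys(2) positive_homogeneous_mem by (auto simp: positive_homogeneous_def)
    also have "\<dots> \<subseteq> ideal_of (I \<union> set (map Var fl @ map Var cl))"
      unfolding all by (rule ideal.span_mono) auto
    finally show "\<exists>N. y ^ N \<in> ideal_of (I \<union> set (map Var fl @ map Var cl))" by blast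
  qed (use \<open>\<not> length ys \<le> card F\<close> fl in simp)
  then have "koszul_exact I (map Var cl) 0"
    by (rule koszul_exact_drop[OF I, rotated 2]) (use hom in auto)
  moreover have "cocycle I (map Var cl) 0 (\<lambda>_. u)"
    using u(2) cl by (auto simp: cocycle_0_iff[OF id])
  ultimately show False using u(1) by (auto simp: koszul_exact_def coboundary_0_iff)
qed

section \<open>Edge ideals and a lower bound on the Krull dimension\<close>

lemma mem_monomial_ideal_iff:
  "f \<in> ideal_of ((\<lambda>t. single t (1::'k::field)) ` G) \<longleftrightarrow>
     (\<forall>t\<in>keys f. \<exists>g\<in>G. \<exists>s. t = s + g)" (is "?L \<longleftrightarrow> ?R f")
proof
  assume ?L
  then show "?R f"
  proof (induction rule: ideal.span_induct_alt)
    case (step c x y)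
    from step(1) obtain g where g: "g \<in> G" "x = single g 1" by blast
    show ?case
    proof
      fix t assume "t \<in> keys (c * x + y)"
      then have "t \<in> keys (c * x) \<or> t \<in> keys y" using keys_add[of "c * x" y] by blast
      then show "\<exists>g\<in>G. \<exists>s. t = s + g"
      proof
        assume "t \<in> keys (c * x)"
        then obtain s where "t = s + g" using keys_mult[of c x] g by auto
        then show ?thesis using g by blast
      qed (use step in blast)
    qed
  qed simp
next
  assume R: "?R f"
  show ?L
  proof (rule mem_ideal_if_keys)
    fix t c assume "t \<in> keys f"
    then obtain g s where gs: "g \<in> G" "t = s + g" using R by blast
    have "single t c = single s c * single g (1::'k)"
      unfolding gs(2) mult_single mult_1_right ..
    moreover have "single g (1::'k) \<in> ideal_of ((\<lambda>t. single t 1) ` G)"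
      using gs(1) by (simp add: ideal.span_base)
    ultimately show "single t c \<in> ideal_of ((\<lambda>t. single t 1) ` G)"
      by (simp only: ideal.span_scale)
  qed simp
qed

lemma single_divides_iff:
  fixes t :: "'v \<Rightarrow>\<^sub>0 nat"
  shows "(\<exists>s. t = s + single v n) \<longleftrightarrow> n \<le> lookup t v"
proof
  assume "n \<le> lookup t v"
  then have "t = (t - single v n) + single v n"
    by (intro poly_mapping_eqI) (auto simp: lookup_add lookup_minus lookup_single when_def)
  then show "\<exists>s. t = s + single v n" ..
qed (auto simp: lookup_add)

lemma pair_divides_iff:
  fixes t :: "'v \<Rightarrow>\<^sub>0 nat"
  assumes "u \<noteq> v"
  shows "(\<exists>s. t = s + (single u 1 + single v 1)) \<longleftrightarrow>
     0 < lookup t u \<and> 0 < lookup t v"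
proof
  assume "0 < lookup t u \<and> 0 < lookup t v"
  then have "t = (t - (single u 1 + single v 1)) +
      (single u 1 + single v 1)"
    using assms by (intro poly_mapping_eqI) (auto simp: lookup_add lookup_minus lookup_single when_def)
  then show "\<exists>s. t = s + (single u 1 + single v 1)" ..
qed (use assms in \<open>auto simp: lookup_add lookup_single when_def\<close>)

lemma Var_mult_Var: "Var u * Var v = single (single u 1 + single v 1) 1"
  by (simp add: Var_def mult_single)

lemma edge_ideal_eq_monomial:
  "edge_ideal E = ideal_of ((\<lambda>t. single t 1) `
     {single u 1 + single v 1 | u v. {u, v} \<in> E})"
  unfolding edge_ideal_def by (rule arg_cong[where f = "module.span (*)"]) (auto simp: Var_mult_Var)

lemma mem_edge_ideal_iff:
  fixes f :: "('v::finite, 'k::field) mpoly"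
  assumes "simple_graph E"
  shows "f \<in> edge_ideal E \<longleftrightarrow> (\<forall>t\<in>keys f. \<exists>u v. {u, v} \<in> E \<and>
      0 < lookup t u \<and> 0 < lookup t v)"
proof -
  have "u \<noteq> v" if "{u, v} \<in> E" for u v using assms that by (auto simp: simple_graph_def)
  then have "(\<exists>g\<in>{single u 1 + single v 1 | u v. {u, v} \<in> E}. \<exists>s. t = s + g) \<longleftrightarrow>
      (\<exists>u v. {u, v} \<in> E \<and> 0 < lookup t u \<and> 0 < lookup t v)" for t :: "'v \<Rightarrow>\<^sub>0 nat"
    using pair_divides_iff[of _ _ t] by blast
  then show ?thesis unfolding edge_ideal_eq_monomial mem_monomial_ideal_iff by simp
qed

lemma graded_ideal_edge_ideal: "graded_ideal (edge_ideal E)"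
  unfolding edge_ideal_def
  by (rule graded_ideal_ideal_of) (auto simp: Var_mult_Var homogeneous_of_degree_iff)

lemma mem_var_ideal_iff:
  "f \<in> ideal_of (Var ` D) \<longleftrightarrow> (\<forall>t\<in>keys f. \<exists>v\<in>D. 0 < lookup t v)"
proof -
  have "Var ` D = (\<lambda>t. single t 1) ` ((\<lambda>v. single v 1) ` D)"
    by (auto simp: Var_def)
  show ?thesis unfolding \<open>Var ` D = _\<close> mem_monomial_ideal_iff
    by (simp add: single_divides_iff Suc_le_eq)
qed

text \<open>
  A numbering of the variables turns exponent vectors into exponent vectors over \<open>nat\<close>, which carry a
  linear order compatible with addition. This supplies a monomial order although \<open>'v\<close> is not ordered.
\<close>

lemma monomial_order:
  obtains w :: "('v::finite \<Rightarrow>\<^sub>0 nat) \<Rightarrow> (nat \<Rightarrow>\<^sub>0 nat)" where "inj w" "\<And>s t. w (s + t) = w s + w t"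
proof -
  obtain idx :: "'v \<Rightarrow> nat" where idx: "inj idx"
    using finite_imp_inj_to_nat_seg[of "UNIV :: 'v set"] by auto
  define w where "w t = (\<Sum>v\<in>UNIV. single (idx v) (lookup t v))" for t :: "'v \<Rightarrow>\<^sub>0 nat"
  have lw: "lookup (w t) (idx v) = lookup t v" for t v
  proof -
    have "lookup (w t) (idx v) = (\<Sum>u\<in>UNIV. if u = v then lookup t u else 0)"
      unfolding w_def lookup_sum by (rule sum.cong) (auto simp: lookup_single when_def dest: injD[OF idx])
    then show ?thesis by simp
  qed
  show thesis
  proof (rule that)
    show "inj w" by (rule injI, rule poly_mapping_eqI) (metis lw)
    show "w (s + t) = w s + w t" for s t
      by (simp add: w_def lookup_add single_add sum.distrib)
  qed
qed

text \<open>
  Among the monomials that avoid \<open>D\<close>, the product of the largest one of \<open>a\<close> and the largest one of \<open>b\<close>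
  occurs in \<open>a * b\<close> without cancellation.
\<close>

lemma prime_ideal_var_ideal: "prime_ideal (ideal_of (Var ` D :: ('v::finite, 'k::field) mpoly set))"
  unfolding prime_ideal_def
proof (intro conjI allI impI)
  show "is_ideal (ideal_of (Var ` D :: ('v, 'k) mpoly set))" by simp
  have "(1 :: ('v, 'k) mpoly) \<notin> ideal_of (Var ` D)" by (simp add: mem_var_ideal_iff)
  then show "ideal_of (Var ` D :: ('v, 'k) mpoly set) \<noteq> UNIV" by blast
  fix a b :: "('v, 'k) mpoly" assume ab: "a * b \<in> ideal_of (Var ` D)"
  show "a \<in> ideal_of (Var ` D) \<or> b \<in> ideal_of (Var ` D)"
  proof (rule ccontr)
    assume no: "\<not> (a \<in> ideal_of (Var ` D) \<or> b \<in> ideal_of (Var ` D))"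
    obtain w :: "('v \<Rightarrow>\<^sub>0 nat) \<Rightarrow> (nat \<Rightarrow>\<^sub>0 nat)" where w: "inj w" "\<And>s t. w (s + t) = w s + w t"
      using monomial_order[where 'v = 'v] by blast
    define free where "free t \<longleftrightarrow> (\<forall>v\<in>D. lookup t v = 0)" for t :: "'v \<Rightarrow>\<^sub>0 nat"
    have leading: "\<exists>t\<in>keys f. free t \<and> (\<forall>s\<in>keys f. free s \<longrightarrow> w s \<le> w t)"
      if "f \<notin> ideal_of (Var ` D)" for f :: "('v, 'k) mpoly"
    proof -
      let ?K = "{t \<in> keys f. free t}"
      have fin: "finite (w ` ?K)" by simp
      have "?K \<noteq> {}" using that by (auto simp: mem_var_ideal_iff free_def)
      then have "Max (w ` ?K) \<in> w ` ?K" by (intro Max_in fin) auto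
      then obtain t where "t \<in> ?K" "Max (w ` ?K) = w t" by auto
      then show ?thesis using Max_ge[OF fin] by auto
    qed
    obtain s where s: "s \<in> keys a" "free s" "\<And>x. x \<in> keys a \<Longrightarrow> free x \<Longrightarrow> w x \<le> w s"
      using leading[of a] no by blast
    obtain t where t: "t \<in> keys b" "free t" "\<And>x. x \<in> keys b \<Longrightarrow> free x \<Longrightarrow> w x \<le> w t"
      using leading[of b] no by blast
    have unique: "x = s \<and> y = t" if "x \<in> keys a" "y \<in> keys b" "x + y = s + t" for x y
    proof -
      have "free (x + y)" using s(2) t(2) that(3) by (simp add: free_def lookup_add)
      then have "free x" "free y" by (auto simp: free_def lookup_add)
      then have "w x \<le> w s" "w y \<le> w t" using s(3) t(3) that by auto
      moreover have "w x + w y = w s + w t" using that(3) w(2) by metis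
      ultimately have "w x = w s" "w y = w t"
        by (metis add_less_le_mono order_less_le less_irrefl, metis add_le_less_mono order_less_le less_irrefl)
      then show ?thesis using w(1) by (simp add: inj_eq)
    qed
    define a1 where "a1 = part (\<lambda>x. x = s) a"
    define a2 where "a2 = part (\<lambda>x. x \<noteq> s) a"
    define b1 where "b1 = part (\<lambda>x. x = t) b"
    define b2 where "b2 = part (\<lambda>x. x \<noteq> t) b"
    have a: "a = a1 + a2" and b: "b = b1 + b2"
      unfolding a1_def a2_def b1_def b2_def by (rule part_split[symmetric])+
    have a1: "a1 = single s (lookup a s)"
      and b1: "b1 = single t (lookup b t)"
      unfolding a1_def b1_def by (rule poly_mapping_eqI, simp add: lookup_part lookup_single when_def)+
    have "s + t \<notin> keys (a2 * b)"
    proof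
      assume "s + t \<in> keys (a2 * b)"
      then obtain x y where "s + t = x + y" "x \<in> keys a2" "y \<in> keys b"
        using keys_mult[of a2 b] by blast
      then show False using unique[of x y] by (auto simp: a2_def keys_part)
    qed
    moreover have "s + t \<notin> keys (a1 * b2)"
    proof
      assume "s + t \<in> keys (a1 * b2)"
      then obtain x y where "s + t = x + y" "x \<in> keys a1" "y \<in> keys b2"
        using keys_mult[of a1 b2] by blast
      then show False using unique[of x y] by (auto simp: a1_def b2_def keys_part)
    qed
    moreover have "a * b = a1 * b1 + a1 * b2 + a2 * b"
    proof -
      have "a * b = a1 * b + a2 * b" by (subst a) (rule distrib_right)
      moreover have "a1 * b = a1 * b1 + a1 * b2" by (subst b) (rule distrib_left)
      ultimately show ?thesis by simp
    qed
    ultimately have "lookup (a * b) (s + t) = lookup a s * lookup b t"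
      by (simp add: lookup_add in_keys_iff a1 b1 mult_single)
    then have "s + t \<in> keys (a * b)" using s(1) t(1) by (simp add: in_keys_iff)
    then show False using ab s(2) t(2) by (auto simp: mem_var_ideal_iff free_def lookup_add)
  qed
qed

text \<open>
  The complement of an independent set is a vertex cover, so its variables generate a prime containing
  the edge ideal; adding the variables of \<open>F\<close> one by one gives a chain of primes of length \<open>card F\<close>.
\<close>

lemma card_le_krull_dim_edge_ideal:
  assumes E: "simple_graph (E :: 'v::finite set set)" and F: "\<And>e. e \<in> E \<Longrightarrow> \<not> e \<subseteq> F"
  shows "enat (card F) \<le> krull_dim (edge_ideal E :: ('v, 'k::field) mpoly set)"
proof -
  obtain fl where fl: "set fl = F" "distinct fl" "length fl = card F"
    using finite_distinct_list[of F] distinct_card by fastforce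
  define P where "P i = ideal_of (Var ` (- F \<union> set (take i fl)) :: ('v, 'k) mpoly set)" for i
  have "(\<forall>i\<le>card F. prime_ideal (P i) \<and> edge_ideal E \<subseteq> P i) \<and> (\<forall>i<card F. P i \<subset> P (Suc i))"
  proof (intro conjI allI impI)
    fix i
    show "prime_ideal (P i)" unfolding P_def by (rule prime_ideal_var_ideal)
    show "edge_ideal E \<subseteq> P i"
    proof
      fix f :: "('v, 'k) mpoly" assume f: "f \<in> edge_ideal E"
      show "f \<in> P i" unfolding P_def mem_var_ideal_iff
      proof
        fix t assume "t \<in> keys f"
        then obtain u v where "{u, v} \<in> E" "0 < lookup t u" "0 < lookup t v"
          using f unfolding mem_edge_ideal_iff[OF E] by blast
        then show "\<exists>v\<in>- F \<union> set (take i fl). 0 < lookup t v" using F[of "{u, v}"] by auto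
      qed
    qed
  next
    fix i assume i: "i < card F"
    have "P i \<subseteq> P (Suc i)" unfolding P_def
      by (intro ideal.span_mono image_mono Un_mono order_refl set_take_subset_set_take) simp
    moreover have "Var (fl ! i) \<in> P (Suc i)"
      unfolding P_def using i fl by (intro ideal.span_base imageI) (simp add: take_Suc_conv_app_nth)
    moreover have "fl ! i \<notin> - F \<union> set (take i fl)"
      using i fl by (auto simp: in_set_conv_nth nth_eq_iff_index_eq)
    then have "Var (fl ! i) \<notin> P i"
      unfolding P_def mem_var_ideal_iff by (auto simp: Var_def lookup_single when_def)
    ultimately show "P i \<subset> P (Suc i)" by blast
  qed
  then show ?thesis unfolding krull_dim_def by (intro SUP_upper) blast
qed

section \<open>Substitution of polynomials for the variables\<close>

definition monom_value :: "('v::finite \<Rightarrow> ('v, 'k::field) mpoly) \<Rightarrow> ('v \<Rightarrow>\<^sub>0 nat) \<Rightarrow> ('v, 'k) mpoly" where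
  "monom_value s t = (\<Prod>v\<in>UNIV. s v ^ lookup t v)"

definition subst :: "('v::finite \<Rightarrow> ('v, 'k::field) mpoly) \<Rightarrow> ('v, 'k) mpoly \<Rightarrow> ('v, 'k) mpoly" where
  "subst s f = (\<Sum>t\<in>keys f. Const (lookup f t) * monom_value s t)"

lemma monom_value_add: "monom_value s (t + u) = monom_value s t * monom_value s u"
  by (simp add: monom_value_def lookup_add power_add prod.distrib)

lemma subst_superset:
  assumes "finite A" "keys f \<subseteq> A"
  shows "subst s f = (\<Sum>t\<in>A. Const (lookup f t) * monom_value s t)"
  unfolding subst_def by (rule sum.mono_neutral_left) (use assms in \<open>auto simp: in_keys_iff\<close>)

lemma subst_add: "subst s (f + g) = subst s f + subst s g"
proof -
  let ?A = "keys f \<union> keys g"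
  have "subst s (f + g) = (\<Sum>t\<in>?A. Const (lookup (f + g) t) * monom_value s t)"
    using keys_add[of f g] by (intro subst_superset) auto
  also have "\<dots> = (\<Sum>t\<in>?A. Const (lookup f t) * monom_value s t) +
      (\<Sum>t\<in>?A. Const (lookup g t) * monom_value s t)"
    by (simp add: lookup_add Const_add distrib_right sum.distrib)
  also have "\<dots> = subst s f + subst s g"
    by (simp add: subst_superset[of ?A f] subst_superset[of ?A g])
  finally show ?thesis .
qed

lemma subst_0 [simp]: "subst s 0 = 0"
  by (simp add: subst_def)

lemma subst_sum: "subst s (\<Sum>a\<in>A. f a) = (\<Sum>a\<in>A. subst s (f a))"
  by (induction A rule: infinite_finite_induct) (simp_all add: subst_add)

lemma subst_single: "subst s (single t c) = Const c * monom_value s t"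
  by (cases "c = 0") (simp_all add: subst_def)

lemma subst_mult: "subst s (f * g) = subst s f * subst s g"
proof -
  have "f * g = (\<Sum>t\<in>keys f. \<Sum>u\<in>keys g.
      single (t + u) (lookup f t * lookup g u))"
    by (subst (1) poly_eq_sum_monomials[of f], subst (1) poly_eq_sum_monomials[of g])
       (simp add: sum_product mult_single)
  then have "subst s (f * g) = (\<Sum>t\<in>keys f. \<Sum>u\<in>keys g.
      (Const (lookup f t) * monom_value s t) * (Const (lookup g u) * monom_value s u))"
    by (simp add: subst_sum subst_single monom_value_add Const_mult algebra_simps)
  then show ?thesis by (simp add: subst_def sum_product)
qed

lemma subst_Const [simp]: "subst s (Const c) = Const c"
  by (simp add: Const_def subst_single monom_value_def)

lemma subst_Var [simp]: "subst s (Var v) = s v"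
proof -
  have "monom_value s (single v 1) = (\<Prod>u\<in>UNIV. if u = v then s u else 1)"
    unfolding monom_value_def by (rule prod.cong) (auto simp: lookup_single when_def)
  then show ?thesis by (simp add: Var_def subst_single)
qed

section \<open>Unmixed Cameron--Walker graphs\<close>

definition maximal_independent :: "'v::finite set set \<Rightarrow> 'v set \<Rightarrow> bool" where
  "maximal_independent E F \<longleftrightarrow> (\<forall>e\<in>E. \<not> e \<subseteq> F) \<and> (\<forall>v. v \<notin> F \<longrightarrow> (\<exists>u\<in>F. {u, v} \<in> E))"

text \<open>
  The graphs with an edge \<open>{a, l a}\<close> at every \<open>a \<in> A\<close>, where \<open>l a\<close> is a leaf, a triangle \<open>{b, c b, d b}\<close>
  at every \<open>b \<in> B\<close>, where \<open>c b\<close> and \<open>d b\<close> have degree \<open>2\<close>, and further edges only between \<open>A\<close> and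
  \<open>B\<close>, at least one at every \<open>b\<close>. All these vertices are distinct and there are no others.
\<close>

locale whiskered_triangles =
  fixes E :: "'v::finite set set" and A B :: "'v set" and l c d :: "'v \<Rightarrow> 'v"
  assumes vertex_cases: "v \<in> A \<or> v \<in> l ` A \<or> v \<in> B \<or> v \<in> c ` B \<or> v \<in> d ` B"
    and disjoint: "A \<inter> l ` A = {}" "A \<inter> B = {}" "A \<inter> c ` B = {}" "A \<inter> d ` B = {}"
      "l ` A \<inter> B = {}" "l ` A \<inter> c ` B = {}" "l ` A \<inter> d ` B = {}"
      "B \<inter> c ` B = {}" "B \<inter> d ` B = {}" "c ` B \<inter> d ` B = {}"
    and inj: "inj_on l A" "inj_on c B" "inj_on d B"
    and whisker: "a \<in> A \<Longrightarrow> {a, l a} \<in> E"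
    and triangle: "b \<in> B \<Longrightarrow> {b, c b} \<in> E" "b \<in> B \<Longrightarrow> {b, d b} \<in> E" "b \<in> B \<Longrightarrow> {c b, d b} \<in> E"
    and edge_cases: "e \<in> E \<Longrightarrow> (\<exists>a\<in>A. e = {a, l a}) \<or>
      (\<exists>b\<in>B. e = {b, c b} \<or> e = {b, d b} \<or> e = {c b, d b}) \<or> (\<exists>a\<in>A. \<exists>b\<in>B. e = {a, b})"
    and attached: "b \<in> B \<Longrightarrow> \<exists>a\<in>A. {a, b} \<in> E"
    and nonempty: "B \<noteq> {}"

lemma connected_closed_UNIV:
  assumes "connected_graph E" "s \<in> S" "\<And>x y. x \<in> S \<Longrightarrow> {x, y} \<in> E \<Longrightarrow> y \<in> S"
  shows "S = UNIV"
proof -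
  have "t \<in> S" for t
  proof -
    have "(s, t) \<in> {(a, b). {a, b} \<in> E}\<^sup>*" using assms(1) by (simp add: connected_graph_def)
    then show ?thesis by (induction rule: rtrancl_induct) (use assms(2,3) in auto)
  qed
  then show ?thesis by blast
qed

lemma matching_card_le:
  fixes E :: "'v::finite set set"
  shows "matching E M \<Longrightarrow> card M \<le> matching_number E"
proof -
  assume "matching E M"
  moreover have "finite {card M | M. matching E M}"
    by (rule finite_subset[of _ "card ` (UNIV :: 'v set set set)"]) auto
  ultimately show ?thesis unfolding matching_number_def by (intro Max_ge) auto
qed

lemma induced_matching_attained:
  fixes E :: "'v::finite set set"
  obtains M where "induced_matching E M" "card M = induced_matching_number E"
proof -
  have "finite {card M | M. induced_matching E M}"
    by (rule finite_subset[of _ "card ` (UNIV :: 'v set set set)"]) auto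
  moreover have "induced_matching E {}" by (simp add: induced_matching_def matching_def)
  then have "{card M | M. induced_matching E M} \<noteq> {}" by blast
  ultimately have "induced_matching_number E \<in> {card M | M. induced_matching E M}"
    unfolding induced_matching_number_def by (rule Max_in)
  then show thesis using that by auto
qed

text \<open>
  Let \<open>M\<close> be an induced matching that is also a maximum matching. The graph has only the edges of \<open>M\<close> and
  edges between the set \<open>W\<close> of matched and the set \<open>U\<close> of unmatched vertices. The absence of augmenting
  paths restricts the latter edges to triangles over edges of \<open>M\<close> and edges to partners of leaves, and
  unmixedness leaves exactly one triangle at every vertex in \<open>U\<close>.
\<close>

theorem cameron_walker_unmixed_structure:
  fixes E :: "'v::finite set set"
  assumes cw: "cameron_walker E"
    and unmixed: "\<And>F F'. maximal_independent E F \<Longrightarrow> maximal_independent E F' \<Longrightarrow> card F = card F'"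
  obtains A B l c d where "whiskered_triangles E A B l c d"
proof -
  have simple: "simple_graph E" and conn: "connected_graph E" and nstar: "\<not> is_star E"
    and nstt: "\<not> is_star_triangle E" and eq: "induced_matching_number E = matching_number E"
    using cw by (simp_all add: cameron_walker_def)
  have no_loop: "x \<noteq> y" if "{x, y} \<in> E" for x y using simple that by (auto simp: simple_graph_def)
  obtain M where M: "induced_matching E M" "card M = matching_number E"
    using induced_matching_attained[of E] eq by metis
  have match: "matching E M" using M(1) by (simp add: induced_matching_def)
  have ME: "M \<subseteq> E" and disj: "\<And>e e'. e \<in> M \<Longrightarrow> e' \<in> M \<Longrightarrow> e \<noteq> e' \<Longrightarrow> e \<inter> e' = {}"
    using match by (auto simp: matching_def)
  have induced: False
    if "e \<in> M" "e' \<in> M" "e \<noteq> e'" "f \<in> E" "f \<inter> e \<noteq> {}" "f \<inter> e' \<noteq> {}" for e e' f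
    using M(1) that unfolding induced_matching_def by meson
  have max: "card M' \<le> card M" if "matching E M'" for M' using matching_card_le[OF that] M(2) by simp
  define W where "W = \<Union>M"
  define U where "U = - W"
  define N where "N x = {u \<in> U. {x, u} \<in> E}" for x
  have "\<exists>y. {x, y} \<in> M" if x: "x \<in> W" for x
  proof -
    obtain e where e: "e \<in> M" "x \<in> e" using x by (auto simp: W_def)
    then have "card e = 2" using ME simple by (auto simp: simple_graph_def)
    then obtain a b where "e = {a, b}" by (auto simp: card_2_iff)
    then show ?thesis using e by (auto simp: insert_commute)
  qed
  then obtain p where p: "\<And>x. x \<in> W \<Longrightarrow> {x, p x} \<in> M" by metis
  have pM: "y = p x" if "{x, y} \<in> M" for x y
  proof -
    have "x \<in> W" using that by (auto simp: W_def)
    then have "{x, y} = {x, p x}" using disj[OF that p] by auto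
    then show ?thesis using no_loop[of x y] that ME by (auto simp: doubleton_eq_iff)
  qed
  have pW: "p x \<in> W" "p (p x) = x" "p x \<noteq> x" "{x, p x} \<in> E" if "x \<in> W" for x
  proof -
    show "p x \<in> W" using p[OF that] by (auto simp: W_def)
    show "p (p x) = x" using pM[of "p x" x] p[OF that] by (simp add: insert_commute)
    show "{x, p x} \<in> E" using p[OF that] ME by blast
    then show "p x \<noteq> x" using no_loop[of x "p x"] by auto
  qed
  have WW: "y = p x" if "{x, y} \<in> E" "x \<in> W" "y \<in> W" for x y
  proof (rule ccontr)
    assume ne: "y \<noteq> p x"
    have "{x, p x} \<noteq> {y, p y}"
      using ne no_loop[OF that(1)] by (auto simp: doubleton_eq_iff)
    then show False using induced[OF p[OF that(2)] p[OF that(3)] _ that(1)] by auto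
  qed
  have UU: "{x, y} \<notin> E" if "x \<in> U" "y \<in> U" for x y
  proof
    assume e: "{x, y} \<in> E"
    have "matching E (insert {x, y} M)"
      using e match that unfolding matching_def U_def W_def by auto
    moreover have "{x, y} \<notin> M" using that by (auto simp: U_def W_def)
    ultimately show False using max[of "insert {x, y} M"] by simp
  qed
  \<comment> \<open>Otherwise \<open>u\<close>, \<open>x\<close>, \<open>p x\<close>, \<open>u'\<close> is an augmenting path.\<close>
  have augment: "u = u'" if x: "x \<in> W" and u: "u \<in> N x" "u' \<in> N (p x)" for x u u'
  proof (rule ccontr)
    assume ne: "u \<noteq> u'"
    let ?M = "insert {x, u} (insert {p x, u'} (M - {{x, p x}}))"
    have xe: "x \<notin> e" "p x \<notin> e" if "e \<in> M - {{x, p x}}" for e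
      using disj[of e "{x, p x}"] that p[OF x] by auto
    have ue: "u \<notin> e" "u' \<notin> e" if "e \<in> M" for e
      using u that by (auto simp: N_def U_def W_def)
    have uW: "u \<notin> W" "u' \<notin> W" using u by (auto simp: N_def U_def)
    have d0: "{x, u} \<inter> {p x, u'} = {}" using ne pW[OF x] x uW by auto
    have "matching E ?M"
      unfolding matching_def
    proof (intro conjI ballI impI)
      show "?M \<subseteq> E" using u ME by (auto simp: N_def)
      fix e e' assume "e \<in> ?M" "e' \<in> ?M" "e \<noteq> e'"
      then show "e \<inter> e' = {}" using d0 xe ue disj[of e e'] by auto
    qed
    moreover have "card ?M = card M + 1"
    proof -
      have "{x, u} \<notin> M" "{p x, u'} \<notin> M" using ue by blast+
      moreover have "{x, u} \<noteq> {p x, u'}" using d0 by blast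
      moreover have "card (M - {{x, p x}}) = card M - 1" "card M > 0"
        using p[OF x] by (auto simp: card_gt_0_iff)
      ultimately show ?thesis by simp
    qed
    ultimately show False using max[of ?M] by simp
  qed
  \<comment> \<open>Otherwise \<open>{x, p x}\<close> is a connected component, and the graph is a star with one edge.\<close>
  have nbr_exists: "N x \<noteq> {} \<or> N (p x) \<noteq> {}" if x: "x \<in> W" for x
  proof (rule ccontr)
    assume "\<not> ?thesis"
    then have none: "N x = {}" "N (p x) = {}" by auto
    have "{x, p x} = UNIV"
    proof (rule connected_closed_UNIV[OF conn, of x])
      fix y z assume y: "y \<in> {x, p x}" and e: "{y, z} \<in> E"
      show "z \<in> {x, p x}"
      proof (cases "z \<in> W")
        case True
        then have "z = p y" using WW[OF e] y x pW by auto
        then show ?thesis using y pW[OF x] by auto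
      next
        case False
        then show ?thesis using none y e by (auto simp: N_def U_def)
      qed
    qed simp
    then have V: "y = x \<or> y = p x" for y by auto
    have "E = {{x, v} | v. v \<noteq> x}"
    proof (intro equalityI subsetI)
      fix e assume "e \<in> E"
      then obtain a b where ab: "e = {a, b}" "a \<noteq> b"
        using simple by (auto simp: simple_graph_def card_2_iff)
      have "a = x \<or> b = x" using V[of a] V[of b] ab(2) by metis
      then have "e = {x, b} \<and> b \<noteq> x \<or> e = {x, a} \<and> a \<noteq> x" using ab by blast
      then show "e \<in> {{x, v} | v. v \<noteq> x}" by blast
    next
      fix e assume "e \<in> {{x, v} | v. v \<noteq> x}"
      then show "e \<in> E" using V pW(4)[OF x] by auto
    qed
    then show False using nstar unfolding is_star_def by blast
  qed
  \<comment> \<open>Otherwise the graph is a single vertex, which is a star.\<close>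
  have U_nbr: "\<exists>x\<in>W. {x, u} \<in> E" if u: "u \<in> U" for u
  proof (rule ccontr)
    assume none: "\<not> ?thesis"
    have iso: "{u, y} \<notin> E" for y
      using none UU[OF u, of y] by (auto simp: U_def insert_commute)
    have "{u} = UNIV" by (rule connected_closed_UNIV[OF conn, of u]) (use iso in auto)
    then have all: "y = u" for y by auto
    have "E = {}"
    proof (rule ccontr)
      assume "E \<noteq> {}"
      then obtain e where "e \<in> E" by blast
      then obtain a b where "e = {a, b}" "a \<noteq> b" using simple by (auto simp: simple_graph_def card_2_iff)
      then show False using all[of a] all[of b] by simp
    qed
    moreover have "{{u, v} | v. v \<noteq> u} = {}" using all by auto
    ultimately have "E = {{u, v} | v. v \<noteq> u}" by simp
    then show False using nstar unfolding is_star_def by blast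
  qed
  \<comment> \<open>The matched vertices are divided into the leaves \<open>L\<close>, their partners \<open>A\<close>, and the ends \<open>D\<close> of edges of \<open>M\<close> that span a triangle with an apex in \<open>P\<close>; \<open>H\<close> selects one end of each of these edges.\<close>
  define A where "A = {x \<in> W. N x \<noteq> {} \<and> N (p x) = {}}"
  define L where "L = {x \<in> W. N x = {}}"
  define D where "D = {x \<in> W. N x \<noteq> {} \<and> N (p x) \<noteq> {}}"
  define H where "H = {x \<in> D. (SOME z. z \<in> {x, p x}) = x}"
  define P where "P = {u \<in> U. \<exists>x\<in>D. {x, u} \<in> E}"
  have W_cases: "x \<in> A \<or> x \<in> L \<or> x \<in> D" if "x \<in> W" for x
    using that by (auto simp: A_def L_def D_def)
  have sub: "A \<subseteq> W" "L \<subseteq> W" "D \<subseteq> W" "H \<subseteq> D" by (auto simp: A_def L_def D_def H_def)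
  have ALD: "A \<inter> L = {}" "A \<inter> D = {}" "L \<inter> D = {}" by (auto simp: A_def L_def D_def)
  have pA: "p x \<in> L" if "x \<in> A" for x using that pW by (auto simp: A_def L_def)
  have pL: "p x \<in> A" if "x \<in> L" for x using that pW nbr_exists by (auto simp: A_def L_def)
  have pD: "p x \<in> D" if "x \<in> D" for x using that pW by (auto simp: D_def)
  have H_one: "(x \<in> H) \<noteq> (p x \<in> H)" if "x \<in> D" for x
  proof -
    have x: "x \<in> W" using that by (simp add: D_def)
    have pp: "{p x, p (p x)} = {x, p x}" using pW[OF x] by auto
    define z where "z = (SOME z. z \<in> {x, p x})"
    have "z \<in> {x, p x}" unfolding z_def by (rule someI[of _ x]) simp
    moreover have "x \<in> H \<longleftrightarrow> z = x" using that by (simp only: H_def z_def) blast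
    moreover have "p x \<in> H \<longleftrightarrow> z = p x" using pD[OF that] by (simp only: H_def z_def pp mem_Collect_eq simp_thms)
    ultimately show ?thesis using pW(3)[OF x] by auto
  qed
  have D_apex: "\<exists>u. N x = {u} \<and> N (p x) = {u}" if "x \<in> D" for x
  proof -
    have x: "x \<in> W" and ne: "N x \<noteq> {}" "N (p x) \<noteq> {}" using that by (auto simp: D_def)
    then show ?thesis using augment[OF x] by blast
  qed
  then obtain apex where apex: "\<And>x. x \<in> D \<Longrightarrow> N x = {apex x} \<and> N (p x) = {apex x}" by metis
  have Uedge: "x \<in> A \<or> x \<in> D" if "{x, u} \<in> E" "u \<in> U" for x u
  proof -
    have "x \<in> W" using UU[of x u] that by (auto simp: U_def)
    moreover have "u \<in> N x" using that by (simp add: N_def)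
    ultimately show ?thesis by (auto simp: A_def D_def)
  qed
  have edge_split: "(\<exists>x\<in>W. e = {x, p x}) \<or> (\<exists>x u. e = {x, u} \<and> u \<in> U \<and> (x \<in> A \<or> x \<in> D))"
    if e: "e \<in> E" for e
  proof -
    obtain a b where ab: "e = {a, b}" using simple e by (auto simp: simple_graph_def card_2_iff)
    consider "a \<in> W" "b \<in> W" | "a \<in> U" | "b \<in> U" by (auto simp: U_def)
    then show ?thesis
    proof cases
      case 1
      then show ?thesis using WW[of a b] e ab by auto
    next
      case 2
      then show ?thesis using Uedge[of b a] e ab by (auto simp: insert_commute)
    next
      case 3
      then show ?thesis using Uedge[of a b] e ab by blast
    qed
  qed
  have edge_cases: thesis'
    if "e \<in> E" "\<And>x. x \<in> A \<Longrightarrow> e = {x, p x} \<Longrightarrow> thesis'" "\<And>x. x \<in> H \<Longrightarrow> e = {x, p x} \<Longrightarrow> thesis'"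
      "\<And>x u. x \<in> A \<Longrightarrow> u \<in> U \<Longrightarrow> e = {x, u} \<Longrightarrow> thesis'"
      "\<And>x. x \<in> D \<Longrightarrow> apex x \<in> U \<Longrightarrow> e = {x, apex x} \<Longrightarrow> thesis'" for e thesis'
    using edge_split[OF that(1)]
  proof
    assume "\<exists>x\<in>W. e = {x, p x}"
    then obtain x where x: "x \<in> W" "e = {x, p x}" by blast
    have e': "e = {p x, p (p x)}" using x pW by auto
    consider "x \<in> A" | "x \<in> L" | "x \<in> D" using W_cases[OF x(1)] by blast
    then show thesis'
    proof cases
      case 1
      then show ?thesis using that(2) x by blast
    next
      case 2
      then show ?thesis using that(2)[OF pL e'] by blast
    next
      case 3
      then show ?thesis using that(3)[of x] that(3)[of "p x"] H_one[OF 3] x e' by blast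
    qed
  next
    assume "\<exists>x u. e = {x, u} \<and> u \<in> U \<and> (x \<in> A \<or> x \<in> D)"
    then obtain x u where xu: "e = {x, u}" "u \<in> U" "x \<in> A \<or> x \<in> D" by blast
    show thesis'
    proof (cases "x \<in> A")
      case True
      then show ?thesis using that(4) xu by blast
    next
      case False
      then have x: "x \<in> D" using xu by blast
      moreover have "u \<in> N x" using xu that(1) by (simp add: N_def)
      ultimately have "u = apex x" using apex by auto
      then show ?thesis using that(5)[OF x] xu by blast
    qed
  qed
  have HW: "H \<subseteq> W" using sub by blast
  have UW: "U \<inter> W = {}" by (auto simp: U_def)
  have pH: "p x \<notin> H" if "x \<in> H" for x using H_one[of x] that sub by blast
  have apexU: "apex x \<in> U" "{x, apex x} \<in> E" "{p x, apex x} \<in> E" if "x \<in> D" for x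
  proof -
    have "apex x \<in> N x" "apex x \<in> N (p x)" using apex[OF that] by blast+
    then show "apex x \<in> U" "{x, apex x} \<in> E" "{p x, apex x} \<in> E" by (auto simp: N_def)
  qed
  have apexP: "apex x \<in> P" if "x \<in> D" for x using apexU[OF that] that by (auto simp: P_def)
  have P_apex: "\<exists>x\<in>H. u = apex x" if u: "u \<in> P" for u
  proof -
    obtain x where x: "x \<in> D" "{x, u} \<in> E" "u \<in> U" using u by (auto simp: P_def)
    then have "u \<in> N x" by (simp add: N_def)
    then have u: "u = apex x" using apex[OF x(1)] by simp
    have "apex (p x) = apex x"
      using apex[OF x(1)] apex[OF pD[OF x(1)]] by auto
    then show ?thesis using H_one[OF x(1)] u by metis
  qed
  have rA: "x \<notin> U" "x \<notin> L" "x \<notin> D" "x \<notin> H" if "x \<in> A" for x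
    using that ALD UW sub by blast+
  have rL: "x \<notin> U" "x \<notin> A" "x \<notin> D" "x \<notin> H" if "x \<in> L" for x
    using that ALD UW sub by blast+
  have rD: "x \<notin> U" "x \<notin> A" "x \<notin> L" if "x \<in> D" for x
    using that ALD UW sub by blast+
  have HD: "x \<in> D" if "x \<in> H" for x using that sub by blast
  \<comment> \<open>The sizes of the following three maximal independent sets are compared. The last two force \<open>U = P\<close>, and then the first two force \<open>card U = card H\<close>, so that apexes and triangles correspond bijectively.\<close>
  have F1: "maximal_independent E (U \<union> L)"
    unfolding maximal_independent_def
  proof (intro conjI ballI allI impI notI)
    fix e assume e: "e \<in> E" "e \<subseteq> U \<union> L"
    show False
    proof (rule edge_cases[OF e(1)])
      fix x assume "x \<in> A" "e = {x, p x}"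
      then show False using e(2) rA(1,2)[of x] by simp
    next
      fix x assume "x \<in> H" "e = {x, p x}"
      then show False using e(2) rD(1,3)[OF HD, of x] by simp
    next
      fix x u assume "x \<in> A" "e = {x, u}"
      then show False using e(2) rA(1,2)[of x] by simp
    next
      fix x assume "x \<in> D" "e = {x, apex x}"
      then show False using e(2) rD(1,3)[of x] by simp
    qed
  next
    fix v assume v: "v \<notin> U \<union> L"
    then have "v \<in> W" "N v \<noteq> {}" by (auto simp: U_def L_def)
    then show "\<exists>u\<in>U \<union> L. {u, v} \<in> E" by (auto simp: N_def insert_commute)
  qed
  \<comment> \<open>All apexes are replaced by one end of each triangle edge.\<close>
  have F2: "maximal_independent E ((U - P) \<union> L \<union> H)"
    unfolding maximal_independent_def
  proof (intro conjI ballI allI impI notI)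
    fix e assume e: "e \<in> E" "e \<subseteq> (U - P) \<union> L \<union> H"
    show False
    proof (rule edge_cases[OF e(1)])
      fix x assume "x \<in> H" "e = {x, p x}"
      then show False using e(2) pH[of x] rD[OF pD[OF HD]] by simp
    next
      fix x assume x: "x \<in> D" "e = {x, apex x}"
      then show False using e(2) apexP[OF x(1)] rL(1)[of "apex x"] rD(1)[OF HD, of "apex x"] apexU(1)[OF x(1)] by auto
    next
      fix x assume "x \<in> A" "e = {x, p x}"
      then show False using e(2) rA(1,2,4)[of x] by simp
    next
      fix x u assume "x \<in> A" "e = {x, u}"
      then show False using e(2) rA(1,2,4)[of x] by simp
    qed
  next
    fix v assume v: "v \<notin> (U - P) \<union> L \<union> H"
    show "\<exists>u\<in>(U - P) \<union> L \<union> H. {u, v} \<in> E"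
    proof (cases "v \<in> U")
      case True
      then obtain x where "x \<in> H" "v = apex x" using v P_apex by blast
      then show ?thesis using apexU(2)[of x] sub by blast
    next
      case False
      then have vW: "v \<in> W" by (simp add: U_def)
      then have "{p v, v} \<in> E" using pW(4) by (simp add: insert_commute)
      moreover have "p v \<in> L \<or> p v \<in> H" using W_cases[OF vW] v pA H_one by blast
      ultimately show ?thesis by blast
    qed
  qed
  \<comment> \<open>The leaves are replaced by their partners, which dominate the vertices in \<open>U - P\<close>.\<close>
  have F3: "maximal_independent E (A \<union> H)"
    unfolding maximal_independent_def
  proof (intro conjI ballI allI impI notI)
    fix e assume e: "e \<in> E" "e \<subseteq> A \<union> H"
    show False
    proof (rule edge_cases[OF e(1)])
      fix x assume "x \<in> H" "e = {x, p x}"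
      then show False using e(2) pH[of x] rD(2)[OF pD[OF HD]] by simp
    next
      fix x assume "x \<in> A" "e = {x, p x}"
      then show False using e(2) rL[OF pA] by simp
    next
      fix x u assume "u \<in> U" "e = {x, u}"
      then show False using e(2) rA(1)[of u] rD(1)[OF HD, of u] by auto
    next
      fix x assume "apex x \<in> U" "e = {x, apex x}"
      then show False using e(2) rA(1)[of "apex x"] rD(1)[OF HD, of "apex x"] by auto
    qed
  next
    fix v assume v: "v \<notin> A \<union> H"
    show "\<exists>u\<in>A \<union> H. {u, v} \<in> E"
    proof (cases "v \<in> U")
      case True
      then obtain x where x: "x \<in> W" "{x, v} \<in> E" using U_nbr by blast
      show ?thesis
      proof (cases "v \<in> P")
        case True
        then obtain x where "x \<in> H" "v = apex x" using P_apex by blast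
        then show ?thesis using apexU(2)[of x] sub by blast
      next
        case False
        then show ?thesis using Uedge[OF x(2) True] x \<open>v \<in> U\<close> by (auto simp: P_def)
      qed
    next
      case False
      then have vW: "v \<in> W" by (simp add: U_def)
      then have "{p v, v} \<in> E" using pW(4) by (simp add: insert_commute)
      moreover have "p v \<in> A \<or> p v \<in> H" using W_cases[OF vW] v pL H_one by blast
      ultimately show ?thesis by blast
    qed
  qed
  have inj_p: "inj_on p W" by (rule inj_onI) (metis pW(2))
  have "L = p ` A"
  proof (intro equalityI subsetI)
    fix x assume "x \<in> L"
    then show "x \<in> p ` A" using pL[of x] pW(2)[of x] sub by (metis imageI subsetD)
  qed (use pA in blast)
  then have cardL: "card L = card A" using card_image[OF inj_on_subset[OF inj_p sub(1)]] by simp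
  have "card ((U - P) \<union> L \<union> H) = card (A \<union> H)" by (rule unmixed[OF F2 F3])
  moreover have "card ((U - P) \<union> L \<union> H) = card (U - P) + card L + card H"
  proof -
    have "(U - P) \<inter> L = {}" "((U - P) \<union> L) \<inter> H = {}" using ALD UW sub by blast+
    then show ?thesis by (simp add: card_Un_disjoint)
  qed
  moreover have "card (A \<union> H) = card A + card H"
    using ALD sub by (intro card_Un_disjoint) auto
  ultimately have "card (U - P) = 0" using cardL by simp
  then have UP: "U = P" by (auto simp: P_def)
  have "card (U \<union> L) = card ((U - P) \<union> L \<union> H)" by (rule unmixed[OF F1 F2])
  moreover have "card (U \<union> L) = card U + card L" using UW sub by (intro card_Un_disjoint) auto
  moreover have "card (L \<union> H) = card L + card H" using ALD sub by (intro card_Un_disjoint) auto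
  ultimately have cardU: "card U = card H" using UP by simp
  have apexH: "apex ` H = U"
  proof (intro equalityI subsetI)
    fix u assume "u \<in> apex ` H"
    then obtain x where "x \<in> H" "u = apex x" by blast
    then show "u \<in> U" using apexU(1)[OF HD] by simp
  next
    fix u assume "u \<in> U"
    then show "u \<in> apex ` H" using P_apex[of u] UP by auto
  qed
  then have inj_apex: "inj_on apex H" using cardU by (intro eq_card_imp_inj_on) auto
  define c where "c = the_inv_into H apex"
  have c: "c u \<in> H" "apex (c u) = u" if u: "u \<in> U" for u
  proof -
    obtain x where x: "x \<in> H" "u = apex x" using u apexH by blast
    have "c u = x" unfolding c_def x(2) by (rule the_inv_into_f_f[OF inj_apex x(1)])
    then show "c u \<in> H" "apex (c u) = u" using x by simp_all
  qed
  have c_apex: "c (apex x) = x" if "x \<in> H" for x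
    unfolding c_def using the_inv_into_f_f[OF inj_apex that] .
  have cU: "c ` U = H"
  proof (intro equalityI subsetI)
    fix x assume "x \<in> H"
    then have "c (apex x) = x" "apex x \<in> U" using c_apex apexH by auto
    then show "x \<in> c ` U" by (metis imageI)
  qed (use c(1) in blast)
  define d where "d u = p (c u)" for u
  have dD: "d u \<in> D - H" if "u \<in> U" for u
    using pH[OF c(1)[OF that]] pD[OF HD[OF c(1)[OF that]]] unfolding d_def by simp
  have D_cases: "x \<in> H \<or> x \<in> d ` U" if x: "x \<in> D" for x
  proof (cases "x \<in> H")
    case False
    then have h: "p x \<in> H" using H_one[OF x] by blast
    then have "d (apex (p x)) = p (p x)" unfolding d_def using c_apex by simp
    moreover have "apex (p x) \<in> U" using h apexH by blast
    ultimately show ?thesis using pW(2) x sub by (metis imageI subsetD)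
  qed blast
  have dsub: "d ` U \<subseteq> D" "d ` U \<inter> H = {}" using dD by blast+
  have "whiskered_triangles E A U p c d"
  proof
    show "v \<in> A \<or> v \<in> p ` A \<or> v \<in> U \<or> v \<in> c ` U \<or> v \<in> d ` U" for v
      using W_cases[of v] D_cases[of v] \<open>L = p ` A\<close> cU by (auto simp: U_def)
    show "A \<inter> p ` A = {}" "p ` A \<inter> U = {}" "p ` A \<inter> c ` U = {}" "p ` A \<inter> d ` U = {}"
      unfolding \<open>L = p ` A\<close>[symmetric] cU using ALD sub UW dsub by blast+
    show "A \<inter> U = {}" "A \<inter> c ` U = {}" "A \<inter> d ` U = {}"
      unfolding cU using ALD sub UW dsub by blast+
    show "U \<inter> c ` U = {}" "U \<inter> d ` U = {}" "c ` U \<inter> d ` U = {}"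
      unfolding cU using ALD sub UW dsub by blast+
    show "inj_on p A" by (rule inj_on_subset[OF inj_p sub(1)])
    show inj_c: "inj_on c U" by (rule inj_onI) (metis c(2))
    show "inj_on d U"
    proof (rule inj_onI)
      fix u u' assume u: "u \<in> U" "u' \<in> U" "d u = d u'"
      then have "c u = c u'" using inj_onD[OF inj_p, of "c u" "c u'"] c(1) HW unfolding d_def by blast
      then show "u = u'" using inj_c u by (auto dest: inj_onD)
    qed
    show "{a, p a} \<in> E" if "a \<in> A" for a using that pW(4) sub by blast
    show "{b, c b} \<in> E" if "b \<in> U" for b
      using apexU(2)[of "c b"] c[OF that] sub by (auto simp: insert_commute)
    show "{b, d b} \<in> E" if "b \<in> U" for b
      using apexU(3)[of "c b"] c[OF that] sub by (auto simp: insert_commute d_def)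
    show "{c b, d b} \<in> E" if "b \<in> U" for b
      using pW(4)[of "c b"] c[OF that] HW by (auto simp: d_def)
    show "(\<exists>a\<in>A. e = {a, p a}) \<or> (\<exists>b\<in>U. e = {b, c b} \<or> e = {b, d b} \<or> e = {c b, d b}) \<or>
        (\<exists>a\<in>A. \<exists>b\<in>U. e = {a, b})" if "e \<in> E" for e
      using that
    proof (rule edge_cases)
      fix x assume x: "x \<in> H" "e = {x, p x}"
      then have "e = {c (apex x), d (apex x)}" "apex x \<in> U" using c_apex apexH by (auto simp: d_def)
      then show ?thesis by blast
    next
      fix x assume x: "x \<in> D" "apex x \<in> U" "e = {x, apex x}"
      show ?thesis
      proof (cases "x \<in> H")
        case True
        then have "e = {apex x, c (apex x)}" using x c_apex by auto
        then show ?thesis using x by blast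
      next
        case False
        then have h: "p x \<in> H" using H_one[OF x(1)] by blast
        have "apex (p x) = apex x" using apex[OF x(1)] apex[OF pD[OF x(1)]] by auto
        then have "d (apex x) = p (p x)" unfolding d_def using c_apex[OF h] by simp
        then have "e = {apex x, d (apex x)}" using x pW(2) sub by auto
        then show ?thesis using x by blast
      qed
    qed blast+
    \<comment> \<open>Otherwise the triangle at \<open>b\<close> is a connected component, and the graph is a star triangle.\<close>
    show "\<exists>a\<in>A. {a, b} \<in> E" if b: "b \<in> U" for b
    proof (rule ccontr)
      assume none: "\<not> ?thesis"
      have cH: "c b \<in> H" and cD: "c b \<in> D" and cW: "c b \<in> W" using c[OF b] sub HW by blast+
      have db: "d b \<in> D" using dD[OF b] by blast
      have apd: "apex (d b) = b"
        using apex[OF cD] apex[OF pD[OF cD]] c(2)[OF b] unfolding d_def by auto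
      have "{b, c b, d b} = UNIV"
      proof (rule connected_closed_UNIV[OF conn, of b])
        fix x y assume x: "x \<in> {b, c b, d b}" and e: "{x, y} \<in> E"
        have nb: "y = c b \<or> y = d b" if "{y, b} \<in> E" for y
        proof -
          have "y \<in> D" using Uedge[OF that b] none that by blast
          moreover have "b \<in> N y" using that b by (simp add: N_def)
          ultimately have "apex y = b" using apex by auto
          then show ?thesis
            using D_cases[OF \<open>y \<in> D\<close>] c_apex[of y] 
          proof (elim disjE)
            assume "y \<in> d ` U"
            then obtain u where u: "u \<in> U" "y = d u" by blast
            have "c u \<in> D" using c(1)[OF u(1)] sub by blast
            then have "apex (d u) = u"
              using apex[of "c u"] apex[OF pD, of "c u"] c(2)[OF u(1)] unfolding d_def by auto
            then show ?thesis using u \<open>apex y = b\<close> by simp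
          qed auto
        qed
        have cd: "y \<in> {b, c b, d b}" if "x \<in> D" "{x, y} \<in> E" "apex x = b" "p x \<in> {c b, d b}" for x
        proof (cases "y \<in> W")
          case True
          then show ?thesis using WW[OF that(2)] that sub by auto
        next
          case False
          then have "y \<in> N x" using that(2) by (simp add: N_def U_def)
          then show ?thesis using apex[OF that(1)] that(3) by simp
        qed
        have pdb: "p (d b) = c b" unfolding d_def using pW(2)[OF cW] .
        consider "x = b" | "x = c b" | "x = d b" using x by blast
        then show "y \<in> {b, c b, d b}"
        proof cases
          case 1
          then show ?thesis using nb[of y] e by (auto simp: insert_commute)
        next
          case 2
          then show ?thesis using cd[of x] e cD c(2)[OF b] by (simp add: d_def)
        next
          case 3
          then show ?thesis using cd[of x] e db apd pdb by simp
        qed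
      qed simp
      then have V: "v = b \<or> v = c b \<or> v = d b" for v by (metis UNIV_I insert_iff singletonD)
      have bc: "{b, c b} \<in> E" "{b, d b} \<in> E" "{c b, d b} \<in> E"
        using apexU[OF cD] c(2)[OF b] pW(4)[OF cW] by (auto simp: d_def insert_commute)
      then have ne: "b \<noteq> c b" "b \<noteq> d b" "c b \<noteq> d b" using no_loop by blast+
      have "E = {{c b, d b}} \<union> {{b, v} | v. v \<noteq> b}"
      proof (intro equalityI subsetI)
        fix e assume "e \<in> E"
        then obtain x y where xy: "e = {x, y}" "x \<noteq> y" using simple by (auto simp: simple_graph_def card_2_iff)
        show "e \<in> {{c b, d b}} \<union> {{b, v} | v. v \<noteq> b}"
        proof (cases "x = b \<or> y = b")
          case True
          then have "e = {b, y} \<and> y \<noteq> b \<or> e = {b, x} \<and> x \<noteq> b" using xy by blast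
          then show ?thesis by blast
        next
          case False
          then have "x = c b \<and> y = d b \<or> x = d b \<and> y = c b" using xy(2) V[of x] V[of y] by metis
          then show ?thesis using xy(1) by blast
        qed
      next
        fix e assume "e \<in> {{c b, d b}} \<union> {{b, v} | v. v \<noteq> b}"
        then show "e \<in> E" using V bc by auto
      qed
      moreover have "\<Union>{{c b, d b}} = UNIV - {b}" using V ne by auto
      moreover have "card {c b, d b} = 2" using ne by simp
      ultimately have "is_star_triangle E"
        unfolding is_star_triangle_def by (intro exI[of _ b] exI[of _ "{{c b, d b}}"]) simp
      then show False using nstt by simp
    qed
    show "U \<noteq> {}"
    proof
      assume "U = {}"
      then have "N x = {}" for x by (simp add: N_def)
      then have "W = {}" using nbr_exists by blast
      then show False using \<open>U = {}\<close> by (simp add: U_def)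
    qed
  qed
  then show thesis by (rule that)
qed

context whiskered_triangles
begin

lemma roles_distinct:
  "a \<in> A \<Longrightarrow> a' \<in> A \<Longrightarrow> l a' \<noteq> a" "a \<in> A \<Longrightarrow> b \<in> B \<Longrightarrow> a \<noteq> b"
  "a \<in> A \<Longrightarrow> b \<in> B \<Longrightarrow> c b \<noteq> a" "a \<in> A \<Longrightarrow> b \<in> B \<Longrightarrow> d b \<noteq> a"
  "a \<in> A \<Longrightarrow> b \<in> B \<Longrightarrow> l a \<noteq> b" "a \<in> A \<Longrightarrow> b \<in> B \<Longrightarrow> l a \<noteq> c b" "a \<in> A \<Longrightarrow> b \<in> B \<Longrightarrow> l a \<noteq> d b"
  "b \<in> B \<Longrightarrow> b' \<in> B \<Longrightarrow> c b' \<noteq> b" "b \<in> B \<Longrightarrow> b' \<in> B \<Longrightarrow> d b' \<noteq> b" "b \<in> B \<Longrightarrow> b' \<in> B \<Longrightarrow> c b \<noteq> d b'"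
  by (use disjoint(1) in blast, use disjoint(2) in blast, use disjoint(3) in blast,
      use disjoint(4) in blast, use disjoint(5) in blast, use disjoint(6) in blast,
      use disjoint(7) in blast, use disjoint(8) in blast, use disjoint(9) in blast,
      use disjoint(10) in blast)

lemma maximal_independent_leaves: "maximal_independent E (l ` A \<union> c ` B)"
  unfolding maximal_independent_def
proof (intro conjI ballI allI impI notI)
  fix e assume e: "e \<in> E" "e \<subseteq> l ` A \<union> c ` B"
  have "a \<notin> l ` A \<union> c ` B" if "a \<in> A" for a using that disjoint(1,3) by blast
  moreover have "b \<notin> l ` A \<union> c ` B" "d b \<notin> l ` A \<union> c ` B" if "b \<in> B" for b
    using that disjoint(5,7,8,10) by blast+
  ultimately show False using edge_cases[OF e(1)] e(2) by blast
next
  fix v assume v: "v \<notin> l ` A \<union> c ` B"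
  consider "v \<in> A" | "v \<in> B" | b where "b \<in> B" "v = d b" using vertex_cases[of v] v by blast
  then show "\<exists>u\<in>l ` A \<union> c ` B. {u, v} \<in> E"
  proof cases
    case 1
    then show ?thesis using whisker[of v] by (intro bexI[of _ "l v"]) (simp_all add: insert_commute)
  next
    case 2
    then show ?thesis using triangle(1)[of v] by (intro bexI[of _ "c v"]) (simp_all add: insert_commute)
  next
    case 3
    then show ?thesis using triangle(3)[of b] by (intro bexI[of _ "c b"]) simp_all
  qed
qed

lemma card_leaves: "card (l ` A \<union> c ` B) = card A + card B"
  using disjoint inj by (simp add: card_Un_disjoint card_image)

lemma edge_iff:
  "b \<in> B \<Longrightarrow> {c b, v} \<in> E \<longleftrightarrow> v = b \<or> v = d b"
  "b \<in> B \<Longrightarrow> {d b, v} \<in> E \<longleftrightarrow> v = b \<or> v = c b"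
  "a \<in> A \<Longrightarrow> {l a, v} \<in> E \<longleftrightarrow> v = a"
proof -
  show "{c b, v} \<in> E \<longleftrightarrow> v = b \<or> v = d b" if b: "b \<in> B"
  proof
    assume "{c b, v} \<in> E"
    from edge_cases[OF this] b show "v = b \<or> v = d b"
      by (elim disjE bexE) (auto simp: doubleton_eq_iff roles_distinct roles_distinct[symmetric] inj_on_eq_iff[OF inj(2)])
  qed (use triangle[OF b] in \<open>auto simp: insert_commute\<close>)
  show "{d b, v} \<in> E \<longleftrightarrow> v = b \<or> v = c b" if b: "b \<in> B"
  proof
    assume "{d b, v} \<in> E"
    from edge_cases[OF this] b show "v = b \<or> v = c b"
      by (elim disjE bexE)
        (auto simp: doubleton_eq_iff roles_distinct roles_distinct[symmetric] inj_on_eq_iff[OF inj(3)])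
  qed (use triangle[OF b] in \<open>auto simp: insert_commute\<close>)
  show "{l a, v} \<in> E \<longleftrightarrow> v = a" if a: "a \<in> A"
  proof
    assume "{l a, v} \<in> E"
    from edge_cases[OF this] a show "v = a"
      by (elim disjE bexE) (auto simp: doubleton_eq_iff roles_distinct roles_distinct[symmetric] inj_on_eq_iff[OF inj(1)])
  qed (use whisker[OF a] in \<open>auto simp: insert_commute\<close>)
qed

end

section \<open>Cohen--Macaulay edge ideals are unmixed\<close>

definition set_monomial :: "'v::finite set \<Rightarrow> ('v \<Rightarrow>\<^sub>0 nat)" where
  "set_monomial S = (\<Sum>v\<in>S. single v 1)"

lemma lookup_set_monomial: "lookup (set_monomial S) v = (if v \<in> S then 1 else 0)"
  by (simp add: set_monomial_def lookup_sum lookup_single when_def)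

lemma lookup_Var_mult:
  "lookup (Var v * f) (single v 1 + t) = lookup f t"
proof -
  have "Var v * f = (\<Sum>u\<in>keys f. single (single v 1 + u) (lookup f u))"
    by (subst (1) poly_eq_sum_monomials[of f]) (simp add: sum_distrib_left Var_def mult_single)
  then show ?thesis by (simp add: lookup_sum lookup_single when_def in_keys_iff)
qed

lemma single_eq_monom_value: "single t c = Const c * monom_value Var t"
proof -
  have prod: "(\<Prod>v\<in>A. single (g v) (1::'k::field)) = single (\<Sum>v\<in>A. g v) 1"
    if "finite A" for A :: "'v set" and g :: "'v \<Rightarrow> ('v \<Rightarrow>\<^sub>0 nat)"
    using that by (induction A rule: finite_induct) (simp_all add: mult_single)
  have "(\<Sum>v\<in>UNIV. single v (lookup t v)) = t"
    by (rule poly_mapping_eqI) (simp add: lookup_sum lookup_single when_def)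
  then show ?thesis by (simp add: monom_value_def Var_power prod Const_mult_single)
qed

text \<open>
  Polynomials are generated by constants and variables; this principle serves to compare ring
  homomorphisms.
\<close>

lemma mpoly_induct [case_names Const Var add mult]:
  fixes f :: "('v::finite, 'k::field) mpoly"
  assumes "\<And>c. P (Const c)" "\<And>v. P (Var v)" "\<And>f g. P f \<Longrightarrow> P g \<Longrightarrow> P (f + g)" "\<And>f g. P f \<Longrightarrow> P g \<Longrightarrow> P (f * g)"
  shows "P f"
proof -
  have one: "P 1" and zero: "P 0" using assms(1)[of 1] assms(1)[of 0] by simp_all
  have pow: "P (Var v ^ n)" for v n by (induction n) (simp_all add: one assms)
  have prod: "P (\<Prod>v\<in>A. Var v ^ g v)" for A g
    by (induction A rule: infinite_finite_induct) (simp_all add: one pow assms(4))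
  have "P (\<Sum>t\<in>A. single t (g t))" for A g
    by (induction A rule: infinite_finite_induct)
       (simp_all add: zero single_eq_monom_value monom_value_def prod assms)
  then show ?thesis by (subst poly_eq_sum_monomials)
qed

lemma SUP_enat_attained:
  assumes "(SUP x\<in>S. enat (g x)) = enat n" "S \<noteq> {}"
  shows "\<exists>x\<in>S. g x = n"
proof (rule ccontr)
  assume no: "\<not> ?thesis"
  have le: "g x \<le> n" if "x \<in> S" for x
    using SUP_upper[OF that, of "\<lambda>x. enat (g x)"] assms(1) by simp
  obtain x where "x \<in> S" using assms(2) by blast
  then have "n > 0" using le[of x] no by (cases "n = 0") auto
  have "(SUP x\<in>S. enat (g x)) \<le> enat (n - 1)"
  proof (rule SUP_least)
    fix x assume "x \<in> S"
    then have "g x \<le> n" "g x \<noteq> n" using le no by auto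
    then show "enat (g x) \<le> enat (n - 1)" by simp
  qed
  then show False using assms(1) \<open>n > 0\<close> by simp
qed

text \<open>
  The lower bound \<open>card F\<close> on the Krull dimension and the upper bound \<open>card F\<close> on the depth coincide. The
  latter comes from the squarefree monomial of \<open>F\<close>, which lies outside the edge ideal and is
  multiplied into it by every variable outside \<open>F\<close>, since such a vertex has a neighbour in \<open>F\<close>.
\<close>

lemma cohen_macaulay_unmixed:
  fixes E :: "'v::finite set set"
  assumes simple: "simple_graph E" and cm: "cohen_macaulay (edge_ideal E :: ('v, 'k::field) mpoly set)"
    and F: "maximal_independent E F"
  shows "krull_dim (edge_ideal E :: ('v, 'k) mpoly set) = enat (card F)"
    and "\<exists>ys :: ('v, 'k) mpoly list. positive_homogeneous ys \<and> weakly_regular (edge_ideal E) ys \<and> length ys = card F"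
proof -
  let ?I = "edge_ideal E :: ('v, 'k) mpoly set"
  let ?u = "single (set_monomial F) 1 :: ('v, 'k) mpoly"
  have graded: "graded_ideal ?I" by (rule graded_ideal_edge_ideal)
  then have id: "is_ideal ?I" by (simp add: graded_ideal_def)
  have indep: "\<not> e \<subseteq> F" if "e \<in> E" for e using F that by (simp add: maximal_independent_def)
  have "?u \<notin> ?I"
  proof
    assume "?u \<in> ?I"
    then obtain x y where "{x, y} \<in> E" "x \<in> F" "y \<in> F"
      unfolding mem_edge_ideal_iff[OF simple] by (auto simp: lookup_set_monomial split: if_splits)
    then show False using indep by blast
  qed
  moreover have "Var v * ?u \<in> ?I" if v: "v \<notin> F" for v
  proof -
    obtain w where w: "w \<in> F" "{w, v} \<in> E" using F v by (auto simp: maximal_independent_def)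
    have "Var v * ?u = single (single v 1 + set_monomial F) 1"
      by (simp add: Var_def mult_single)
    moreover have "0 < lookup (single v 1 + set_monomial F) x" if "x \<in> {w, v}" for x
      using that w(1) by (auto simp: lookup_add lookup_set_monomial)
    ultimately show ?thesis unfolding mem_edge_ideal_iff[OF simple]
      using w(2) by (intro ballI exI[of _ w] exI[of _ v]) simp
  qed
  ultimately have bound: "length ys \<le> card F"
    if "positive_homogeneous ys" "regular_sequence ?I ys" for ys
    using regular_sequence_length_le[OF graded weakly_regular_if_regular_sequence[OF id that(2)] that(1), of ?u F]
    by blast
  have "depth ?I \<le> enat (card F)"
    unfolding depth_def by (rule SUP_least) (use bound in auto)
  moreover have "enat (card F) \<le> krull_dim ?I"
    by (rule card_le_krull_dim_edge_ideal[OF simple indep])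
  ultimately show krull: "krull_dim ?I = enat (card F)"
    using cm by (simp add: cohen_macaulay_def)
  then have depth: "depth ?I = enat (card F)" using cm by (simp add: cohen_macaulay_def)
  have "1 \<notin> ?I" unfolding mem_edge_ideal_iff[OF simple] by simp
  moreover have "ideal_of (?I \<union> set []) = ?I" using id by (simp only: list.set Un_empty_right ideal.span_eq_iff)
  ultimately have "ideal_of (?I \<union> set []) \<noteq> UNIV" by (metis UNIV_I)
  then have "regular_sequence ?I []" unfolding regular_sequence_def by simp
  moreover have "positive_homogeneous ([] :: ('v, 'k) mpoly list)" by (simp add: positive_homogeneous_def)
  ultimately have "{ys. positive_homogeneous ys \<and> regular_sequence ?I ys} \<noteq> {}" by blast
  from SUP_enat_attained[OF depth[unfolded depth_def] this]
  show "\<exists>ys :: ('v, 'k) mpoly list. positive_homogeneous ys \<and> weakly_regular ?I ys \<and> length ys = card F"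
    using weakly_regular_if_regular_sequence[OF id] by blast
qed

lemma enat_two_power: "enat (2 ^ n) = 2 ^ n"
  by (induction n) (simp_all add: one_enat_def numeral_eq_enat flip: times_enat_simps(1))

section \<open>Pendant triangles\<close>

lemma degree_eq_card_neighbours:
  assumes "simple_graph E"
  shows "degree E v = card {u. {v, u} \<in> E}"
proof -
  have "{e \<in> E. v \<in> e} = (\<lambda>u. {v, u}) ` {u. {v, u} \<in> E}"
  proof (intro equalityI subsetI)
    fix e assume e: "e \<in> {e \<in> E. v \<in> e}"
    then obtain x y where "e = {x, y}" using assms by (auto simp: simple_graph_def card_2_iff)
    then show "e \<in> (\<lambda>u. {v, u}) ` {u. {v, u} \<in> E}" using e by (auto simp: insert_commute)
  qed auto
  moreover have "inj_on (\<lambda>u. {v, u}) {u. {v, u} \<in> E}"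
    by (auto simp: inj_on_def doubleton_eq_iff)
  ultimately show ?thesis by (simp add: degree_def card_image)
qed

context whiskered_triangles
begin

lemma simple: "simple_graph E"
  unfolding simple_graph_def
proof
  fix e assume "e \<in> E"
  from edge_cases[OF this] show "card e = 2"
    by (elim disjE bexE) (use roles_distinct roles_distinct[symmetric] in \<open>auto simp: card_2_iff\<close>)
qed

lemma degree_b: "b \<in> B \<Longrightarrow> degree E b > 2"
proof -
  assume b: "b \<in> B"
  then obtain a where a: "a \<in> A" "{a, b} \<in> E" using attached by blast
  have "card {a, c b, d b} = 3" using roles_distinct a b by (simp add: roles_distinct[symmetric])
  moreover have "{a, c b, d b} \<subseteq> {u. {b, u} \<in> E}" using a triangle[OF b] by (simp add: insert_commute)
  then have "card {a, c b, d b} \<le> card {u. {b, u} \<in> E}" by (rule card_mono[rotated]) simp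
  ultimately show ?thesis by (simp add: degree_eq_card_neighbours[OF simple])
qed

lemma degree_cd: "b \<in> B \<Longrightarrow> degree E (c b) = 2" "b \<in> B \<Longrightarrow> degree E (d b) = 2"
proof -
  assume b: "b \<in> B"
  have "{u. {c b, u} \<in> E} = {b, d b}" "{u. {d b, u} \<in> E} = {b, c b}"
    using edge_iff(1)[OF b] edge_iff(2)[OF b] by auto
  moreover have "b \<noteq> c b" "b \<noteq> d b" using roles_distinct b by metis+
  ultimately show "degree E (c b) = 2" "degree E (d b) = 2"
    by (simp_all add: degree_eq_card_neighbours[OF simple])
qed

text \<open>
  Every edge between two vertices of degree \<open>2\<close> that lies in a triangle is of the form \<open>{c b, d b}\<close>: the
  vertices in \<open>B\<close> have larger degree, and leaves lie in no triangle.
\<close>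

lemma pendant_triangle_iff: "pendant_triangle E T \<longleftrightarrow> (\<exists>b\<in>B. T = {c b, d b, b})"
proof
  assume "pendant_triangle E T"
  then obtain x y z where T: "T = {x, y, z}" "x \<noteq> z" "y \<noteq> z" "{x, y} \<in> E" "{x, z} \<in> E" "{y, z} \<in> E"
    "degree E x = 2" "degree E y = 2" unfolding pendant_triangle_def by blast
  have not_b: "x \<notin> B" "y \<notin> B" using T(7,8) degree_b by fastforce+
  have not_l: "x \<notin> l ` A" "y \<notin> l ` A"
  proof -
    show "x \<notin> l ` A"
    proof
      assume "x \<in> l ` A"
      then obtain a where a: "a \<in> A" "x = l a" by blast
      then show False using T(3-5) edge_iff(3)[OF a(1)] by simp
    qed
    show "y \<notin> l ` A"
    proof
      assume "y \<in> l ` A"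
      then obtain a where a: "a \<in> A" "y = l a" by blast
      then show False using T(2,4,6) edge_iff(3)[OF a(1)] by (simp add: insert_commute)
    qed
  qed
  have "\<exists>b\<in>B. {x, y} = {c b, d b}"
    using edge_cases[OF T(4)] not_b not_l by (auto simp: doubleton_eq_iff)
  then obtain b where b: "b \<in> B" "{x, y} = {c b, d b}" by blast
  then have "z = b" using T(2,3,5,6) edge_iff(1)[OF b(1)] edge_iff(2)[OF b(1)]
    by (auto simp: doubleton_eq_iff)
  then show "\<exists>b\<in>B. T = {c b, d b, b}" using T(1) b by (intro bexI[of _ b]) auto
next
  assume "\<exists>b\<in>B. T = {c b, d b, b}"
  then obtain b where b: "b \<in> B" "T = {c b, d b, b}" by blast
  show "pendant_triangle E T"
    unfolding pendant_triangle_def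
    by (rule exI[of _ "c b"], rule exI[of _ "d b"], rule exI[of _ b])
       (use b triangle[OF b(1)] degree_b[OF b(1)] degree_cd[OF b(1)] roles_distinct in
        \<open>simp add: insert_commute\<close>)
qed

lemma card_pendant_triangles: "card {T. pendant_triangle E T} = card B"
proof -
  have "{T. pendant_triangle E T} = (\<lambda>b. {c b, d b, b}) ` B" by (auto simp: pendant_triangle_iff)
  moreover have "inj_on (\<lambda>b. {c b, d b, b}) B"
  proof (rule inj_onI)
    fix b b' assume b: "b \<in> B" "b' \<in> B" "{c b, d b, b} = {c b', d b', b'}"
    then have "b \<in> {c b', d b', b'}" by blast
    then show "b = b'" using roles_distinct(8)[OF b(1,2)] roles_distinct(9)[OF b(1,2)] by auto
  qed
  ultimately show ?thesis by (simp add: card_image)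
qed

section \<open>The type, computed from one linear system of parameters\<close>

text \<open>
  The variables that remain after the elimination of \<open>l a\<close> and \<open>d b\<close> by means of the linear forms
  \<open>l a - a\<close> and \<open>d b - b - c b\<close>. There is one such form for each \<open>a \<in> A\<close> and each \<open>b \<in> B\<close>, as many as the
  dimension.
\<close>

definition kept :: "'v set" where
  "kept = A \<union> B \<union> c ` B"

definition eliminate :: "'v \<Rightarrow> ('v, 'k::field) mpoly" where
  "eliminate v = (if v \<in> l ` A then Var (the_inv_into A l v)
     else if v \<in> d ` B then Var (the_inv_into B d v) + Var (c (the_inv_into B d v)) else Var v)"

definition lsop :: "('v, 'k::field) mpoly set" where
  "lsop = (\<lambda>a. Var (l a) - Var a) ` A \<union> (\<lambda>b. Var (d b) - Var b - Var (c b)) ` B"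

text \<open>
  The pairs of remaining variables with product zero in the quotient: \<open>b * c b\<close> and \<open>a * b\<close> come from
  edges of \<open>G\<close>. The squares vanish as well: \<open>a * l a\<close> becomes \<open>a ^ 2\<close>, while \<open>b * d b\<close> and \<open>c b * d b\<close>
  become \<open>b ^ 2\<close> and \<open>(c b) ^ 2\<close> up to the product \<open>b * c b\<close>.
\<close>

definition conflict :: "'v \<Rightarrow> 'v \<Rightarrow> bool" where
  "conflict u v \<longleftrightarrow> (\<exists>b\<in>B. {u, v} = {b, c b}) \<or> (\<exists>a\<in>A. \<exists>b\<in>B. {a, b} \<in> E \<and> {u, v} = {a, b})"

definition killed :: "('v \<Rightarrow>\<^sub>0 nat) \<Rightarrow> bool" where
  "killed t \<longleftrightarrow> (\<exists>v\<in>kept. 2 \<le> lookup t v) \<or>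
     (\<exists>u v. conflict u v \<and> 0 < lookup t u \<and> 0 < lookup t v)"

definition killed_ideal :: "('v, 'k::field) mpoly set" where
  "killed_ideal = {f. \<forall>t\<in>keys f. killed t}"

definition lsop_ideal :: "('v, 'k::field) mpoly set" where
  "lsop_ideal = ideal_of (edge_ideal E \<union> lsop)"

lemma conflict_sym: "conflict u v \<longleftrightarrow> conflict v u"
  by (simp add: conflict_def insert_commute)

lemma conflict_edge: "conflict u v \<Longrightarrow> {u, v} \<in> E"
  using triangle(1) by (auto simp: conflict_def)

lemma conflict_neq: "conflict u v \<Longrightarrow> u \<noteq> v"
  using conflict_edge[of u v] simple by (auto simp: simple_graph_def)

lemma conflict_iff:
  "b \<in> B \<Longrightarrow> conflict (c b) u \<longleftrightarrow> u = b"
  "a \<in> A \<Longrightarrow> conflict a u \<longleftrightarrow> u \<in> B \<and> {a, u} \<in> E"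
  "b \<in> B \<Longrightarrow> conflict b u \<longleftrightarrow> u = c b \<or> u \<in> A \<and> {u, b} \<in> E"
proof -
  show "conflict (c b) u \<longleftrightarrow> u = b" if "b \<in> B"
    using that by (auto simp: conflict_def doubleton_eq_iff roles_distinct roles_distinct[symmetric]
        inj_on_eq_iff[OF inj(2)])
  show "conflict a u \<longleftrightarrow> u \<in> B \<and> {a, u} \<in> E" if "a \<in> A"
    using that by (auto simp: conflict_def doubleton_eq_iff roles_distinct roles_distinct[symmetric])
  show "conflict b u \<longleftrightarrow> u = c b \<or> u \<in> A \<and> {u, b} \<in> E" if "b \<in> B"
    using that by (auto simp: conflict_def doubleton_eq_iff roles_distinct roles_distinct[symmetric])
qed

lemma killed_add: "killed t \<Longrightarrow> killed (s + t)"
  unfolding killed_def lookup_add by (meson trans_le_add2 trans_less_add2)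

lemma killed_ideal: "is_ideal killed_ideal"
proof (rule ideal.subspaceI)
  show "0 \<in> killed_ideal" by (simp add: killed_ideal_def)
  show "f + g \<in> killed_ideal" if "f \<in> killed_ideal" "g \<in> killed_ideal" for f g
    using that keys_add[of f g] by (auto simp: killed_ideal_def)
  show "r * f \<in> killed_ideal" if "f \<in> killed_ideal" for r f
    unfolding killed_ideal_def
  proof (intro CollectI ballI)
    fix t assume "t \<in> keys (r * f)"
    then obtain x y where "t = x + y" "y \<in> keys f" using keys_mult[of r f] by blast
    then show "killed t" using that killed_add by (simp add: killed_ideal_def)
  qed
qed

lemma eliminate_simps:
  "a \<in> A \<Longrightarrow> eliminate a = Var a" "a \<in> A \<Longrightarrow> eliminate (l a) = Var a" "b \<in> B \<Longrightarrow> eliminate b = Var b"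
  "b \<in> B \<Longrightarrow> eliminate (c b) = Var (c b)" "b \<in> B \<Longrightarrow> eliminate (d b) = Var b + Var (c b)"
proof -
  show "a \<in> A \<Longrightarrow> eliminate a = Var a" using disjoint(1,4) by (auto simp: eliminate_def)
  show "a \<in> A \<Longrightarrow> eliminate (l a) = Var a" using the_inv_into_f_f[OF inj(1)] by (simp add: eliminate_def)
  show "b \<in> B \<Longrightarrow> eliminate b = Var b" using disjoint(5,9) by (auto simp: eliminate_def)
  show "b \<in> B \<Longrightarrow> eliminate (c b) = Var (c b)" using disjoint(6,10) by (auto simp: eliminate_def)
  show "b \<in> B \<Longrightarrow> eliminate (d b) = Var b + Var (c b)"
    using the_inv_into_f_f[OF inj(3)] disjoint(7) by (auto simp: eliminate_def)
qed

lemma eliminate_kept: "v \<in> kept \<Longrightarrow> eliminate v = Var v"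
  using eliminate_simps by (auto simp: kept_def)

lemma eliminate_cases:
  obtains u where "u \<in> kept" "eliminate w = (Var u :: ('v, 'k::field) mpoly)"
    | b where "b \<in> B" "eliminate w = (Var b + Var (c b) :: ('v, 'k) mpoly)"
  using vertex_cases[of w]
proof (elim disjE imageE)
  fix a assume "a \<in> A" "w = l a"
  then show thesis by (intro that(1)[of a]) (simp_all add: kept_def eliminate_simps)
next
  fix b assume "b \<in> B" "w = d b"
  then show thesis by (intro that(2)[of b]) (simp_all add: eliminate_simps)
qed (rule that(1)[of w], auto simp: kept_def eliminate_simps)+

lemma eliminate_keys:
  fixes f :: "('v, 'b::field) mpoly"
  shows "t \<in> keys (subst eliminate f) \<Longrightarrow> v \<notin> kept \<Longrightarrow> lookup t v = 0"
proof (induction f arbitrary: t rule: mpoly_induct)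
  case (Const c)
  then have "t \<in> keys (Const c)" by simp
  then show ?case by (auto simp: Const_def split: if_splits)
next
  case (Var w)
  have key: "u \<in> kept \<Longrightarrow> t \<in> keys (Var u :: ('v, 'b) mpoly) \<Longrightarrow> lookup t v = 0" for u
    using Var.prems(2) by (auto simp: Var_def lookup_single when_def)
  show ?case
  proof (rule eliminate_cases[of w])
    fix u assume "u \<in> kept" "eliminate w = (Var u :: ('v, 'b) mpoly)"
    then show ?thesis using key Var.prems(1) by simp
  next
    fix b assume b: "b \<in> B" "eliminate w = (Var b + Var (c b) :: ('v, 'b) mpoly)"
    then have "b \<in> kept" "c b \<in> kept" by (auto simp: kept_def)
    then show ?thesis
      using key[of b] key[of "c b"] Var.prems(1) b keys_add[of "Var b :: ('v, 'b) mpoly" "Var (c b)"] by auto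
  qed
next
  case (add f g)
  then show ?case using keys_add[of "subst eliminate f" "subst eliminate g"] by (auto simp: subst_add)
next
  case (mult f g)
  then obtain x y where "t = x + y" "x \<in> keys (subst eliminate f)" "y \<in> keys (subst eliminate g)"
    using keys_mult[of "subst eliminate f" "subst eliminate g"] by (auto simp: subst_mult)
  then show ?case using mult by (simp add: lookup_add)
qed

lemma lsop_ideal_edge: "{u, v} \<in> E \<Longrightarrow> f * (Var u * Var v) \<in> lsop_ideal"
  unfolding lsop_ideal_def edge_ideal_def
  by (intro ideal.span_scale ideal.span_base UnI1) blast

lemma lsop_ideal_lsop: "a \<in> A \<Longrightarrow> f * (Var (l a) - Var a) \<in> lsop_ideal" "b \<in> B \<Longrightarrow> f * (Var (d b) - Var b - Var (c b)) \<in> lsop_ideal"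
  unfolding lsop_ideal_def by (intro ideal.span_scale ideal.span_base UnI2; auto simp: lsop_def)+

lemma lsop_ideal_ideal: "is_ideal lsop_ideal"
  by (simp add: lsop_ideal_def)

lemma diff_subst_eliminate_mem: "f - subst eliminate f \<in> lsop_ideal"
proof (induction f rule: mpoly_induct)
  case (Const c)
  then show ?case by (simp add: ideal.subspace_0[OF lsop_ideal_ideal])
next
  case (Var v)
  show ?case using vertex_cases[of v]
  proof (elim disjE imageE)
    fix a assume "a \<in> A" "v = l a"
    then show ?thesis using lsop_ideal_lsop(1)[of a 1] by (simp add: eliminate_simps)
  next
    fix b assume "b \<in> B" "v = d b"
    then show ?thesis using lsop_ideal_lsop(2)[of b 1] by (simp add: eliminate_simps algebra_simps)
  qed (auto simp: eliminate_simps ideal.subspace_0[OF lsop_ideal_ideal])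
next
  case (add f g)
  from ideal.subspace_add[OF lsop_ideal_ideal this] show ?case by (simp add: subst_add algebra_simps)
next
  case (mult f g)
  have "g * (f - subst eliminate f) + subst eliminate f * (g - subst eliminate g) \<in> lsop_ideal"
    by (intro ideal.subspace_add[OF lsop_ideal_ideal] ideal.subspace_scale[OF lsop_ideal_ideal] mult)
  then show ?case by (simp add: subst_mult algebra_simps)
qed

lemma Var_Var_killed_ideal: 
  "v \<in> kept \<Longrightarrow> Var v * Var v \<in> killed_ideal" "b \<in> B \<Longrightarrow> Var b * Var (c b) \<in> killed_ideal"
  "a \<in> A \<Longrightarrow> b \<in> B \<Longrightarrow> {a, b} \<in> E \<Longrightarrow> Var a * Var b \<in> killed_ideal"
proof -
  show "Var v * Var v \<in> killed_ideal" if "v \<in> kept"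
    using that by (auto simp: Var_mult_Var killed_ideal_def killed_def lookup_add intro!: bexI[of _ v])
  show "Var b * Var (c b) \<in> killed_ideal" if "b \<in> B"
    unfolding Var_mult_Var killed_ideal_def killed_def
    using that by (intro CollectI ballI disjI2 exI[of _ "c b"] exI[of _ b]) (auto simp: lookup_add conflict_iff)
  show "Var a * Var b \<in> killed_ideal" if "a \<in> A" "b \<in> B" "{a, b} \<in> E"
    unfolding Var_mult_Var killed_ideal_def killed_def
    using that by (intro CollectI ballI disjI2 exI[of _ a] exI[of _ b]) (auto simp: lookup_add conflict_iff)
qed

lemma killed_ideal_subset_lsop_ideal:
  fixes f :: "('v, 'k::field) mpoly"
  shows "f \<in> killed_ideal \<Longrightarrow> f \<in> lsop_ideal"
proof (rule mem_ideal_if_keys[OF lsop_ideal_ideal])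
  have sq: "Var v * Var v \<in> (lsop_ideal :: ('v, 'k) mpoly set)" if v: "v \<in> kept" for v
  proof -
    consider "v \<in> A" | "v \<in> B" | b where "b \<in> B" "v = c b" using v by (auto simp: kept_def)
    then show ?thesis
    proof cases
      case 1
      have "1 * (Var v * Var (l v)) - Var v * (Var (l v) - Var v) \<in> lsop_ideal"
        by (intro ideal.subspace_diff[OF lsop_ideal_ideal] lsop_ideal_edge lsop_ideal_lsop whisker 1)
      then show ?thesis by (simp add: algebra_simps)
    next
      case 2
      have "1 * (Var v * Var (d v)) - 1 * (Var v * Var (c v)) - Var v * (Var (d v) - Var v - Var (c v)) \<in> lsop_ideal"
        by (intro ideal.subspace_diff[OF lsop_ideal_ideal] lsop_ideal_edge lsop_ideal_lsop triangle 2)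
      then show ?thesis by (simp add: algebra_simps)
    next
      case 3
      have "1 * (Var (c b) * Var (d b)) - 1 * (Var b * Var (c b)) - Var (c b) * (Var (d b) - Var b - Var (c b)) \<in> lsop_ideal"
        by (intro ideal.subspace_diff[OF lsop_ideal_ideal] lsop_ideal_edge lsop_ideal_lsop triangle 3)
      then show ?thesis using 3 by (simp add: algebra_simps)
    qed
  qed
  have pair: "single t k \<in> (lsop_ideal :: ('v, 'k) mpoly set)"
    if uv: "0 < lookup t u" "0 < lookup t v" "u \<noteq> v" "{u, v} \<in> E" for t u v k
  proof -
    obtain s where "t = s + (single u 1 + single v 1)"
      using pair_divides_iff[OF uv(3)] uv(1,2) by blast
    then have "single t k = single s k * (Var u * Var v)"
      by (simp add: Var_mult_Var mult_single)
    then show ?thesis using lsop_ideal_edge[OF uv(4)] by simp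
  qed
  fix t and k :: 'k assume f: "f \<in> killed_ideal" and t: "t \<in> keys f"
  then have "killed t" by (simp add: killed_ideal_def)
  then show "single t k \<in> lsop_ideal" unfolding killed_def
  proof (elim disjE bexE exE conjE)
    fix v assume "v \<in> kept" "2 \<le> lookup t v"
    then show ?thesis using single_mem_ideal[OF lsop_ideal_ideal, of v 2 t k] sq by (simp add: power2_eq_square)
  next
    fix u v assume "conflict u v" "0 < lookup t u" "0 < lookup t v"
    then show ?thesis using pair conflict_edge conflict_neq by blast
  qed
qed

text \<open>
  Modulo the linear forms every polynomial agrees with the result of the elimination, and the
  elimination turns the edge ideal into the monomial ideal \<open>killed_ideal\<close>.
\<close>

lemma mem_lsop_ideal_iff:
  fixes f :: "('v, 'k::field) mpoly"
  shows "f \<in> lsop_ideal \<longleftrightarrow> subst eliminate f \<in> killed_ideal"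
proof
  assume "subst eliminate f \<in> killed_ideal"
  then have "subst eliminate f + (f - subst eliminate f) \<in> lsop_ideal"
    by (intro ideal.subspace_add[OF lsop_ideal_ideal] killed_ideal_subset_lsop_ideal diff_subst_eliminate_mem)
  then show "f \<in> lsop_ideal" by simp
next
  let ?P = "{f :: ('v, 'k) mpoly. subst eliminate f \<in> killed_ideal}"
  have ideal: "is_ideal ?P"
    by (rule ideal.subspaceI)
       (auto simp: subst_add subst_mult ideal.subspace_0[OF killed_ideal] ideal.subspace_add[OF killed_ideal]
          ideal.subspace_scale[OF killed_ideal])
  have edge: "Var u * Var v \<in> ?P" if "{u, v} \<in> E" for u v
  proof -
    have "(eliminate u * eliminate v :: ('v, 'k) mpoly) \<in> killed_ideal"
      using edge_cases[OF that]
    proof (elim disjE bexE)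
      fix a assume a: "a \<in> A" "{u, v} = {a, l a}"
      then have "(eliminate u * eliminate v :: ('v, 'k) mpoly) = Var a * Var a" by (auto simp: doubleton_eq_iff eliminate_simps)
      then show ?thesis using Var_Var_killed_ideal(1)[of a] a by (simp add: kept_def)
    next
      fix b assume b: "b \<in> B" "{u, v} = {b, c b}"
      then have "(eliminate u * eliminate v :: ('v, 'k) mpoly) = Var b * Var (c b)"
        by (auto simp: doubleton_eq_iff eliminate_simps mult.commute)
      then show ?thesis using Var_Var_killed_ideal(2)[OF b(1)] by simp
    next
      fix b assume b: "b \<in> B" "{u, v} = {b, d b}"
      then have "(eliminate u * eliminate v :: ('v, 'k) mpoly) = Var b * Var b + Var b * Var (c b)"
        by (auto simp: doubleton_eq_iff eliminate_simps algebra_simps)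
      then show ?thesis
        using Var_Var_killed_ideal(1)[of b] Var_Var_killed_ideal(2)[OF b(1)] b ideal.subspace_add[OF killed_ideal]
        by (simp add: kept_def)
    next
      fix b assume b: "b \<in> B" "{u, v} = {c b, d b}"
      then have "(eliminate u * eliminate v :: ('v, 'k) mpoly) = Var (c b) * Var (c b) + Var b * Var (c b)"
        by (auto simp: doubleton_eq_iff eliminate_simps algebra_simps)
      then show ?thesis
        using Var_Var_killed_ideal(1)[of "c b"] Var_Var_killed_ideal(2)[OF b(1)] b ideal.subspace_add[OF killed_ideal]
        by (simp add: kept_def)
    next
      fix a b assume ab: "a \<in> A" "b \<in> B" "{u, v} = {a, b}"
      then have "(eliminate u * eliminate v :: ('v, 'k) mpoly) = Var a * Var b"
        by (auto simp: doubleton_eq_iff eliminate_simps mult.commute)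
      then show ?thesis using Var_Var_killed_ideal(3)[OF ab(1,2)] that ab(3) by simp
    qed
    then show ?thesis by (simp add: subst_mult)
  qed
  have "edge_ideal E \<subseteq> ?P"
    unfolding edge_ideal_def by (rule ideal.span_minimal[OF _ ideal]) (use edge in blast)
  moreover have "lsop \<subseteq> ?P"
  proof
    have sub: "subst eliminate (f - g) = subst eliminate f - subst eliminate g" for f g :: "('v, 'k) mpoly"
      using subst_add[of eliminate "f - g" g] by simp
    fix f :: "('v, 'k) mpoly" assume "f \<in> lsop"
    then show "f \<in> ?P"
      by (auto simp: lsop_def sub eliminate_simps ideal.subspace_0[OF killed_ideal])
  qed
  ultimately have "lsop_ideal \<subseteq> ?P"
    unfolding lsop_ideal_def by (intro ideal.span_minimal[OF _ ideal]) blast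
  moreover assume "f \<in> lsop_ideal"
  ultimately show "subst eliminate f \<in> killed_ideal" by blast
qed

lemma subst_eliminate_single:
  fixes k :: "'k::field"
  assumes "\<And>v. v \<notin> kept \<Longrightarrow> lookup t v = 0"
  shows "subst eliminate (single t k) = single t k"
proof -
  have "eliminate v ^ lookup t v = (Var v ^ lookup t v :: ('v, 'k) mpoly)" for v
    using assms[of v] by (cases "v \<in> kept") (simp_all add: eliminate_kept)
  then have "monom_value eliminate t = (monom_value Var t :: ('v, 'k) mpoly)" by (simp add: monom_value_def)
  then show ?thesis unfolding subst_single by (simp only: single_eq_monom_value)
qed

text \<open>
  The standard monomials form a basis of the quotient ring. They are squarefree, and their supports are
  the independent sets of the conflict graph.
\<close>

definition standard :: "('v \<Rightarrow>\<^sub>0 nat) set" where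
  "standard = {t. (\<forall>v. v \<notin> kept \<longrightarrow> lookup t v = 0) \<and> \<not> killed t}"

text \<open>
  The standard monomials that every remaining variable annihilates; their supports are the maximal
  independent sets of the conflict graph.
\<close>

definition top_standard :: "('v \<Rightarrow>\<^sub>0 nat) set" where
  "top_standard = {t \<in> standard. \<forall>v\<in>kept. killed (single v 1 + t)}"

lemma finite_standard: "finite standard"
proof -
  have "inj_on (\<lambda>t. {v. lookup t v = 1}) standard"
  proof (rule inj_onI)
    fix s t assume st: "s \<in> standard" "t \<in> standard"
      and eq: "{v. lookup s v = 1} = {v. lookup t v = 1}"
    have le: "lookup x v = 0 \<or> lookup x v = 1" if x: "x \<in> standard" for x v
    proof (cases "v \<in> kept")
      case True
      then have "\<not> 2 \<le> lookup x v" using x by (auto simp: standard_def killed_def)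
      then show ?thesis by linarith
    qed (use x in \<open>simp add: standard_def\<close>)
    show "s = t"
    proof (rule poly_mapping_eqI)
      fix v
      have "lookup s v = 1 \<longleftrightarrow> lookup t v = 1" using eq by blast
      then show "lookup s v = lookup t v"
        using le[OF st(1), of v] le[OF st(2), of v] by auto
    qed
  qed
  then show ?thesis by (rule inj_on_finite[of _ _ UNIV]) auto
qed

lemma quotient_dim_lsop_ideal_finite: "quotient_dim UNIV (lsop_ideal :: ('v, 'k::field) mpoly set) < \<infinity>"
proof -
  have "quotient_dim UNIV (lsop_ideal :: ('v, 'k) mpoly set) \<le> enat (card standard)"
  proof (rule quotient_dim_le_card[where \<sigma> = "subst eliminate"])
    fix f :: "('v, 'k) mpoly"
    assume "\<And>t. t \<in> standard \<Longrightarrow> lookup (subst eliminate f) t = 0"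
    then have "t \<notin> standard" if "t \<in> keys (subst eliminate f)" for t
      using that by (auto simp: in_keys_iff)
    then show "f \<in> lsop_ideal"
      using eliminate_keys[of _ f] unfolding mem_lsop_ideal_iff killed_ideal_def standard_def by blast
  qed (simp_all add: finite_standard subst_add subst_mult)
  then show ?thesis by (meson enat_ord_code(4) le_less_trans)
qed

text \<open>
  In a quotient by a monomial ideal the socle is spanned by the monomials that it contains.
\<close>

lemma socle_dim_lsop_ideal: "socle_dim (lsop_ideal :: ('v, 'k::field) mpoly set) = enat (card top_standard)"
  unfolding socle_dim_def
proof (rule antisym)
  let ?W = "{f :: ('v, 'k) mpoly. \<forall>v. Var v * f \<in> lsop_ideal}"
  have fin: "finite top_standard"
    by (rule finite_subset[OF _ finite_standard]) (auto simp: top_standard_def)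
  show "quotient_dim ?W lsop_ideal \<le> enat (card top_standard)"
  proof (rule quotient_dim_le_card[where \<sigma> = "subst eliminate"])
    show "is_ideal ?W"
    proof (rule ideal.subspaceI)
      show "0 \<in> ?W" by (simp add: ideal.subspace_0[OF lsop_ideal_ideal])
      show "f + g \<in> ?W" if "f \<in> ?W" "g \<in> ?W" for f g
        using that by (simp add: distrib_left ideal.subspace_add[OF lsop_ideal_ideal])
      show "r * f \<in> ?W" if "f \<in> ?W" for r f
      proof -
        have "Var v * (r * f) \<in> lsop_ideal" for v
          unfolding mult.left_commute[of "Var v" r f] using that by (simp add: ideal.subspace_scale[OF lsop_ideal_ideal])
        then show ?thesis by simp
      qed
    qed
    fix f assume f: "f \<in> ?W"
      and zero: "\<And>t. t \<in> top_standard \<Longrightarrow> lookup (subst eliminate f) t = 0"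
    have "killed t" if t: "t \<in> keys (subst eliminate f)" for t
    proof (rule ccontr)
      assume nb: "\<not> killed t"
      have "killed (single v 1 + t)" if v: "v \<in> kept" for v
      proof -
        have "Var v * f \<in> lsop_ideal" using f by simp
        then have "Var v * subst eliminate f \<in> killed_ideal" by (simp add: mem_lsop_ideal_iff subst_mult eliminate_kept[OF v])
        moreover have "single v 1 + t \<in> keys (Var v * subst eliminate f)"
          using t by (simp add: in_keys_iff lookup_Var_mult[of v, simplified])
        ultimately show ?thesis by (simp add: killed_ideal_def)
      qed
      then have "t \<in> top_standard"
        using nb eliminate_keys[OF t] by (auto simp: top_standard_def standard_def)
      then show False using zero t by (simp add: in_keys_iff)
    qed
    then show "f \<in> lsop_ideal" by (simp add: mem_lsop_ideal_iff killed_ideal_def)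
  qed (simp_all add: fin subst_add subst_mult)
  show "enat (card top_standard) \<le> quotient_dim ?W lsop_ideal"
  proof (rule card_le_quotient_dim[OF fin])
    fix t assume t: "t \<in> top_standard"
    then have fixed: "subst eliminate (single t 1) = single t (1::'k)"
      by (intro subst_eliminate_single) (auto simp: top_standard_def standard_def)
    have Var_t: "Var v * single t (1::'k) \<in> killed_ideal" if "v \<in> kept" for v
      using t that by (simp add: Var_def mult_single killed_ideal_def top_standard_def)
    have "Var w * single t (1::'k) \<in> lsop_ideal" for w
    proof -
      have "eliminate w * single t (1::'k) \<in> killed_ideal"
      proof (rule eliminate_cases[of w])
        fix u assume "u \<in> kept" "eliminate w = (Var u :: ('v, 'k) mpoly)"
        then show ?thesis using Var_t by simp
      next
        fix b assume b: "b \<in> B" "eliminate w = (Var b + Var (c b) :: ('v, 'k) mpoly)"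
        then have "b \<in> kept" "c b \<in> kept" by (auto simp: kept_def)
        then show ?thesis
          unfolding b(2) distrib_right by (intro ideal.subspace_add[OF killed_ideal] Var_t)
      qed
      then show ?thesis by (simp add: mem_lsop_ideal_iff subst_mult fixed)
    qed
    then show "single t 1 \<in> ?W" by simp
  next
    fix k t assume s: "(\<Sum>t\<in>top_standard. single t (k t)) \<in> (lsop_ideal :: ('v, 'k) mpoly set)"
      and t: "t \<in> top_standard"
    have "subst eliminate (\<Sum>t\<in>top_standard. single t (k t)) = (\<Sum>t\<in>top_standard. single t (k t))"
      unfolding subst_sum
      by (intro sum.cong refl subst_eliminate_single) (auto simp: top_standard_def standard_def)
    then have "(\<Sum>t\<in>top_standard. single t (k t)) \<in> killed_ideal"
      using s by (simp add: mem_lsop_ideal_iff)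
    moreover have "lookup (\<Sum>t\<in>top_standard. single t (k t)) t = k t"
      using t fin by (simp add: lookup_sum lookup_single when_def)
    moreover have "\<not> killed t" using t by (simp add: top_standard_def standard_def)
    ultimately show "k t = 0" by (auto simp: killed_ideal_def in_keys_iff)
  qed
qed

text \<open>
  The maximal independent set of the conflict graph whose intersection with \<open>B\<close> is \<open>X\<close>.
\<close>

definition choice :: "'v set \<Rightarrow> 'v set" where
  "choice X = X \<union> c ` (B - X) \<union> {a \<in> A. \<forall>b\<in>X. {a, b} \<notin> E}"

lemma choice_mem:
  assumes "X \<subseteq> B"
  shows "b \<in> B \<Longrightarrow> b \<in> choice X \<longleftrightarrow> b \<in> X" "b \<in> B \<Longrightarrow> c b \<in> choice X \<longleftrightarrow> b \<notin> X"
    "a \<in> A \<Longrightarrow> a \<in> choice X \<longleftrightarrow> (\<forall>b\<in>X. {a, b} \<notin> E)"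
proof -
  show "b \<in> choice X \<longleftrightarrow> b \<in> X" if "b \<in> B"
    using that disjoint(2,8) by (auto simp: choice_def)
  show "c b \<in> choice X \<longleftrightarrow> b \<notin> X" if "b \<in> B"
  proof -
    have "c b \<in> c ` (B - X) \<longleftrightarrow> b \<notin> X" using inj_on_image_mem_iff[OF inj(2) that, of "B - X"] that by simp
    moreover have "c b \<notin> X" "c b \<notin> A" using that assms disjoint(3,8) by blast+
    ultimately show ?thesis by (simp add: choice_def)
  qed
  show "a \<in> choice X \<longleftrightarrow> (\<forall>b\<in>X. {a, b} \<notin> E)" if "a \<in> A"
    using that disjoint(2,3) assms by (auto simp: choice_def)
qed

lemma killed_single_add_iff:
  assumes t: "\<not> killed t" and w: "w \<in> kept"
  shows "killed (single w 1 + t) \<longleftrightarrow>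
    0 < lookup t w \<or> (\<exists>u. conflict w u \<and> 0 < lookup t u)" (is "?L \<longleftrightarrow> ?R")
proof
  assume ?L
  then show ?R unfolding killed_def
  proof (elim disjE bexE exE conjE)
    fix v assume "v \<in> kept" "2 \<le> lookup (single w 1 + t) v"
    then show ?thesis using t by (cases "v = w") (auto simp: killed_def lookup_add lookup_single)
  next
    fix u v assume uv: "conflict u v" "0 < lookup (single w 1 + t) u"
      "0 < lookup (single w 1 + t) v"
    have pos: "0 < lookup t x" if "x \<noteq> w" "0 < lookup (single w 1 + t) x" for x
      using that by (simp add: lookup_add lookup_single when_def)
    consider "u = w" | "v = w" | "u \<noteq> w" "v \<noteq> w" by blast
    then show ?thesis
    proof cases
      case 1
      then show ?thesis using uv conflict_neq[OF uv(1)] pos[of v] by blast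
    next
      case 2
      then show ?thesis using uv conflict_neq[OF uv(1)] pos[of u] conflict_sym by blast
    next
      case 3
      then show ?thesis using uv pos t unfolding killed_def by blast
    qed
  qed
next
  assume ?R
  then show ?L
  proof (elim disjE exE conjE)
    assume "0 < lookup t w"
    then show ?thesis using w unfolding killed_def by (intro disjI1 bexI[of _ w]) (simp_all add: lookup_add)
  next
    fix u assume "conflict w u" "0 < lookup t u"
    then show ?thesis unfolding killed_def
      by (intro disjI2 exI[of _ w] exI[of _ u]) (simp_all add: lookup_add)
  qed
qed

lemma killed_set_monomial_iff: "killed (set_monomial S) \<longleftrightarrow> (\<exists>u\<in>S. \<exists>v\<in>S. conflict u v)"
  by (auto simp: killed_def lookup_set_monomial split: if_splits)

lemma top_standard_eq: "top_standard = (\<lambda>X. set_monomial (choice X)) ` Pow B"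
proof (intro equalityI subsetI)
  fix t assume t: "t \<in> top_standard"
  then have nb: "\<not> killed t" and supp: "\<And>v. v \<notin> kept \<Longrightarrow> lookup t v = 0"
    by (auto simp: top_standard_def standard_def)
  have max: "0 < lookup t w \<or> (\<exists>u. conflict w u \<and> 0 < lookup t u)" if "w \<in> kept" for w
    using t that killed_single_add_iff[OF nb that] by (simp add: top_standard_def)
  have le: "lookup t v \<le> 1" if "v \<in> kept" for v
    using nb that by (auto simp: killed_def not_le)
  have indep: "\<not> (0 < lookup t u \<and> 0 < lookup t v)" if "conflict u v" for u v
    using nb that by (auto simp: killed_def)
  define X where "X = {b \<in> B. 0 < lookup t b}"
  have XB: "X \<subseteq> B" by (auto simp: X_def)
  have pos: "0 < lookup t v \<longleftrightarrow> v \<in> choice X" for v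
  proof (cases "v \<in> kept")
    case True
    then consider "v \<in> A" | "v \<in> B" | b where "b \<in> B" "v = c b" unfolding kept_def by blast
    then show ?thesis
    proof cases
      case 1
      have "0 < lookup t v \<longleftrightarrow> (\<forall>b\<in>X. {v, b} \<notin> E)"
        using max[OF True] indep[of v] conflict_iff(2)[OF 1] by (auto simp: X_def)
      then show ?thesis using choice_mem(3)[OF XB 1] by simp
    next
      case 2
      then show ?thesis using choice_mem(1)[OF XB 2] by (simp add: X_def)
    next
      case 3
      have "0 < lookup t v \<longleftrightarrow> b \<notin> X"
        using max[OF True] indep[of v b] conflict_iff(1)[OF 3(1)] 3 by (auto simp: X_def)
      then show ?thesis using choice_mem(2)[OF XB 3(1)] 3(2) by simp
    qed
  next
    case False
    moreover have "choice X \<subseteq> kept" using XB by (auto simp: choice_def kept_def)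
    ultimately show ?thesis using supp by auto
  qed
  have "t = set_monomial (choice X)"
  proof (rule poly_mapping_eqI)
    fix v
    show "lookup t v = lookup (set_monomial (choice X)) v"
      using pos[of v] le[of v] supp[of v] by (cases "v \<in> kept") (auto simp: lookup_set_monomial)
  qed
  then show "t \<in> (\<lambda>X. set_monomial (choice X)) ` Pow B" using XB by blast
next
  fix t assume "t \<in> (\<lambda>X. set_monomial (choice X)) ` Pow B"
  then obtain X where X: "X \<subseteq> B" "t = set_monomial (choice X)" by blast
  have sub: "choice X \<subseteq> kept" using X(1) by (auto simp: choice_def kept_def)
  have nb: "\<not> killed t"
    unfolding X(2) killed_set_monomial_iff
  proof (intro notI, elim bexE)
    fix u v assume uv: "u \<in> choice X" "v \<in> choice X" "conflict u v"
    have no_b: False if "b \<in> B" "b \<in> choice X" "w \<in> choice X" "conflict b w" for b w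
    proof -
      have bX: "b \<in> X" using that(2) choice_mem(1)[OF X(1) that(1)] by simp
      have "w = c b \<or> w \<in> A \<and> {w, b} \<in> E" using conflict_iff(3)[OF that(1)] that(4) by simp
      then show False
      proof
        assume "w = c b"
        then show False using that(3) bX choice_mem(2)[OF X(1) that(1)] by simp
      next
        assume "w \<in> A \<and> {w, b} \<in> E"
        then show False using that(3) bX choice_mem(3)[OF X(1), of w] by simp
      qed
    qed
    have "u \<in> B \<or> v \<in> B" using uv(3) by (auto simp: conflict_def doubleton_eq_iff)
    then show False using no_b uv conflict_sym by blast
  qed
  have top: "killed (single w 1 + t)" if w: "w \<in> kept" for w
  proof -
    have "w \<in> choice X \<or> (\<exists>u\<in>choice X. conflict w u)"
    proof -
      consider "w \<in> A" | "w \<in> B" | b where "b \<in> B" "w = c b" using w by (auto simp: kept_def)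
      then show ?thesis
      proof cases
        case 1
        show ?thesis using choice_mem(3)[OF X(1) 1] conflict_iff(2)[OF 1] choice_mem(1)[OF X(1)] X(1) by blast
      next
        case 2
        show ?thesis using choice_mem(1,2)[OF X(1) 2] conflict_iff(3)[OF 2] by blast
      next
        case 3
        show ?thesis using choice_mem(1,2)[OF X(1) 3(1)] conflict_iff(1)[OF 3(1)] 3(2) by blast
      qed
    qed
    then show ?thesis
      unfolding killed_single_add_iff[OF nb w] by (auto simp: X(2) lookup_set_monomial)
  qed
  have supp: "lookup t v = 0" if "v \<notin> kept" for v
    using sub that by (auto simp: X(2) lookup_set_monomial)
  have "t \<in> standard"
    unfolding standard_def by (intro CollectI conjI allI impI supp nb)
  then show "t \<in> top_standard"
    unfolding top_standard_def by (intro CollectI conjI ballI top)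
qed

lemma card_top_standard: "card top_standard = 2 ^ card B"
proof -
  have "inj_on (\<lambda>X. set_monomial (choice X)) (Pow B)"
  proof (rule inj_onI)
    fix X Y assume XY: "X \<in> Pow B" "Y \<in> Pow B" "set_monomial (choice X) = set_monomial (choice Y)"
    have "lookup (set_monomial (choice X)) b = lookup (set_monomial (choice Y)) b" for b
      using XY(3) by (simp only:)
    then have "b \<in> choice X \<longleftrightarrow> b \<in> choice Y" for b
      unfolding lookup_set_monomial by (metis zero_neq_one)
    then show "X = Y" using choice_mem(1)[of X] choice_mem(1)[of Y] XY(1,2) by blast
  qed
  then show ?thesis by (simp add: top_standard_eq card_image card_Pow)
qed

text \<open>
  The linear forms are a homogeneous system of parameters, and all systems of parameters have the same
  socle dimension as the regular sequence \<open>ys\<close>.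
\<close>

lemma cm_type_edge_ideal:
  assumes cm: "cohen_macaulay (edge_ideal E :: ('v, 'k::field) mpoly set)"
  shows "cm_type (edge_ideal E :: ('v, 'k) mpoly set) = 2 ^ card B"
proof -
  let ?I = "edge_ideal E :: ('v, 'k) mpoly set"
  note unmixed = cohen_macaulay_unmixed[OF simple cm maximal_independent_leaves, unfolded card_leaves]
  obtain ys :: "('v, 'k) mpoly list" where ys: "positive_homogeneous ys" "weakly_regular ?I ys" "length ys = card A + card B"
    using unmixed(2) by blast
  obtain al bl where al: "set al = A" "distinct al" and bl: "set bl = B" "distinct bl"
    using finite_distinct_list[of A] finite_distinct_list[of B] by auto
  define \<eta> :: "('v, 'k) mpoly list"
    where "\<eta> = map (\<lambda>a. Var (l a) - Var a) al @ map (\<lambda>b. Var (d b) - Var b - Var (c b)) bl"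
  have set: "set \<eta> = lsop" by (simp add: \<eta>_def lsop_def al bl)
  have len: "length \<eta> = card A + card B"
    using distinct_card[OF al(2)] distinct_card[OF bl(2)] by (simp add: \<eta>_def al bl)
  have hom: "homogeneous_of_degree 1 (Var v :: ('v, 'k) mpoly)" for v
    by (simp add: homogeneous_of_degree_iff Var_def)
  have hom_diff: "homogeneous_of_degree n (f - g)" if "homogeneous_of_degree n f" "homogeneous_of_degree n g"
    for n and f g :: "('v, 'k) mpoly"
    using that keys_diff[of f g] by (auto simp: homogeneous_of_degree_iff)
  have pos: "positive_homogeneous \<eta>"
    unfolding positive_homogeneous_def set lsop_def
    by (auto intro!: exI[of _ 1] hom_diff hom simp del: One_nat_def)
  have lsop_ideal: "ideal_of (?I \<union> set \<eta>) = lsop_ideal" by (simp add: lsop_ideal_def set)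
  have hsop: "is_hsop ?I \<eta>"
    unfolding is_hsop_def lsop_ideal using pos len unmixed(1) quotient_dim_lsop_ideal_finite by simp
  have eq: "socle_dim (ideal_of (?I \<union> set \<theta>)) = socle_dim (ideal_of (?I \<union> set ys))"
    if "is_hsop ?I \<theta>" for \<theta>
  proof (rule socle_dim_hsop[OF graded_ideal_edge_ideal ys(2,1)])
    show "positive_homogeneous \<theta>" "quotient_dim UNIV (ideal_of (?I \<union> set \<theta>)) < \<infinity>"
      using that by (simp_all add: is_hsop_def)
    show "length \<theta> = length ys" using that unmixed(1) ys(3) by (simp add: is_hsop_def)
  qed
  have "socle_dim (ideal_of (?I \<union> set \<eta>)) = enat (2 ^ card B)"
    unfolding lsop_ideal socle_dim_lsop_ideal card_top_standard ..
  then have val: "socle_dim (ideal_of (?I \<union> set \<eta>)) = 2 ^ card B" by (simp only: enat_two_power)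
  show ?thesis
    unfolding cm_type_def
  proof (rule the_equality)
    show "\<forall>\<theta>. is_hsop ?I \<theta> \<longrightarrow> socle_dim (ideal_of (?I \<union> set \<theta>)) = 2 ^ card B"
      using eq val hsop by metis
    show "t = 2 ^ card B" if "\<forall>\<theta>. is_hsop ?I \<theta> \<longrightarrow> socle_dim (ideal_of (?I \<union> set \<theta>)) = t" for t
      using that hsop val by metis
  qed
qed

end

section \<open>The type of a Cohen--Macaulay Cameron--Walker graph\<close>

theorem theorem2p1:
  fixes E :: "'v::finite set set" and m :: nat
  assumes "cameron_walker E"
    and "m = card {T. pendant_triangle E T}"
  shows "(cohen_macaulay (edge_ideal E :: ('v, 'k::field) mpoly set) \<longrightarrow>
            cm_type (edge_ideal E :: ('v, 'k) mpoly set) = 2 ^ m)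
         \<and> \<not> gorenstein (edge_ideal E :: ('v, 'k) mpoly set)"
proof -
  have type: "cm_type (edge_ideal E :: ('v, 'k) mpoly set) = 2 ^ m \<and> m \<noteq> 0"
    if cm: "cohen_macaulay (edge_ideal E :: ('v, 'k) mpoly set)"
  proof -
    have simple: "simple_graph E" using assms(1) by (simp add: cameron_walker_def)
    have "card F = card F'" if "maximal_independent E F" "maximal_independent E F'" for F F'
      using cohen_macaulay_unmixed(1)[OF simple cm that(1)] cohen_macaulay_unmixed(1)[OF simple cm that(2)]
      by simp
    then obtain A B l c d where "whiskered_triangles E A B l c d"
      using cameron_walker_unmixed_structure[OF assms(1)] by metis
    then interpret whiskered_triangles E A B l c d .
    have "m = card B" using assms(2) card_pendant_triangles by simp
    then show ?thesis using cm_type_edge_ideal[OF cm] nonempty by (simp add: card_eq_0_iff)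
  qed
  \<comment> \<open>A Gorenstein ring has type \<open>1\<close>, whereas \<open>m > 0\<close>.\<close>
  moreover have "(2 :: enat) ^ m \<noteq> 1" if "m \<noteq> 0"
  proof
    assume "(2 :: enat) ^ m = 1"
    then show False using that by (simp add: one_enat_def flip: enat_two_power)
  qed
  ultimately show ?thesis by (auto simp: gorenstein_def)
qed

end
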